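(* Let $E\subset\mathbb{C}$ be a compact set that is symmetric with respect to the real axis, regular for the Dirichlet problem, and satisfies $\mathrm{cap}(E)=1$. Let $\{\alpha_n\}$ be a sequence of distinct algebraic integers and let $P_n\in\mathbb{Z}[z]$ denote the (monic) minimal polynomial of $\alpha_n$. Let $\operatorname{Gal}(\alpha_n)\subset\mathbb{C}$ be the set of all Galois conjugates of $\alpha_n$ (the set of complex roots of $P_n$), and assume that $$\operatorname{dist}(\operatorname{Gal}(\alpha_n),E):=\max_{\zeta\in\operatorname{Gal}(\alpha_n)}\ \min_{w\in E}|\zeta-w|\longrightarrow 0\quad\text{as } n\to\infty.$$ Then $$\Gamma\bigl(K_{P_n},\mathrm{Pc}(E)\bigr):=\|g_{P_n}-g_E\|_{L^\infty(\mathbb{C})}\longrightarrow 0,$$ where $g_{P_n}$ is the dynamical Green function of $P_n$ and $g_E$ is the Green function of $\widehat{\mathbb{C}}\setminus\mathrm{Pc}(E)$ with pole at $\infty$. In particular, the Brolin measures $\omega_{P_n}$ converge in the weak-* topology to the equilibrium measure $\mu_E$ of $E$.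
   Context: $\mathrm{cap}(E)$ is the logarithmic capacity: $-\log\mathrm{cap}(E)=\inf_{\nu}\iint\log\frac{1}{|z-w|}\,d\nu(z)\,d\nu(w)$ over Borel probability measures $\nu$ on $E$; when $\mathrm{cap}(E)>0$ the unique minimizer is the equilibrium measure $\mu_E$. The polynomially convex hull $\mathrm{Pc}(E)$ is the complement in $\mathbb{C}$ of the unbounded component of $\mathbb{C}\setminus E$. The Green function is $g_E(z)=\int\log|z-\zeta|\,d\mu_E(\zeta)-\log\mathrm{cap}(E)$ for $z\in\mathbb{C}$; it coincides with the Green function of $\widehat{\mathbb{C}}\setminus\mathrm{Pc}(E)$ with pole at $\infty$ (extended to $\mathrm{Pc}(E)$). $E$ is regular for the Dirichlet problem if it is non-polar and the unbounded component of $\widehat{\mathbb{C}}\setminus E$ is a regular domain for the Dirichlet problem; equivalently, $\mathrm{cap}(E)>0$ and $g_E$ is continuous on $\mathbb{C}$ and vanishes identically on $\mathrm{Pc}(E)$. For a polynomial $P\in\mathbb{C}[z]$ of degree $d\ge 2$: the filled Julia set is $K_P=\{z\in\mathbb{C}:\ \{P^{\circ k}(z)\}_{k\ge 0}\text{ is bounded}\}$; the dynamical Green function is $g_P(z)=\lim_{k\to\infty}d^{-k}\log^+|P^{\circ k}(z)|$, where $\log^+t=\max\{\log t,0\}$; the Brolin measure is $\omega_P=\Delta g_P$, with $\Delta$ the Laplacian in the sense of distributions normalized (i.e. $\frac{1}{2\pi}$ times the usual Laplacian) so that $\omega_P$ is a probability measure. It equals the equilibrium measure of $K_P$. Since these objects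 are defined only for degree $\ge2$, the limits are understood along those $n$ with $\deg P_n\ge2$. *)

theory Defs
  imports
    "HOL-Analysis.Analysis"
    "HOL-Computational_Algebra.Computational_Algebra"
    "HOL-Probability.Probability"
begin

definition prob_measures_on :: "complex set \<Rightarrow> complex measure set" where
  "prob_measures_on E = {\<nu>. sets \<nu> = sets borel \<and> prob_space \<nu> \<and> emeasure \<nu> E = 1}"

(* The diagonal is treated separately because ln 0 = 0 in HOL. *)
definition log_kernel :: "complex \<Rightarrow> complex \<Rightarrow> ereal" where
  "log_kernel z w = (if z = w then \<infinity> else ereal (ln (1 / cmod (z - w))))"

(* Positive part minus negative part, as e2ennreal truncates negative values to 0. On a
   bounded set the kernel is bounded below, so the second integral is then finite and the
   energy is a well-defined element of (-\<infinity>, \<infinity>]. *)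
definition log_energy :: "complex measure \<Rightarrow> ereal" where
  "log_energy \<nu> =
     enn2ereal (\<integral>\<^sup>+ (z, w). e2ennreal (log_kernel z w) \<partial>(\<nu> \<Otimes>\<^sub>M \<nu>))
   - enn2ereal (\<integral>\<^sup>+ (z, w). e2ennreal (- log_kernel z w) \<partial>(\<nu> \<Otimes>\<^sub>M \<nu>))"

definition min_log_energy :: "complex set \<Rightarrow> ereal" where
  "min_log_energy E = (INF \<nu>\<in>prob_measures_on E. log_energy \<nu>)"

definition log_capacity :: "complex set \<Rightarrow> real" where
  "log_capacity E =
     (if min_log_energy E = \<infinity> then 0 else exp (- real_of_ereal (min_log_energy E)))"

(* Meaningful for compact E with positive capacity, where the minimizer is unique. *)
definition equilibrium_measure :: "complex set \<Rightarrow> complex measure" where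
  "equilibrium_measure E =
     (THE \<mu>. \<mu> \<in> prob_measures_on E \<and> log_energy \<mu> = min_log_energy E)"

definition poly_convex_hull :: "complex set \<Rightarrow> complex set" where
  "poly_convex_hull E = - outside E"

(* The integral is a Bochner integral with ln 0 = 0. For compact E of positive capacity this
   is the usual logarithmic potential: \<mu>_E has finite energy, hence no atoms, and by Frostman's
   theorem its potential is finite at every point. *)
definition green_function :: "complex set \<Rightarrow> complex \<Rightarrow> real" where
  "green_function E z =
     (LINT \<zeta>|equilibrium_measure E. ln (cmod (z - \<zeta>))) - ln (log_capacity E)"

(* Stated through the Green function: this is equivalent to E being non-polar and the unbounded
   component of its complement in the Riemann sphere being a regular domain for the Dirichlet
   problem. *)
definition dirichlet_regular :: "complex set \<Rightarrow> bool" where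
  "dirichlet_regular E \<longleftrightarrow>
     log_capacity E > 0 \<and> continuous_on UNIV (green_function E) \<and>
     (\<forall>z\<in>poly_convex_hull E. green_function E z = 0)"

(* Minimality of the degree is over the rationals, as for the usual minimal polynomial. *)
definition is_minimal_int_poly :: "int poly \<Rightarrow> complex \<Rightarrow> bool" where
  "is_minimal_int_poly p \<alpha> \<longleftrightarrow>
     lead_coeff p = 1 \<and> poly (map_poly of_int p) \<alpha> = 0 \<and>
     (\<forall>q :: rat poly. q \<noteq> 0 \<and> poly (map_poly of_rat q) \<alpha> = 0 \<longrightarrow> degree p \<le> degree q)"

definition complex_roots :: "int poly \<Rightarrow> complex set" where
  "complex_roots p = {z. poly (map_poly of_int p) z = 0}"

definition max_dist :: "complex set \<Rightarrow> complex set \<Rightarrow> real" where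
  "max_dist S E = Max ((\<lambda>\<zeta>. infdist \<zeta> E) ` S)"

definition log_plus :: "real \<Rightarrow> real" where
  "log_plus t = max (ln t) 0"

definition dynamical_green :: "complex poly \<Rightarrow> complex \<Rightarrow> real" where
  "dynamical_green p z = lim (\<lambda>k. log_plus (cmod ((poly p ^^ k) z)) / real (degree p) ^ k)"

definition dir_deriv :: "complex \<Rightarrow> (complex \<Rightarrow> real) \<Rightarrow> complex \<Rightarrow> real" where
  "dir_deriv b f z = frechet_derivative f (at z) b"

primrec C_k :: "nat \<Rightarrow> (complex \<Rightarrow> real) \<Rightarrow> bool" where
  "C_k 0 f \<longleftrightarrow> continuous_on UNIV f"
| "C_k (Suc k) f \<longleftrightarrow> f differentiable_on UNIV \<and> (\<forall>b\<in>Basis. C_k k (dir_deriv b f))"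

definition test_function :: "(complex \<Rightarrow> real) \<Rightarrow> bool" where
  "test_function \<phi> \<longleftrightarrow> (\<forall>k. C_k k \<phi>) \<and> compact (closure {z. \<phi> z \<noteq> 0})"

definition laplacian :: "(complex \<Rightarrow> real) \<Rightarrow> complex \<Rightarrow> real" where
  "laplacian \<phi> z = (\<Sum>b\<in>Basis. dir_deriv b (dir_deriv b \<phi>) z)"

(* The distributional Laplacian of the dynamical Green function, divided by 2 pi; the Borel
   probability measure representing it is unique. *)
definition brolin_measure :: "complex poly \<Rightarrow> complex measure" where
  "brolin_measure p =
     (THE \<omega>. sets \<omega> = sets borel \<and> prob_space \<omega> \<and>
        (\<forall>\<phi>. test_function \<phi> \<longrightarrow>
           (LINT z|\<omega>. \<phi> z) = (LINT z|lborel. dynamical_green p z * laplacian \<phi> z) / (2 * pi)))"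

(* The dynamical objects exist only for degree at least 2; limits are taken along those n. *)
definition along_nonlinear :: "(nat \<Rightarrow> int poly) \<Rightarrow> nat filter" where
  "along_nonlinear P = inf sequentially (principal {n. degree (P n) \<ge> 2})"

definition Linf_norm :: "(complex \<Rightarrow> real) \<Rightarrow> ereal" where
  "Linf_norm f = esssup lborel (\<lambda>z. ereal \<bar>f z\<bar>)"

(* Tested against all bounded continuous functions; for probability measures with a probability
   measure as limit this is the same as testing against C_c or C_0. *)
definition weak_star_tendsto ::
    "(nat \<Rightarrow> complex measure) \<Rightarrow> complex measure \<Rightarrow> nat filter \<Rightarrow> bool" where
  "weak_star_tendsto \<omega> \<mu> F \<longleftrightarrow>
     (\<forall>f :: complex \<Rightarrow> real. continuous_on UNIV f \<and> bounded (range f) \<longrightarrow>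
        ((\<lambda>n. LINT z|\<omega> n. f z) \<longlongrightarrow> (LINT z|\<mu>. f z)) F)"

end

theory Submission
  imports
    Defs
    "HOL-Complex_Analysis.Complex_Analysis"
    "HOL-Library.Diagonal_Subsequence"
    "HOL-Real_Asymp.Real_Asymp"
    "Jordan_Normal_Form.Char_Poly"
begin

text \<open>The integer discriminant of $P_n$ is nonzero, so the discrete logarithmic energy of the
  Galois orbit of $\alpha_n$ is at most $0$. The representation
  $\log(D/r) = \int_0^\infty (e^{-tr^2} - e^{-tD^2})\,dt/2t$ writes the logarithmic energy as a
  mixture of Gaussian energies, which are squares of $L^2$-norms. Hence the energy is lower
  semicontinuous and strictly convex, the minimizer $\mu_E$ is unique, and every weak limit of the
  uniform measures on the Galois orbits, having energy at most $0 = -\log \mathrm{cap}(E)$, equals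
  $\mu_E$. Regularity of $E$ turns this equidistribution into uniform convergence of
  $d_n^{-1}\log^+|P_n|$ to $g_E$ on the whole plane, where $d_n = \deg P_n \to \infty$.
  In particular $|d_n^{-1}\log^+|P_n| - \log^+|z||$ is bounded by a constant $C$ independent
  of $n$, and summing the telescoping series that defines $g_{P_n}$ gives
  $|g_{P_n} - d_n^{-1}\log^+|P_n|| \le 2C/d_n$. Weak convergence of the Brolin measures follows
  since they are the distributional Laplacians of the $g_{P_n}$.\<close>

section \<open>Elementary integrals over the plane\<close>

text \<open>The kernel -log|z - w| is unbounded and changes sign, so energies may be infinite and
  cannot be subtracted freely. With all measures in the disc of radius R, measuring distances
  against D = 2R makes log(D/r) a mixture of nonnegative terms, and Tonelli and Fatou apply without
  integrability questions. A Gaussian energy is a square because the product of two Gaussians of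
  exponent 2t integrates to one of exponent t. The uniform measure on d roots has infinite
  logarithmic energy on the diagonal. In the mixture the diagonal contributes exactly 1/d for each
  t, so it can be removed before the limit is taken. Regularity gives the lower bound for log^+|P_n|
  / d_n on E for free, since g_E vanishes there; off E the potentials converge, and the upper bound
  comes from logarithms truncated from below. That g_E is nonnegative is the maximum modulus
  principle for 1/P_n. The Brolin measure is a definite description, so its existence has to be
  proved: it is a weak limit of uniform measures on the iterated preimages of an escaping
  point.\<close>

lemma emeasure_lborel_complex_ball: "r \<ge> 0 \<Longrightarrow> emeasure lborel (ball (c::complex) r) = ennreal (pi * r\<^sup>2)"
  by (subst emeasure_ball) (auto simp: unit_ball_vol_2)

text \<open>Polar coordinates in layer-cake form: a radial function that is a tail integral in s =
  |z|^2 is integrated by Tonelli, because {|z|^2 < s} has area pi s. The three integrals below only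
  require the right density \<open>f\<close>.\<close>

lemma nn_integral_radial_tail:
  fixes f :: "real \<Rightarrow> ennreal"
  assumes [measurable]: "f \<in> borel_measurable borel"
  shows "(\<integral>\<^sup>+z. (\<integral>\<^sup>+s\<in>{(cmod z)\<^sup>2<..}. f s \<partial>lborel) \<partial>lborel)
    = (\<integral>\<^sup>+s\<in>{0<..}. f s * ennreal (pi * s) \<partial>lborel)"
proof -
  have "(\<integral>\<^sup>+z. (\<integral>\<^sup>+s\<in>{(cmod z)\<^sup>2<..}. f s \<partial>lborel) \<partial>lborel)
    = (\<integral>\<^sup>+z. (\<integral>\<^sup>+s. f s * indicator {p. (cmod (fst p))\<^sup>2 < snd p} (z, s) \<partial>lborel) \<partial>lborel)"
    by (intro nn_integral_cong) (auto simp: indicator_def)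
  also have "\<dots> = (\<integral>\<^sup>+s. (\<integral>\<^sup>+z. f s * indicator {p. (cmod (fst p))\<^sup>2 < snd p} (z, s) \<partial>lborel) \<partial>lborel)"
    by (rule lborel_pair.Fubini') measurable
  also have "\<dots> = (\<integral>\<^sup>+s\<in>{0<..}. f s * ennreal (pi * s) \<partial>lborel)"
  proof (rule nn_integral_cong)
    fix s :: real
    have "(\<integral>\<^sup>+z. f s * indicator {p. (cmod (fst p))\<^sup>2 < snd p} (z, s) \<partial>lborel)
       = f s * (\<integral>\<^sup>+z. indicator {z. (cmod z)\<^sup>2 < s} z \<partial>lborel)"
      by (subst nn_integral_cmult[symmetric]) (auto simp: indicator_def intro!: nn_integral_cong)
    also have "(\<integral>\<^sup>+z. indicator {z. (cmod z)\<^sup>2 < s} z \<partial>lborel) = ennreal (pi * s) * indicator {0<..} s"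
    proof (cases "s > 0")
      case True
      have "{z. (cmod z)\<^sup>2 < s} = ball 0 (sqrt s)"
        using True by (auto simp: real_less_rsqrt) (metis norm_ge_zero real_sqrt_less_iff real_sqrt_unique real_less_rsqrt)+
      then show ?thesis using True by (simp add: emeasure_lborel_complex_ball)
    next
      case False
      then have "{z::complex. (cmod z)\<^sup>2 < s} = {}" 
        by (auto simp: not_less intro: order_trans[OF _ zero_le_power2])
      then show ?thesis using False by simp
    qed
    finally show "(\<integral>\<^sup>+z. f s * indicator {p. (cmod (fst p))\<^sup>2 < snd p} (z, s) \<partial>lborel)
        = f s * ennreal (pi * s) * indicator {0<..} s" by (simp add: mult.assoc)
  qed
  finally show ?thesis .
qed

lemma nn_integral_gaussian_complex:
  assumes t: "t > 0"
  shows "(\<integral>\<^sup>+z. ennreal (exp (- t * (cmod z)\<^sup>2)) \<partial>lborel) = ennreal (pi / t)"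
proof -
  have 1: "(\<integral>\<^sup>+s\<in>{a<..}. ennreal (t * exp (- t * s)) \<partial>lborel) = ennreal (exp (- t * a))" for a
  proof -
    have "(\<integral>\<^sup>+s\<in>{a<..}. ennreal (t * exp (- t * s)) \<partial>lborel) = (\<integral>\<^sup>+s\<in>{a..}. ennreal (t * exp (- t * s)) \<partial>lborel)"
      using AE_lborel_singleton[of a]
      by (intro nn_integral_cong_AE) (auto simp: indicator_def)
    also have "\<dots> = ennreal (0 - (- exp (- t * a)))"
    proof (rule nn_integral_FTC_atLeast)
      show "((\<lambda>s. - exp (- t * s)) \<longlongrightarrow> 0) at_top" using t by real_asymp
    qed (use t in \<open>auto intro!: derivative_eq_intros\<close>)
    finally show ?thesis by simp
  qed
  have "(\<integral>\<^sup>+z. ennreal (exp (- t * (cmod z)\<^sup>2)) \<partial>lborel) = (\<integral>\<^sup>+z. (\<integral>\<^sup>+s\<in>{(cmod z)\<^sup>2<..}. ennreal (t * exp (- t * s)) \<partial>lborel) \<partial>lborel)"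
    by (subst 1) simp
  also have "\<dots> = (\<integral>\<^sup>+s\<in>{0<..}. ennreal (t * exp (- t * s)) * ennreal (pi * s) \<partial>lborel)"
    by (rule nn_integral_radial_tail) measurable
  also have "\<dots> = (\<integral>\<^sup>+s\<in>{0..}. ennreal (t * exp (- t * s) * (pi * s)) \<partial>lborel)"
    using t by (intro nn_integral_cong) (auto simp: indicator_def ennreal_mult'[symmetric])
  also have "\<dots> = ennreal (0 - (- pi * (0 + 1/t) * exp (- t * 0)))"
  proof (rule nn_integral_FTC_atLeast)
    show "((\<lambda>s. - pi * (s + 1/t) * exp (- t * s)) \<longlongrightarrow> 0) at_top" using t by real_asymp
    show "((\<lambda>s. - pi * (s + 1/t) * exp (- t * s)) has_real_derivative t * exp (- t * s) * (pi * s)) (at s)" for s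
      using t by (auto intro!: derivative_eq_intros simp: field_simps)
  qed (use t in auto)
  finally show ?thesis by simp
qed

text \<open>The exact cost of truncating ln|z| from below at -M. Since (ln s)/2 has derivative
  1/(2s), the density is 1/(2s) up to s = exp(-2M). By translation the cost is the same for every
  pole, which makes truncation errors uniform over all probability measures.\<close>

lemma nn_integral_log_tail_complex:
  "(\<integral>\<^sup>+z. ennreal (max 0 (- M - ln (cmod z))) \<partial>lborel) = ennreal (pi / 2 * exp (- 2 * M))"
proof -
  let ?f = "\<lambda>s. ennreal (indicator {0<..exp (- 2 * M)} s / (2 * s))"
  have 1: "(\<integral>\<^sup>+s\<in>{(cmod z)\<^sup>2<..}. ?f s \<partial>lborel) = ennreal (max 0 (- M - ln (cmod z)))" if "z \<noteq> 0" for z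
  proof (cases "(cmod z)\<^sup>2 \<le> exp (- 2 * M)")
    case True
    have pos: "(cmod z)\<^sup>2 > 0" using that by simp
    have "(\<integral>\<^sup>+s\<in>{(cmod z)\<^sup>2<..}. ?f s \<partial>lborel) = (\<integral>\<^sup>+s. ennreal (1 / (2 * s)) * indicator {(cmod z)\<^sup>2..exp (- 2 * M)} s \<partial>lborel)"
      using AE_lborel_singleton[of "(cmod z)\<^sup>2"]
    proof (intro nn_integral_cong_AE, eventually_elim)
      case (elim s)
      then show ?case using order_less_le_trans[OF pos, of s] order_less_trans[OF pos, of s]
        by (auto simp: indicator_def simp del: zero_less_power2)
    qed
    also have "\<dots> = ennreal (ln (exp (- 2 * M)) / 2 - ln ((cmod z)\<^sup>2) / 2)"
    proof (rule nn_integral_FTC_Icc[OF _ _ _ True])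
      fix s assume "s \<in> {(cmod z)\<^sup>2..exp (- 2 * M)}"
      then have "s > 0" by (meson pos atLeastAtMost_iff order_less_le_trans)
      then show "((\<lambda>s. ln s / 2) has_real_derivative 1 / (2 * s)) (at s)"
        
        by (auto intro!: derivative_eq_intros simp: field_simps)
      show "1 / (2 * s) \<ge> 0" using \<open>s > 0\<close> by simp
    qed measurable
    also have "ln (exp (- 2 * M)) / 2 - ln ((cmod z)\<^sup>2) / 2 = - M - ln (cmod z)"
      using that by (simp add: ln_realpow)
    also have "\<dots> = max 0 (- M - ln (cmod z))"
    proof -
      have "ln ((cmod z)\<^sup>2) \<le> - 2 * M" using True pos by (metis ln_exp ln_mono exp_gt_zero)
      then show ?thesis using that by (simp add: ln_realpow)
    qed
    finally show ?thesis .
  next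
    case False
    have "(\<integral>\<^sup>+s\<in>{(cmod z)\<^sup>2<..}. ?f s \<partial>lborel) = (\<integral>\<^sup>+(s::real). 0 \<partial>lborel)"
      using False by (intro nn_integral_cong) (auto simp: indicator_def)
    moreover have "ln ((cmod z)\<^sup>2) > - 2 * M" using False that 
      by (metis ln_exp ln_less_cancel_iff exp_gt_zero not_le zero_less_norm_iff zero_less_power)
    then have "max 0 (- M - ln (cmod z)) = 0" using that by (simp add: ln_realpow)
    ultimately show ?thesis by simp
  qed
  have "(\<integral>\<^sup>+z. ennreal (max 0 (- M - ln (cmod z))) \<partial>lborel) = (\<integral>\<^sup>+z. (\<integral>\<^sup>+s\<in>{(cmod z)\<^sup>2<..}. ?f s \<partial>lborel) \<partial>lborel)"
    using AE_lborel_singleton[of 0] by (intro nn_integral_cong_AE, eventually_elim) (subst 1, auto)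
  also have "\<dots> = (\<integral>\<^sup>+s\<in>{0<..}. ?f s * ennreal (pi * s) \<partial>lborel)"
    by (rule nn_integral_radial_tail) measurable
  also have "\<dots> = (\<integral>\<^sup>+s. ennreal (pi / 2) * indicator {0<..exp (- 2 * M)} s \<partial>lborel)"
    by (intro nn_integral_cong) (auto simp: indicator_def ennreal_mult'[symmetric])
  also have "\<dots> = ennreal (pi / 2) * ennreal (exp (- 2 * M))"
    by (subst nn_integral_cmult_indicator) auto
  finally show ?thesis by (simp add: ennreal_mult'[symmetric])
qed

text \<open>The integrand is the Laplacian of \<open>reg_ln e\<close>; its mass 2 pi, independent of
  e, is the normalization of ln|z| as a fundamental solution.\<close>

lemma nn_integral_poisson_complex:
  assumes e: "e > 0"
  shows "(\<integral>\<^sup>+z. ennreal (2 * e\<^sup>2 / ((cmod z)\<^sup>2 + e\<^sup>2)\<^sup>2) \<partial>lborel) = ennreal (2 * pi)"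
proof -
  let ?f = "\<lambda>s. ennreal (4 * e\<^sup>2 / \<bar>s + e\<^sup>2\<bar> ^ 3)"
  have 1: "(\<integral>\<^sup>+s\<in>{a<..}. ?f s \<partial>lborel) = ennreal (2 * e\<^sup>2 / (a + e\<^sup>2)\<^sup>2)" if a: "a \<ge> 0" for a
  proof -
    have p: "s + e\<^sup>2 > 0" if "s \<ge> a" for s using a e that by (simp add: add_nonneg_pos)
    have "(\<integral>\<^sup>+s\<in>{a<..}. ?f s \<partial>lborel) = (\<integral>\<^sup>+s\<in>{a..}. ?f s \<partial>lborel)"
      using AE_lborel_singleton[of a]
      by (intro nn_integral_cong_AE) (auto simp: indicator_def)
    also have "\<dots> = ennreal (0 - (- 2 * e\<^sup>2 / (a + e\<^sup>2)\<^sup>2))"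
    proof (rule nn_integral_FTC_atLeast)
      show "((\<lambda>s. - 2 * e\<^sup>2 / (s + e\<^sup>2)\<^sup>2) \<longlongrightarrow> 0) at_top" using e by real_asymp
      show "((\<lambda>s. - 2 * e\<^sup>2 / (s + e\<^sup>2)\<^sup>2) has_real_derivative 4 * e\<^sup>2 / \<bar>s + e\<^sup>2\<bar> ^ 3) (at s)" if "s \<ge> a" for s
        using p[OF that] by (auto intro!: derivative_eq_intros simp: divide_simps power2_eq_square power3_eq_cube) 
    qed (use e in auto)
    finally show ?thesis by simp
  qed
  have "(\<integral>\<^sup>+z. ennreal (2 * e\<^sup>2 / ((cmod z)\<^sup>2 + e\<^sup>2)\<^sup>2) \<partial>lborel) = (\<integral>\<^sup>+z. (\<integral>\<^sup>+s\<in>{(cmod z)\<^sup>2<..}. ?f s \<partial>lborel) \<partial>lborel)"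
    by (subst 1) auto
  also have "\<dots> = (\<integral>\<^sup>+s\<in>{0<..}. ?f s * ennreal (pi * s) \<partial>lborel)"
    by (rule nn_integral_radial_tail) measurable
  also have "\<dots> = (\<integral>\<^sup>+s\<in>{0..}. ennreal (4 * e\<^sup>2 / \<bar>s + e\<^sup>2\<bar> ^ 3 * (pi * s)) \<partial>lborel)"
    using e by (intro nn_integral_cong) (auto simp: indicator_def ennreal_mult'[symmetric])
  also have "\<dots> = ennreal (0 - (4 * pi * e\<^sup>2 * (e\<^sup>2 / (2 * (0 + e\<^sup>2)\<^sup>2) - 1 / (0 + e\<^sup>2))))"
  proof (rule nn_integral_FTC_atLeast)
    show "((\<lambda>s. 4 * pi * e\<^sup>2 * (e\<^sup>2 / (2 * (s + e\<^sup>2)\<^sup>2) - 1 / (s + e\<^sup>2))) \<longlongrightarrow> 0) at_top" using e by real_asymp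
    show "((\<lambda>s. 4 * pi * e\<^sup>2 * (e\<^sup>2 / (2 * (s + e\<^sup>2)\<^sup>2) - 1 / (s + e\<^sup>2))) has_real_derivative 4 * e\<^sup>2 / \<bar>s + e\<^sup>2\<bar> ^ 3 * (pi * s)) (at s)" if "s \<ge> 0" for s
    proof -
      have p: "s + e\<^sup>2 > 0" using e that by (simp add: add_nonneg_pos)
      show ?thesis using p
        apply (auto intro!: derivative_eq_intros)
        apply (simp add: divide_simps power2_eq_square power3_eq_cube)
        apply (simp add: algebra_simps power4_eq_xxxx)
        done
    qed
  qed (use e in auto)
  also have "(0 - (4 * pi * e\<^sup>2 * (e\<^sup>2 / (2 * (0 + e\<^sup>2)\<^sup>2) - 1 / (0 + e\<^sup>2)))) = 2 * pi"
    using e by (simp add: field_simps power2_eq_square)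
  finally show ?thesis .
qed

section \<open>Test functions\<close>

lemma dir_deriv_eqI: "(f has_derivative f') (at z) \<Longrightarrow> dir_deriv b f z = f' b"
  unfolding dir_deriv_def by (metis frechet_derivative_at)

lemma C_k_Suc_has_derivative:
  assumes "C_k (Suc k) f"
  shows "(f has_derivative frechet_derivative f (at z)) (at z)"
  using assms by (simp add: differentiable_on_def flip: frechet_derivative_works)

lemma C_k_const [intro]: "C_k k (\<lambda>z. c)"
proof (induction k arbitrary: c)
  case (Suc k)
  have "dir_deriv b (\<lambda>z. c) = (\<lambda>z. 0)" for b
    by (rule ext, rule dir_deriv_eqI) (rule has_derivative_const)
  with Suc show ?case by simp
qed simp

lemma C_k_add:
  assumes "C_k k f" "C_k k g"
  shows "C_k k (\<lambda>z. f z + g z)"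
  using assms
proof (induction k arbitrary: f g)
  case (Suc k)
  have "dir_deriv b (\<lambda>z. f z + g z) = (\<lambda>z. dir_deriv b f z + dir_deriv b g z)" for b
    by (rule ext, rule dir_deriv_eqI[THEN trans, OF has_derivative_add[OF Suc.prems[THEN C_k_Suc_has_derivative]]])
       (simp add: dir_deriv_def)
  with Suc show ?case by (simp add: differentiable_on_add)
qed (simp add: continuous_on_add)

lemma C_k_SucD: "C_k (Suc k) f \<Longrightarrow> C_k k f"
proof (induction k arbitrary: f)
  case 0
  then show ?case by (simp add: differentiable_imp_continuous_on)
next
  case (Suc k)
  then show ?case by (metis C_k.simps(2))
qed

lemma C_k_mult:
  assumes "C_k k f" "C_k k g"
  shows "C_k k (\<lambda>z. f z * g z)"
  using assms
proof (induction k arbitrary: f g)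
  case (Suc k)
  have "dir_deriv b (\<lambda>z. f z * g z) = (\<lambda>z. f z * dir_deriv b g z + dir_deriv b f z * g z)" for b
    by (rule ext, rule dir_deriv_eqI[THEN trans, OF has_derivative_mult[OF Suc.prems[THEN C_k_Suc_has_derivative]]])
       (simp add: dir_deriv_def)
  moreover have "C_k k (\<lambda>z. f z * dir_deriv b g z + dir_deriv b f z * g z)" if "b \<in> Basis" for b
    using Suc.prems that Suc.prems[THEN C_k_SucD] by (intro C_k_add Suc.IH) auto
  ultimately show ?case using Suc by (simp add: differentiable_on_mult)
qed (simp add: continuous_on_mult)

text \<open>Differentiating exp(-1/x) produces polynomial factors in 1/x, so the induction cannot
  stay with a single function; it runs over a whole set \<open>S\<close> closed under
  differentiation. The map \<open>l\<close> is affine, as its derivative \<open>L\<close> is the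
  same everywhere.\<close>

lemma C_k_compose_linear:
  fixes S :: "(real \<Rightarrow> real) set"
  assumes S: "\<And>f. f \<in> S \<Longrightarrow> \<exists>g\<in>S. \<forall>x. (f has_real_derivative g x) (at x)"
    and l: "\<And>z. (l has_derivative L) (at z)" and "f \<in> S"
  shows "C_k k (\<lambda>z. f (l z))"
  using \<open>f \<in> S\<close>
proof (induction k arbitrary: f)
  case 0
  obtain g where g: "\<forall>x. (f has_real_derivative g x) (at x)" using S[OF 0] by blast
  then have "continuous_on UNIV f" by (auto intro!: DERIV_continuous_on)
  moreover have "continuous_on UNIV l" 
    using l by (intro differentiable_imp_continuous_on) (metis differentiable_on_def differentiable_def)
  ultimately show ?case by (simp add: continuous_on_compose2[of UNIV f])
next
  case (Suc k)
  obtain g where "g \<in> S" and g: "\<And>x. (f has_real_derivative g x) (at x)" using S[OF Suc.prems] by blast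
  have d: "((\<lambda>z. f (l z)) has_derivative (\<lambda>h. L h * g (l z))) (at z)" for z
    using has_derivative_compose[OF l[of z] g[of "l z", unfolded has_field_derivative_def]]
    by (simp add: mult.commute[of "g _"])
  have "C_k k (\<lambda>z. L b * g (l z))" for b
    by (intro C_k_mult Suc.IH \<open>g \<in> S\<close> C_k_const)
  moreover have "dir_deriv b (\<lambda>z. f (l z)) = (\<lambda>z. L b * g (l z))" for b
    by (rule ext, rule dir_deriv_eqI[OF d])
  moreover have "(\<lambda>z. f (l z)) differentiable_on UNIV" using d
    by (auto simp: differentiable_on_def differentiable_def)
  ultimately show ?case by simp
qed

text \<open>For p = 1 this is the standard flat function exp(-1/x); the polynomial factor makes the
  family closed under differentiation.\<close>

definition flat_fun :: "real poly \<Rightarrow> real \<Rightarrow> real" where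
  "flat_fun p x = (if x > 0 then poly p (1 / x) * exp (- 1 / x) else 0)"

lemma poly_times_exp_neg_tendsto_0: "((\<lambda>y. y ^ k * poly p y * exp (- y)) \<longlongrightarrow> (0::real)) at_top"
proof (induction p arbitrary: k)
  case (pCons a p)
  have "((\<lambda>y. a * (y ^ k / exp y) + y ^ Suc k * poly p y * exp (- y)) \<longlongrightarrow> a * 0 + 0) at_top"
    by (intro tendsto_intros tendsto_power_div_exp_0 pCons.IH)
  then show ?case by (simp add: algebra_simps exp_minus divide_inverse)
qed simp

text \<open>With y = 1/x the chain rule gives y^2 (p - p')(y) exp(-y), and
  \<open>[:0, 0, 1:]\<close> is y^2. At 0 the exponential beats every polynomial.\<close>

lemma flat_fun_has_derivative:
  "(flat_fun p has_real_derivative flat_fun ([:0, 0, 1:] * (p - pderiv p)) x) (at x)"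
proof -
  consider "x > 0" | "x < 0" | "x = 0" by linarith
  then show ?thesis
  proof cases
    case 1
    have "((\<lambda>x. poly p (1 / x) * exp (- 1 / x)) has_real_derivative
        flat_fun ([:0, 0, 1:] * (p - pderiv p)) x) (at x)"
      using 1 by (auto intro!: derivative_eq_intros poly_DERIV[THEN DERIV_chain2] 
          simp: flat_fun_def field_simps power2_eq_square)
    then show ?thesis
      by (rule has_field_derivative_transform_within_open[where S = "{0<..}"]) (use 1 in \<open>auto simp: flat_fun_def\<close>)
  next
    case 2
    have "((\<lambda>x. 0) has_real_derivative flat_fun ([:0, 0, 1:] * (p - pderiv p)) x) (at x)"
      using 2 by (simp add: flat_fun_def)
    then show ?thesis
      by (rule has_field_derivative_transform_within_open[where S = "{..<0}"]) (use 2 in \<open>auto simp: flat_fun_def\<close>)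
  next
    case 3
    have "((\<lambda>h. (1 / h) * poly p (1 / h) * exp (- (1 / h))) \<longlongrightarrow> 0) (at_right 0)"
      using filterlim_compose[OF poly_times_exp_neg_tendsto_0[of 1 p] filterlim_inverse_at_top_right]
      by (simp add: inverse_eq_divide)
    then have "((\<lambda>h. flat_fun p h / h) \<longlongrightarrow> 0) (at_right 0)"
      by (rule Lim_transform_eventually) (auto simp: eventually_at_filter flat_fun_def)
    moreover have "((\<lambda>h. flat_fun p h / h) \<longlongrightarrow> 0) (at_left 0)"
      by (rule tendsto_eventually) (auto simp: eventually_at_filter flat_fun_def)
    ultimately have "((\<lambda>h. flat_fun p h / h) \<longlongrightarrow> 0) (at 0)"
      by (simp add: filterlim_split_at)
    then show ?thesis unfolding 3 DERIV_def by (simp add: flat_fun_def)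
  qed
qed

text \<open>As m grows, each factor tends to the indicator of an open half-plane, so these test
  functions recover the indicator of an open box.\<close>

definition box_bump :: "complex \<Rightarrow> complex \<Rightarrow> nat \<Rightarrow> complex \<Rightarrow> real" where
  "box_bump a b m z = flat_fun 1 (m * Re z - m * Re a) * flat_fun 1 (m * Re b - m * Re z) *
     flat_fun 1 (m * Im z - m * Im a) * flat_fun 1 (m * Im b - m * Im z)"

lemma flat_fun_1_bounds: "0 \<le> flat_fun 1 x" "flat_fun 1 x \<le> 1"
  by (auto simp: flat_fun_def)

lemma box_bump_bounds: "0 \<le> box_bump a b m z" "box_bump a b m z \<le> 1"
  unfolding box_bump_def by (intro mult_nonneg_nonneg mult_le_one flat_fun_1_bounds)+

lemma test_function_box_bump: "test_function (box_bump a b m)"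
  unfolding test_function_def
proof
  have *: "C_k k (\<lambda>z. flat_fun 1 (l z))" if "\<And>z. (l has_derivative L) (at z)" for l L k
    by (rule C_k_compose_linear[where S = "range flat_fun", OF _ that])
       (use flat_fun_has_derivative in blast)+
  show "\<forall>k. C_k k (box_bump a b m)"
    unfolding box_bump_def
    by (intro allI C_k_mult *) (rule derivative_eq_intros refl | simp)+
  have "{z. box_bump a b m z \<noteq> 0} \<subseteq> cbox a b"
  proof
    fix z assume "z \<in> {z. box_bump a b m z \<noteq> 0}"
    then have "m * Re z - m * Re a > 0 \<and> m * Re b - m * Re z > 0 \<and> m * Im z - m * Im a > 0 \<and> m * Im b - m * Im z > 0"
      by (auto simp: box_bump_def flat_fun_def split: if_splits)
    then show "z \<in> cbox a b"
      by (auto simp: in_cbox_complex_iff mult_less_cancel_left)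
  qed
  then have "closure {z. box_bump a b m z \<noteq> 0} \<subseteq> cbox a b"
    by (rule closure_minimal[OF _ closed_cbox])
  then show "compact (closure {z. box_bump a b m z \<noteq> 0})"
    using bounded_subset[OF bounded_cbox] by (simp add: compact_eq_bounded_closed)
qed

lemma test_function_continuous: "test_function \<phi> \<Longrightarrow> continuous_on UNIV \<phi>"
  unfolding test_function_def by (metis C_k.simps(1))

lemma flat_fun_scaled_tendsto: "(\<lambda>m::nat. flat_fun 1 (m * x - m * y)) \<longlonglongrightarrow> (if x > y then 1 else 0)"
proof (cases "x > y")
  case True
  have "(\<lambda>m::nat. exp (- (1 / (real m * (x - y))))) \<longlonglongrightarrow> 1"
    using True by real_asymp
  moreover have "\<forall>\<^sub>F m in sequentially. exp (- (1 / (real m * (x - y)))) = flat_fun 1 (m * x - m * y)"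
    using eventually_gt_at_top[of 0]
  proof eventually_elim
    case (elim m)
    then have "real m * (x - y) > 0" using True by simp
    then show ?case by (simp add: flat_fun_def right_diff_distrib)
  qed
  ultimately have "(\<lambda>m::nat. flat_fun 1 (m * x - m * y)) \<longlonglongrightarrow> 1"
    by (rule Lim_transform_eventually)
  then show ?thesis using True by simp
next
  case False
  then have "flat_fun 1 (m * x - m * y) = 0" for m :: nat
    by (auto simp: flat_fun_def not_less mult_left_mono)
  then show ?thesis using False by simp
qed

lemma box_bump_tendsto: "(\<lambda>m. box_bump a b m z) \<longlonglongrightarrow> indicator (box a b) z"
proof -
  have "(\<lambda>m. box_bump a b m z) \<longlonglongrightarrow> (if Re z > Re a then 1 else 0) * (if Re b > Re z then 1 else 0) *
     (if Im z > Im a then 1 else 0) * (if Im b > Im z then 1 else 0)"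
    unfolding box_bump_def by (intro tendsto_mult flat_fun_scaled_tendsto)
  then show ?thesis by (rule back_subst[where P="\<lambda>x. _ \<longlonglongrightarrow> x"]) (auto simp: in_box_complex_iff indicator_def)
qed

lemma borel_measurable_test_function: "test_function \<phi> \<Longrightarrow> \<phi> \<in> borel_measurable borel"
  by (intro borel_measurable_continuous_onI test_function_continuous)

text \<open>Open boxes are an intersection-stable generator of the Borel sets, and their measures
  are limits of integrals of bumps by dominated convergence.\<close>

lemma measure_eqI_test_function:
  assumes M: "prob_space M" "sets M = sets borel" and N: "prob_space N" "sets N = sets borel"
    and eq: "\<And>\<phi>. test_function \<phi> \<Longrightarrow> (LINT z|M. \<phi> z) = (LINT z|N. \<phi> z)"
  shows "M = N"
proof (rule measure_eqI_generator_eq)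
  let ?E = "range (\<lambda>(a, b). box a b::complex set)"
  show "Int_stable ?E"
    by (auto simp: Int_stable_def box_Int_box)
  show "?E \<subseteq> Pow UNIV" "sets M = sigma_sets UNIV ?E" "sets N = sigma_sets UNIV ?E"
    by (simp_all add: borel_eq_box M N)
  let ?A = "\<lambda>n::nat. box (- (real n *\<^sub>R One)) (real n *\<^sub>R One) :: complex set"
  show "range ?A \<subseteq> ?E" "(\<Union>i. ?A i) = UNIV"
    unfolding UN_box_eq_UNIV by auto
  interpret M: prob_space M by fact
  interpret N: prob_space N by fact
  show "emeasure M (?A i) \<noteq> \<infinity>" for i by auto
  have lim: "(\<lambda>m. LINT z|K. box_bump a b m z) \<longlonglongrightarrow> measure K (box a b)"
    if "prob_space K" and K: "sets K = sets borel" for K a b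
  proof -
    interpret prob_space K by fact
    have "(\<lambda>m. LINT z|K. box_bump a b m z) \<longlonglongrightarrow> (LINT z|K. indicator (box a b) z)"
    proof (rule integral_dominated_convergence[where w = "\<lambda>_. 1"])
      show "box_bump a b m \<in> borel_measurable K" for m
        using borel_measurable_test_function[OF test_function_box_bump] K
        by (simp cong: measurable_cong_sets)
    qed (use K box_bump_tendsto box_bump_bounds in auto)
    then show ?thesis using K by simp
  qed
  show "emeasure M X = emeasure N X" if X: "X \<in> ?E" for X
  proof -
    obtain a b where X: "X = box a b" using X by auto
    have "measure M X = measure N X"
      using lim[OF M, of a b] lim[OF N, of a b] LIMSEQ_unique X
      by (simp add: eq test_function_box_bump)
    then show ?thesis by (simp add: M.emeasure_eq_measure N.emeasure_eq_measure)
  qed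
qed

section \<open>Weak compactness\<close>

text \<open>All continuous functions are tested, also unbounded ones: the measures in question live
  on one compact set. This admits the distance to a set and truncated logarithms.\<close>

definition weak_limit :: "(nat \<Rightarrow> complex measure) \<Rightarrow> complex measure \<Rightarrow> bool" where
  "weak_limit \<nu> \<mu> \<longleftrightarrow> (\<forall>f :: complex \<Rightarrow> real. continuous_on UNIV f \<longrightarrow>
     (\<lambda>n. LINT z|\<nu> n. f z) \<longlonglongrightarrow> (LINT z|\<mu>. f z))"

section \<open>Probability measures carried by a compact set\<close>

lemma prob_measures_onD:
  assumes "\<nu> \<in> prob_measures_on K"
  shows "prob_space \<nu>" "sets \<nu> = sets borel" "space \<nu> = UNIV" "emeasure \<nu> K = 1"
  using assms sets_eq_imp_space_eq[of \<nu> borel] by (auto simp: prob_measures_on_def)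

lemma borel_measurable_prob_measures_on:
  assumes "\<nu> \<in> prob_measures_on K" "f \<in> borel_measurable borel"
  shows "f \<in> borel_measurable \<nu>"
  using assms prob_measures_onD(2)[OF assms(1)] by (simp cong: measurable_cong_sets)

lemma AE_prob_measures_on:
  assumes "\<nu> \<in> prob_measures_on K" "closed K"
  shows "AE z in \<nu>. z \<in> K"
proof -
  interpret prob_space \<nu> using prob_measures_onD(1)[OF assms(1)] .
  show ?thesis using assms prob_measures_onD[OF assms(1)]
    by (intro AE_prob_1) (auto simp: measure_def)
qed

lemma integrable_prob_measures_on:
  fixes f :: "complex \<Rightarrow> real"
  assumes \<nu>: "\<nu> \<in> prob_measures_on K" and "compact K" and f: "f \<in> borel_measurable borel"
    and bound: "\<And>z. z \<in> K \<Longrightarrow> \<bar>f z\<bar> \<le> B"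
  shows "integrable \<nu> f"
proof -
  interpret prob_space \<nu> using prob_measures_onD(1)[OF \<nu>] .
  show ?thesis
  proof (rule integrable_const_bound[where B = B])
    show "AE z in \<nu>. norm (f z) \<le> B"
      using AE_prob_measures_on[OF \<nu> compact_imp_closed[OF \<open>compact K\<close>]]
      by eventually_elim (simp add: bound)
  qed (rule borel_measurable_prob_measures_on[OF \<nu> f])
qed

lemma integrable_continuous_prob_measures_on:
  fixes f :: "complex \<Rightarrow> real"
  assumes \<nu>: "\<nu> \<in> prob_measures_on K" and K: "compact K" and f: "continuous_on UNIV f"
  shows "integrable \<nu> f"
proof -
  have "bounded (f ` K)"
    using K f by (intro compact_imp_bounded compact_continuous_image) (auto intro: continuous_on_subset)
  then obtain B where "\<And>z. z \<in> K \<Longrightarrow> \<bar>f z\<bar> \<le> B" by (auto simp: bounded_iff)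
  then show ?thesis by (intro integrable_prob_measures_on[OF \<nu> K] borel_measurable_continuous_onI f)
qed

lemma integral_mono_prob_measures_on:
  fixes f g :: "complex \<Rightarrow> real"
  assumes \<nu>: "\<nu> \<in> prob_measures_on K" and "closed K" and "integrable \<nu> f" "integrable \<nu> g"
    and "\<And>z. z \<in> K \<Longrightarrow> f z \<le> g z"
  shows "(LINT z|\<nu>. f z) \<le> (LINT z|\<nu>. g z)"
  using AE_prob_measures_on[OF \<nu> \<open>closed K\<close>] assms(5)
  by (intro integral_mono_AE assms(3,4)) (auto elim: eventually_mono)

lemma compact_subset_cball:
  fixes K :: "complex set"
  assumes "compact K"
  obtains R where "R \<ge> 1" "K \<subseteq> cball 0 R"
proof -
  obtain r where "K \<subseteq> ball 0 r"
    using bounded_subset_ballD[OF compact_imp_bounded[OF assms], of 0] by blast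
  then have "K \<subseteq> cball 0 (max r 1)" by force
  then show thesis by (intro that) auto
qed

lemma diagonal_convergent_subsequence:
  fixes a :: "nat \<Rightarrow> nat \<Rightarrow> real"
  assumes "\<And>i k. \<bar>a i k\<bar> \<le> 1"
  obtains r where "strict_mono r" "\<And>i. convergent (\<lambda>k. a i (r k))"
proof -
  let ?P = "\<lambda>i s. convergent (\<lambda>k. a i (s k))"
  interpret D: subseqs ?P
  proof
    fix i and s :: "nat \<Rightarrow> nat"
    have "\<forall>k. a i (s k) \<in> {-1..1}" using assms by (auto simp: abs_le_iff minus_le_iff)
    then have "\<exists>l s'. strict_mono s' \<and> ((\<lambda>k. a i (s k)) \<circ> s') \<longlonglongrightarrow> l"
      using compact_Icc compact_imp_seq_compact seq_compactE by metis
    then show "\<exists>r'. strict_mono r' \<and> ?P i (s \<circ> r')" by (auto simp: comp_def convergent_def)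
  qed
  have "?P i (s \<circ> r)" if "strict_mono r" "?P i s" for r s i
    using that LIMSEQ_subseq_LIMSEQ unfolding convergent_def comp_def by blast
  \<comment> \<open>The diagonal sequence refines the i-th choice only from index i + 1 on, hence
    the shift.\<close>
  then have *: "?P i (D.diagseq \<circ> (+) (Suc i))" for i by (rule D.diagseq_holds)
  have "?P i D.diagseq" for i
    using *[of i] convergent_ignore_initial_segment[of "\<lambda>k. a i (D.diagseq k)" "Suc i"]
    by (simp add: comp_def add.commute)
  with that D.subseq_diagseq show thesis by blast
qed

text \<open>Interleaving the binary digits of the coordinates numbers the dyadic squares of side
  $2^{-n}$ in the unit square so that the four children of square $j$ are $4j, \dots, 4j+3$.\<close>

primrec morton :: "nat \<Rightarrow> complex \<Rightarrow> nat" where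
  "morton 0 w = 0"
| "morton (Suc n) w = 4 * morton n w +
     (2 * nat (\<lfloor>2 ^ Suc n * Re w\<rfloor> mod 2) + nat (\<lfloor>2 ^ Suc n * Im w\<rfloor> mod 2))"

primrec morton_corner :: "nat \<Rightarrow> nat \<Rightarrow> complex" where
  "morton_corner 0 j = 0"
| "morton_corner (Suc n) j = morton_corner n (j div 4) +
     Complex (real (j mod 4 div 2) / 2 ^ Suc n) (real (j mod 2) / 2 ^ Suc n)"

lemma morton_digits_less: "2 * nat (a mod 2) + nat (b mod 2) < 4" for a b :: int
proof -
  have "nat (a mod 2) \<le> 1" "nat (b mod 2) \<le> 1" by (simp_all add: nat_le_iff)
  then show ?thesis by linarith
qed

lemma morton_less: "morton n w < 4 ^ n"
proof (induction n)
  case (Suc n)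
  then show ?case using morton_digits_less[of "\<lfloor>2 ^ Suc n * Re w\<rfloor>" "\<lfloor>2 ^ Suc n * Im w\<rfloor>"]
    unfolding morton.simps power_Suc by linarith
qed simp

lemma morton_Suc_div: "morton (Suc n) w div 4 = morton n w"
  using morton_digits_less[of "\<lfloor>2 ^ Suc n * Re w\<rfloor>" "\<lfloor>2 ^ Suc n * Im w\<rfloor>"]
  unfolding morton.simps by (simp only: div_mult_self4 div_less)

lemma borel_measurable_morton [measurable]: "morton n \<in> borel \<rightarrow>\<^sub>M count_space UNIV"
proof (induction n)
  case (Suc n)
  note [measurable] = Suc.IH
  show ?case unfolding morton.simps by measurable
qed simp

lemma floor_double: "\<lfloor>2 * x\<rfloor> = 2 * \<lfloor>x\<rfloor> + \<lfloor>2 * x\<rfloor> mod 2" for x :: real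
proof -
  have "\<lfloor>2 * x\<rfloor> div 2 = \<lfloor>x\<rfloor>"
    using floor_divide_real_eq_div[of 2 "2 * x"] by simp
  then show ?thesis by (metis mult_div_mod_eq)
qed

text \<open>The last base-4 digit holds the next binary digit of each coordinate, so the corner
  collects both binary expansions cut off after n places. The integer parts are not recorded, which
  is why \<open>w\<close> has to lie in the unit square.\<close>

lemma morton_corner_morton:
  assumes "0 \<le> Re w" "Re w < 1" "0 \<le> Im w" "Im w < 1"
  shows "morton_corner n (morton n w) = Complex (\<lfloor>2 ^ n * Re w\<rfloor> / 2 ^ n) (\<lfloor>2 ^ n * Im w\<rfloor> / 2 ^ n)"
proof (induction n)
  case 0
  have "\<lfloor>Re w\<rfloor> = 0" "\<lfloor>Im w\<rfloor> = 0" using assms by (auto simp: floor_eq_iff)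
  then show ?case by (simp add: complex_eq_iff)
next
  case (Suc n)
  let ?a = "\<lfloor>2 ^ Suc n * Re w\<rfloor>" and ?b = "\<lfloor>2 ^ Suc n * Im w\<rfloor>"
  have d: "morton (Suc n) w div 4 = morton n w" by (rule morton_Suc_div)
  have b: "nat (?b mod 2) < 2" by (simp add: nat_less_iff)
  have m4: "morton (Suc n) w mod 4 = 2 * nat (?a mod 2) + nat (?b mod 2)"
    unfolding morton.simps using morton_digits_less[of ?a ?b] by (simp only: mod_mult_self4 mod_less)
  have 1: "morton (Suc n) w mod 4 div 2 = nat (?a mod 2)"
    unfolding m4 using b by simp
  have 2: "morton (Suc n) w mod 2 = nat (?b mod 2)"
  proof -
    have "morton (Suc n) w mod 2 = morton (Suc n) w mod 4 mod 2" by (simp add: mod_mod_cancel del: morton.simps)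
    then show ?thesis unfolding m4 using b by simp
  qed
  have fa: "real_of_int ?a = 2 * \<lfloor>2 ^ n * Re w\<rfloor> + real (nat (?a mod 2))"
    using arg_cong[OF floor_double[of "2 ^ n * Re w"], of real_of_int] by (simp add: mult.assoc)
  have fb: "real_of_int ?b = 2 * \<lfloor>2 ^ n * Im w\<rfloor> + real (nat (?b mod 2))"
    using arg_cong[OF floor_double[of "2 ^ n * Im w"], of real_of_int] by (simp add: mult.assoc)
  show ?case unfolding morton_corner.simps d 1 2 Suc.IH
    unfolding fa fb by (simp add: complex_eq_iff field_simps)
qed

lemma dist_morton_corner:
  assumes "0 \<le> Re w" "Re w < 1" "0 \<le> Im w" "Im w < 1"
  shows "dist w (morton_corner n (morton n w)) \<le> 2 / 2 ^ n"
proof -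
  have *: "\<bar>x - \<lfloor>2 ^ n * x\<rfloor> / 2 ^ n\<bar> \<le> 1 / 2 ^ n" for x :: real
  proof -
    have "\<bar>2 ^ n * x - \<lfloor>2 ^ n * x\<rfloor>\<bar> \<le> 1" by linarith
    then have "\<bar>2 ^ n * x - \<lfloor>2 ^ n * x\<rfloor>\<bar> / 2 ^ n \<le> 1 / 2 ^ n" by (simp add: divide_right_mono)
    also have "\<bar>2 ^ n * x - \<lfloor>2 ^ n * x\<rfloor>\<bar> / 2 ^ n = \<bar>(2 ^ n * x - \<lfloor>2 ^ n * x\<rfloor>) / 2 ^ n\<bar>" by simp
    also have "(2 ^ n * x - \<lfloor>2 ^ n * x\<rfloor>) / 2 ^ n = x - \<lfloor>2 ^ n * x\<rfloor> / 2 ^ n" by (simp add: field_simps)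
    finally show ?thesis .
  qed
  show ?thesis
    unfolding dist_norm morton_corner_morton[OF assms]
    by (rule order_trans[OF cmod_le]) (use *[of "Re w"] *[of "Im w"] in simp)
qed

lemma dist_morton_corner_Suc: "dist (morton_corner (Suc n) j) (morton_corner n (j div 4)) \<le> (1 / 2) ^ n"
proof -
  have "j mod 4 div 2 \<le> 1" "j mod 2 \<le> 1" by linarith+
  then have "real (j mod 4 div 2) / 2 ^ Suc n \<le> 1 / 2 ^ Suc n" "real (j mod 2) / 2 ^ Suc n \<le> 1 / 2 ^ Suc n"
    by (auto simp: divide_right_mono)
  then show ?thesis
    unfolding dist_norm morton_corner.simps
    by (intro order_trans[OF cmod_le]) (simp add: power_one_over)
qed

lemma convergent_geometric_steps:
  fixes x :: "nat \<Rightarrow> 'a :: banach"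
  assumes "\<And>n. dist (x (Suc n)) (x n) \<le> (1 / 2) ^ n"
  shows "convergent x"
proof -
  have "summable (\<lambda>n. x (Suc n) - x n)"
    by (rule summable_comparison_test[OF _ summable_geometric[of "1 / 2 :: real"]])
       (use assms in \<open>auto simp: dist_norm\<close>)
  then have "convergent (\<lambda>n. \<Sum>i<n. x (Suc i) - x i)" by (simp add: summable_iff_convergent)
  then have "convergent (\<lambda>n. x n - x 0)" by (simp add: sum_lessThan_telescope)
  then have "convergent (\<lambda>n. x n - x 0 + x 0)" by (intro convergent_add convergent_const)
  then show ?thesis by simp
qed

text \<open>A generalized inverse of the distribution function \<open>F n\<close>: each u in [0,1)
  selects at level n the one cell whose mass interval contains it, and compatibility of the levels
  makes the selected cells nested.\<close>

lemma quantile_refinement: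
  fixes F :: "nat \<Rightarrow> nat \<Rightarrow> real"
  assumes mono: "\<And>n. mono (F n)" and F0: "\<And>n. F n 0 = 0" and F1: "\<And>n. F n (4 ^ n) = 1"
    and refine: "\<And>n j. F (Suc n) (4 * j) = F n j"
    and u: "0 \<le> u" "u < 1"
  defines "J \<equiv> \<lambda>n. LEAST j. u < F n (Suc j)"
  shows "J n < 4 ^ n" "u \<in> {F n j..<F n (Suc j)} \<longleftrightarrow> j = J n" "J (Suc n) div 4 = J n"
proof -
  have *: "u < F n (Suc (J n)) \<and> J n < 4 ^ n" for n
  proof -
    have **: "u < F n (Suc (4 ^ n - 1))" using F1 u by simp
    then have "u < F n (Suc (J n))" "J n \<le> 4 ^ n - 1" unfolding J_def by (rule LeastI, rule Least_le)
    moreover have "(4::nat) ^ n > 0" by simp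
    ultimately show ?thesis by linarith
  qed
  show "J n < 4 ^ n" using * by simp
  have low: "F n (J n) \<le> u" for n
  proof (cases "J n")
    case (Suc i)
    then have "\<not> u < F n (Suc i)" using not_less_Least[of i "\<lambda>j. u < F n (Suc j)"] by (simp add: J_def)
    then show ?thesis using Suc by simp
  qed (use F0 u in simp)
  have uniq: "u \<in> {F n j..<F n (Suc j)} \<longleftrightarrow> j = J n" for n j
  proof
    assume a: "u \<in> {F n j..<F n (Suc j)}"
    have "j \<le> J n"
    proof (rule ccontr)
      assume "\<not> j \<le> J n"
      then have "F n (Suc (J n)) \<le> F n j" using mono by (intro monoD[OF mono]) simp
      then show False using a *[of n] by simp
    qed
    moreover have "J n \<le> j" unfolding J_def by (rule Least_le) (use a in simp)
    ultimately show "j = J n" by simp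
  qed (use low * in simp)
  show "u \<in> {F n j..<F n (Suc j)} \<longleftrightarrow> j = J n" by (rule uniq)
  have "F n (J (Suc n) div 4) \<le> F (Suc n) (J (Suc n))"
    by (subst refine[of n, symmetric], intro monoD[OF mono]) simp
  moreover have "F (Suc n) (Suc (J (Suc n))) \<le> F n (Suc (J (Suc n) div 4))"
    by (subst refine[of n, symmetric], intro monoD[OF mono]) presburger
  ultimately have "u \<in> {F n (J (Suc n) div 4)..<F n (Suc (J (Suc n) div 4))}"
    using low[of "Suc n"] *[of "Suc n"] by auto
  then show "J (Suc n) div 4 = J n" using uniq by blast
qed

lemma norm_morton_corner: "norm (morton_corner n j) \<le> 2"
proof -
  have "norm (morton_corner n j) \<le> 2 - 2 * (1 / 2) ^ n"
  proof (induction n arbitrary: j)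
    case (Suc n)
    have "norm (morton_corner (Suc n) j) \<le> dist (morton_corner (Suc n) j) (morton_corner n (j div 4)) + norm (morton_corner n (j div 4))"
      using norm_triangle_sub[of "morton_corner (Suc n) j" "morton_corner n (j div 4)"]
      by (simp add: dist_norm del: morton_corner.simps)
    also have "\<dots> \<le> (1 / 2) ^ n + (2 - 2 * (1 / 2) ^ n)"
      by (intro add_mono dist_morton_corner_Suc Suc.IH)
    finally show ?case by simp
  qed simp
  also have "\<dots> \<le> 2" by simp
  finally show ?thesis .
qed

text \<open>Prokhorov's theorem on a compact set. Along a diagonal subsequence the masses of all
  dyadic cells converge; the limit is then the law of an explicit function on [0,1) with Lebesgue
  measure, namely the limit of the corners of the nested quantile cells. The limiting cell masses
  need not be the masses that \<mu> gives to the cells, as mass may move to a boundary; only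
  integrals of continuous functions are compared.\<close>

lemma weak_compactness:
  fixes \<nu> :: "nat \<Rightarrow> complex measure"
  assumes K: "compact K" and \<nu>: "\<And>k. \<nu> k \<in> prob_measures_on K"
  obtains r \<mu> where "strict_mono r" "\<mu> \<in> prob_measures_on K" "weak_limit (\<nu> \<circ> r) \<mu>"
proof -
  obtain b where b: "\<And>z. z \<in> K \<Longrightarrow> norm z \<le> b" 
    using compact_imp_bounded[OF K] by (auto simp: bounded_iff)
  \<comment> \<open>The added 1 puts \<open>K\<close> strictly inside the square of half-side
    \<open>B\<close>, so that the normalized coordinates of \<open>N z\<close> stay below 1;
    \<open>A\<close> undoes \<open>N\<close>.\<close>
  define B where "B = max b 0 + 1"
  have B: "B > 0" and KB: "\<And>z. z \<in> K \<Longrightarrow> norm z < B"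
    using b unfolding B_def by (auto simp: max_def) fastforce+
  define A where "A w = complex_of_real (2 * B) * w - Complex B B" for w
  define N where "N z = Complex ((Re z + B) / (2 * B)) ((Im z + B) / (2 * B))" for z
  have AN: "A (N z) = z" for z using B by (simp add: A_def N_def complex_eq_iff)
  have N01: "0 \<le> Re (N z)" "Re (N z) < 1" "0 \<le> Im (N z)" "Im (N z) < 1" if "z \<in> K" for z
  proof -
    have "\<bar>Re z\<bar> < B" "\<bar>Im z\<bar> < B" using KB[OF that] abs_Re_le_cmod[of z] abs_Im_le_cmod[of z] by linarith+
    then show "0 \<le> Re (N z)" "Re (N z) < 1" "0 \<le> Im (N z)" "Im (N z) < 1" 
      using B by (auto simp: N_def)
  qed
  have [measurable]: "A \<in> borel_measurable borel" "N \<in> borel_measurable borel"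
  proof -
    show "A \<in> borel_measurable borel" unfolding A_def by measurable
    have "continuous_on UNIV N" unfolding N_def Complex_eq using B by (intro continuous_intros) auto
    then show "N \<in> borel_measurable borel" by (rule borel_measurable_continuous_onI)
  qed
  define q where "q n z = morton n (N z)" for n z
  have q_meas [measurable]: "q n \<in> borel \<rightarrow>\<^sub>M count_space UNIV" for n
    unfolding q_def by measurable
  let ?m = "\<lambda>n j (k::nat). measure (\<nu> k) {z. q n z < j}"
  note prob = prob_measures_onD(1)[OF \<nu>] and sets = prob_measures_onD(2)[OF \<nu>] and spc = prob_measures_onD(3)[OF \<nu>]
  have ms: "{z. q n z < j} \<in> sets (\<nu> k)" "{z. q n z = j} \<in> sets (\<nu> k)" for n j k
    unfolding sets by measurable
  obtain r where r: "strict_mono r" "\<And>i. convergent (\<lambda>k. (\<lambda>i k. ?m (fst (prod_decode i)) (snd (prod_decode i)) k) i (r k))"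
    by (rule diagonal_convergent_subsequence[of "\<lambda>i k. ?m (fst (prod_decode i)) (snd (prod_decode i)) k"])
       (use prob_space.prob_le_1[OF prob] in auto)
  define F where "F n j = lim (\<lambda>k. ?m n j (r k))" for n j
  have F: "(\<lambda>k. ?m n j (r k)) \<longlonglongrightarrow> F n j" for n j
    using r(2)[of "prod_encode (n, j)"] unfolding F_def convergent_LIMSEQ_iff by simp
  have F0: "F n 0 = 0" for n using F[of n 0] by (simp add: LIMSEQ_const_iff)
  have F1: "F n (4 ^ n) = 1" for n
  proof -
    have "?m n (4 ^ n) k = 1" for k
      using prob_space.prob_space[OF prob, of k] spc[of k] by (simp add: q_def morton_less)
    then show ?thesis using F[of n "4 ^ n"] by (simp add: LIMSEQ_const_iff)
  qed
  have Fmono: "mono (F n)" for n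
  proof (rule monoI)
    fix i j :: nat assume "i \<le> j"
    then have "?m n i k \<le> ?m n j k" for k
      by (intro finite_measure.finite_measure_mono[OF prob_space.finite_measure[OF prob]] ms) auto
    then show "F n i \<le> F n j" by (intro LIMSEQ_le[OF F F]) auto
  qed
  have Fref: "F (Suc n) (4 * j) = F n j" for n j
  proof -
    have "q (Suc n) z < 4 * j \<longleftrightarrow> q n z < j" for z
      using morton_Suc_div[of n "N z"] unfolding q_def by (auto simp add: div_less_iff_less_mult mult.commute del: morton.simps)
    then have "?m (Suc n) (4 * j) k = ?m n j k" for k by simp
    then show ?thesis using F[of "Suc n" "4 * j"] F[of n j] LIMSEQ_unique by simp
  qed
  define J where "J n u = (LEAST j. u < F n (Suc j))" for n u
  note J = quantile_refinement[OF Fmono F0 F1 Fref, folded J_def]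
  define M where "M = restrict_space lborel {0..<1::real}"
  have spM: "space M = {0..<1}" unfolding M_def by (simp add: space_restrict_space)
  interpret M: prob_space M unfolding M_def by (rule prob_space_restrict_space) auto
  have measM: "f \<in> borel_measurable M" if "f \<in> borel_measurable borel" for f :: "real \<Rightarrow> 'z::topological_space"
    using that unfolding M_def by (intro measurable_restrict_space1) simp
  \<comment> \<open>The corner of the cell selected by u at level n. The finite sum over cells makes
    measurability visible; \<open>YJ\<close> is the direct form on [0,1).\<close>
  define Y where "Y n u = (\<Sum>j<4 ^ n. indicator {F n j..<F n (Suc j)} u *\<^sub>R morton_corner n j)" for n u
  have Ymeas [measurable]: "Y n \<in> borel_measurable borel" for n unfolding Y_def by measurable
  have ind: "indicator {F n j..<F n (Suc j)} u = (if j = J n u then 1 else 0 :: real)" if "u \<in> space M" for n j u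
    using J(2)[of u n j] that unfolding spM indicator_def by simp
  have YJ: "Y n u = morton_corner n (J n u)" if "u \<in> space M" for n u
    unfolding Y_def using J(1)[of u n] that spM
    by (simp add: ind[OF that] if_distrib[of "\<lambda>x. x *\<^sub>R _"] sum.delta cong: if_cong)
  define X where "X u = lim (\<lambda>n. Y n u)" for u
  have Xmeas [measurable]: "X \<in> borel_measurable borel" unfolding X_def by measurable
  have X: "(\<lambda>n. Y n u) \<longlonglongrightarrow> X u" if u: "u \<in> space M" for u
  proof -
    have "dist (Y (Suc n) u) (Y n u) \<le> (1 / 2) ^ n" for n
      unfolding YJ[OF u] using J(3)[of u n] u dist_morton_corner_Suc[of n "J (Suc n) u"] spM by simp
    then show ?thesis unfolding X_def by (intro convergent_LIMSEQ_iff[THEN iffD1] convergent_geometric_steps)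
  qed
  have Yb: "norm (Y n u) \<le> 2" if "u \<in> space M" for n u unfolding YJ[OF that] by (rule norm_morton_corner)
  have Xb: "norm (X u) \<le> 2" if "u \<in> space M" for u
    using X[OF that] Yb[OF that] by (intro LIMSEQ_le_const2[OF tendsto_norm]) auto
  have Ab: "A w \<in> cball 0 (6 * B)" if "norm w \<le> 2" for w
  proof -
    have "norm (A w) \<le> 2 * B * norm w + norm (Complex B B)"
      unfolding A_def using B by (intro order_trans[OF norm_triangle_ineq4]) (simp add: norm_mult)
    moreover have "norm (Complex B B) \<le> B + B" using cmod_le[of "Complex B B"] B by simp
    moreover have "2 * B * norm w \<le> 2 * B * 2" using B that by (intro mult_left_mono) auto
    ultimately show ?thesis by simp
  qed
  define \<mu> where "\<mu> = distr M borel (\<lambda>u. A (X u))"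
  have AX [measurable]: "(\<lambda>u. A (X u)) \<in> M \<rightarrow>\<^sub>M borel" by (rule measM) measurable
  interpret \<mu>: prob_space \<mu> unfolding \<mu>_def by (rule M.prob_space_distr) measurable
  have lim: "(\<lambda>k. LINT z|\<nu> (r k). f z) \<longlonglongrightarrow> (LINT z|\<mu>. f z)" if f: "continuous_on UNIV f" for f :: "complex \<Rightarrow> real"
  proof -
    have fm [measurable]: "f \<in> borel_measurable borel" by (rule borel_measurable_continuous_onI[OF f])
    have uc: "uniformly_continuous_on (cball 0 (6 * B)) f"
      using f by (intro compact_uniformly_continuous) (auto intro: continuous_on_subset)
    have "bounded (f ` cball 0 (6 * B))"
      using f by (intro compact_imp_bounded compact_continuous_image) (auto intro: continuous_on_subset)
    then obtain c where "\<forall>z\<in>cball 0 (6 * B). \<bar>f z\<bar> \<le> c" by (auto simp: bounded_iff)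
    then have c: "\<bar>f z\<bar> \<le> c" if "z \<in> cball 0 (6 * B)" for z using that by blast
    define S where "S n m = (\<Sum>j<4 ^ n. f (A (morton_corner n j)) * (m (Suc j) - m j))" for n and m :: "nat \<Rightarrow> real"
    have 1: "(LINT u|M. f (A (Y n u))) = S n (F n)" for n
    proof -
      have "(LINT u|M. f (A (Y n u))) = (LINT u|M. (\<Sum>j<4 ^ n. f (A (morton_corner n j)) * indicator {F n j..<F n (Suc j)} u))"
      proof (rule Bochner_Integration.integral_cong[OF refl])
        fix u assume u: "u \<in> space M"
        show "f (A (Y n u)) = (\<Sum>j<4 ^ n. f (A (morton_corner n j)) * indicator {F n j..<F n (Suc j)} u)"
          unfolding YJ[OF u] using J(1)[of u n] u spM
          by (simp add: ind[OF u] if_distrib[of "\<lambda>x. _ * x"] sum.delta cong: if_cong)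
      qed
      also have "\<dots> = (\<Sum>j<4 ^ n. f (A (morton_corner n j)) * (LINT u|M. indicator {F n j..<F n (Suc j)} u))"
      proof (subst Bochner_Integration.integral_sum)
        show "integrable M (\<lambda>u. f (A (morton_corner n j)) * indicator {F n j..<F n (Suc j)} u)" for j
          by (intro integrable_mult_right M.integrable_const_bound[where B = 1] measM) auto
      qed simp
      also have "\<dots> = S n (F n)"
        unfolding S_def
      proof (rule sum.cong[OF refl])
        fix j :: nat assume j: "j \<in> {..<4 ^ n}"
        have le: "0 \<le> F n j" "F n j \<le> F n (Suc j)" "F n (Suc j) \<le> 1"
          using monoD[OF Fmono[of n], of 0 j] monoD[OF Fmono[of n], of "Suc j" "4 ^ n"] monoD[OF Fmono[of n], of j "Suc j"] j F0 F1 by auto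
        then have sub: "{F n j..<F n (Suc j)} \<subseteq> {0..<1}" by auto
        have "(LINT u|M. indicator {F n j..<F n (Suc j)} u) = measure M ({F n j..<F n (Suc j)} \<inter> space M)"
          by (rule Bochner_Integration.integral_indicator)
        also have "\<dots> = measure M {F n j..<F n (Suc j)}" by (simp only: spM Int_absorb2[OF sub])
        also have "\<dots> = F n (Suc j) - F n j" 
          unfolding M_def using le by (subst measure_restrict_space) (use sub in auto)
        finally show "f (A (morton_corner n j)) * (LINT u|M. indicator {F n j..<F n (Suc j)} u) = 
           f (A (morton_corner n j)) * (F n (Suc j) - F n j)" by simp
      qed
      finally show ?thesis .
    qed
    have "(\<lambda>n. LINT u|M. f (A (Y n u))) \<longlonglongrightarrow> (LINT u|M. f (A (X u)))"
    proof (rule integral_dominated_convergence[where w = "\<lambda>_. c"])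
      have "continuous_on UNIV (\<lambda>w. f (A w))"
        unfolding A_def by (intro continuous_on_compose2[OF f] continuous_intros) auto
      then have "((\<lambda>n. f (A (Y n u))) \<longlonglongrightarrow> f (A (X u)))" if "u \<in> space M" for u
        by (rule continuous_on_tendsto_compose[OF _ X[OF that]]) auto
      then show "AE u in M. (\<lambda>n. f (A (Y n u))) \<longlonglongrightarrow> f (A (X u))" by simp
      show "AE u in M. norm (f (A (Y n u))) \<le> c" for n
        using c Ab Yb by simp
    qed (auto intro!: measM)
    moreover have "(LINT u|M. f (A (X u))) = (LINT z|\<mu>. f z)" unfolding \<mu>_def by (subst integral_distr) auto
    ultimately have 2: "(\<lambda>n. S n (F n)) \<longlonglongrightarrow> (LINT z|\<mu>. f z)" by (simp add: 1)
    \<comment> \<open>Replacing \<open>f\<close> by its values at cell corners turns the integral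
      into \<open>S n\<close> of the cumulative masses, with an error bounded by the oscillation of
      \<open>f\<close> on cells, uniformly in k. Hence the level n is fixed first, and then k tends
      to infinity along \<open>r\<close>.\<close>
    have 3: "\<bar>(LINT z|\<nu> k. f z) - S n (\<lambda>j. ?m n j k)\<bar> \<le> e" 
      if e: "\<And>z. z \<in> K \<Longrightarrow> \<bar>f z - f (A (morton_corner n (q n z)))\<bar> \<le> e" for k n e
    proof -
      interpret k: prob_space "\<nu> k" by (rule prob)
      have fi: "integrable (\<nu> k) f" by (rule integrable_continuous_prob_measures_on[OF \<nu> K f])
      define g where "g z = (\<Sum>j<4 ^ n. f (A (morton_corner n j)) * indicator {z. q n z = j} z)" for z
      have gq: "g z = f (A (morton_corner n (q n z)))" for z
        unfolding g_def using morton_less[of n "N z"] 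
        by (simp add: indicator_def q_def if_distrib[of "\<lambda>x. _ * x"] sum.delta cong: if_cong)
      have le: "\<bar>f z - g z\<bar> \<le> e" if "z \<in> K" for z unfolding gq by (rule e[OF that])
      have gint: "integrable (\<nu> k) (\<lambda>z. f (A (morton_corner n j)) * indicator {z. q n z = j} z)" for j
        using ms by (intro integrable_mult_right) (simp add: less_top[symmetric])
      have gi: "integrable (\<nu> k) g" unfolding g_def by (intro Bochner_Integration.integrable_sum gint)
      have "(LINT z|\<nu> k. g z) = (\<Sum>j<4 ^ n. f (A (morton_corner n j)) * measure (\<nu> k) {z. q n z = j})"
        unfolding g_def by (subst Bochner_Integration.integral_sum[OF gint]) (simp add: spc)
      also have "\<dots> = S n (\<lambda>j. ?m n j k)"
      proof -
        have "{z. q n z = j} = {z. q n z < Suc j} - {z. q n z < j}" for j by auto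
        then have "measure (\<nu> k) {z. q n z = j} = ?m n (Suc j) k - ?m n j k" for j
          by (simp only:) (intro k.finite_measure_Diff ms, auto)
        then show ?thesis by (simp add: S_def)
      qed
      finally have "(LINT z|\<nu> k. f z) - S n (\<lambda>j. ?m n j k) = (LINT z|\<nu> k. f z - g z)" 
        using fi gi by simp
      also have "\<bar>\<dots>\<bar> \<le> (LINT z|\<nu> k. \<bar>f z - g z\<bar>)" by (rule integral_abs_bound)
      also have "(LINT z|\<nu> k. \<bar>f z - g z\<bar>) \<le> (LINT z|\<nu> k. e)"
        using fi gi by (intro integral_mono_prob_measures_on[OF \<nu> compact_imp_closed[OF K]]) (auto intro: le)
      finally show ?thesis by (simp add: k.prob_space)
    qed
    show ?thesis
    proof (rule LIMSEQ_I)
      fix e :: real assume "e > 0"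
      then have e: "e / 4 > 0" by simp
      obtain d where d: "d > 0" "\<And>x y. x \<in> cball 0 (6 * B) \<Longrightarrow> y \<in> cball 0 (6 * B) \<Longrightarrow> dist y x < d \<Longrightarrow> dist (f y) (f x) < e / 4"
        using uc e unfolding uniformly_continuous_on_def by meson
      have "(\<lambda>n. 2 * B * (2 / 2 ^ n)) \<longlonglongrightarrow> 0" by real_asymp
      then have "\<forall>\<^sub>F n in sequentially. 2 * B * (2 / 2 ^ n) < d" using d(1) order_tendstoD(2) by blast
      moreover have "\<forall>\<^sub>F n in sequentially. dist (S n (F n)) (LINT z|\<mu>. f z) < e / 4" using 2 e by (rule tendstoD)
      ultimately have "\<forall>\<^sub>F n in sequentially. 2 * B * (2 / 2 ^ n) < d \<and> dist (S n (F n)) (LINT z|\<mu>. f z) < e / 4"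
        by (rule eventually_conj)
      then obtain n where n: "2 * B * (2 / 2 ^ n) < d" "dist (S n (F n)) (LINT z|\<mu>. f z) < e / 4"
        by (auto simp: eventually_sequentially)
      have "\<bar>f z - f (A (morton_corner n (q n z)))\<bar> \<le> e / 4" if z: "z \<in> K" for z
      proof -
        have "dist z (A (morton_corner n (q n z))) = dist (A (N z)) (A (morton_corner n (q n z)))" by (simp add: AN)
        also have "\<dots> = 2 * B * dist (N z) (morton_corner n (q n z))"
          unfolding A_def dist_norm using B by (simp add: norm_mult flip: right_diff_distrib)
        also have "\<dots> \<le> 2 * B * (2 / 2 ^ n)"
          using dist_morton_corner[OF N01[OF z]] B unfolding q_def by (intro mult_left_mono) auto
        finally have "dist z (A (morton_corner n (q n z))) < d" using n(1) by simp
        moreover have "z \<in> cball 0 (6 * B)" using KB[OF z] B by simp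
        ultimately show ?thesis using d(2)[OF Ab[OF norm_morton_corner]] by (fastforce simp: dist_real_def)
      qed
      then have est: "\<bar>(LINT z|\<nu> k. f z) - S n (\<lambda>j. ?m n j k)\<bar> \<le> e / 4" for k by (rule 3)
      have "(\<lambda>k. S n (\<lambda>j. ?m n j (r k))) \<longlonglongrightarrow> S n (F n)"
        unfolding S_def by (intro tendsto_intros F)
      then obtain k0 where k0: "\<And>k. k \<ge> k0 \<Longrightarrow> dist (S n (\<lambda>j. ?m n j (r k))) (S n (F n)) < e / 4"
        using e unfolding lim_sequentially by blast
      then have "norm ((LINT z|\<nu> (r k). f z) - (LINT z|\<mu>. f z)) < e" if "k \<ge> k0" for k
        using est[of "r k"] n(2) k0[OF that] \<open>e > 0\<close> unfolding dist_real_def real_norm_def by linarith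
      then show "\<exists>k0. \<forall>k\<ge>k0. norm ((LINT z|\<nu> (r k). f z) - (LINT z|\<mu>. f z)) < e" by blast
    qed
  qed
  \<comment> \<open>Corners of cells need not lie in \<open>K\<close>, so the support comes from the
    limit itself: the truncated distance to \<open>K\<close> integrates to 0 against every
    \<open>\<nu> k\<close>, hence against \<mu>.\<close>
  have "AE z in \<mu>. z \<in> K"
  proof -
    have "K \<noteq> {}" using prob_measures_onD(4)[OF \<nu>[of 0]] by auto
    let ?f = "\<lambda>z. min 1 (infdist z K)"
    have fc: "continuous_on UNIV ?f" by (intro continuous_intros)
    have "(LINT z|\<nu> k. ?f z) = 0" for k
      using AE_prob_measures_on[OF \<nu> compact_imp_closed[OF K], of k]
      by (intro integral_eq_zero_AE) (auto elim!: eventually_mono)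
    then have "(LINT z|\<mu>. ?f z) = 0" using lim[OF fc] by (simp add: LIMSEQ_const_iff)
    moreover have "integrable \<mu> ?f"
      by (intro \<mu>.integrable_const_bound[where B = 1])
         (use borel_measurable_continuous_onI[OF fc] in \<open>auto simp: infdist_nonneg \<mu>_def\<close>)
    ultimately have "AE z in \<mu>. ?f z = 0"
      by (subst (asm) integral_nonneg_eq_0_iff_AE) (auto simp: infdist_nonneg)
    then show ?thesis
    proof eventually_elim
      case (elim z)
      then have "infdist z K = 0" by (auto simp: min_def split: if_splits)
      then show ?case using compact_imp_closed[OF K] \<open>K \<noteq> {}\<close> by (simp add: in_closed_iff_infdist_zero)
    qed
  qed
  then have "emeasure \<mu> K = 1"
    using \<mu>.emeasure_eq_1_AE[of K] compact_imp_closed[OF K] by (simp add: \<mu>_def)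
  then have "\<mu> \<in> prob_measures_on K"
    using \<mu>.prob_space_axioms by (simp add: prob_measures_on_def \<mu>_def)
  moreover have "weak_limit (\<nu> \<circ> r) \<mu>" using lim by (simp add: weak_limit_def)
  ultimately show thesis using that r(1) by blast
qed

section \<open>Logarithmic energy as a mixture of Gaussian energies\<close>

definition gauss :: "real \<Rightarrow> complex \<Rightarrow> complex \<Rightarrow> real" where
  "gauss t x y = exp (- t * (cmod (x - y))\<^sup>2)"

text \<open>The exponent 2t is chosen so that the product of two such kernels, integrated over the
  plane, is a multiple of the kernel of exponent t.\<close>

definition gauss_potential :: "real \<Rightarrow> complex measure \<Rightarrow> complex \<Rightarrow> real" where
  "gauss_potential t \<nu> u = (LINT x|\<nu>. gauss (2 * t) x u)"

text \<open>Encoded as a square so that nonnegativity and convexity are visible. The factor 4t/pi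
  makes it the double integral of \<open>gauss t\<close>, see
  \<open>gauss_energy_eq\<close>.\<close>

definition gauss_energy :: "real \<Rightarrow> complex measure \<Rightarrow> real" where
  "gauss_energy t \<nu> = 4 * t / pi * (LINT u|lborel. (gauss_potential t \<nu> u)\<^sup>2)"

lemma gauss_bounds: "0 \<le> gauss t x y" "t \<ge> 0 \<Longrightarrow> gauss t x y \<le> 1"
  by (auto simp: gauss_def)

lemma borel_measurable_gauss [measurable (raw)]:
  assumes "h \<in> borel_measurable M" "f \<in> borel_measurable M" "g \<in> borel_measurable M"
  shows "(\<lambda>w. gauss (h w) (f w) (g w)) \<in> borel_measurable M"
  using assms unfolding gauss_def by measurable

text \<open>The parallelogram identity around the midpoint, 2|x-u|^2 + 2|y-u|^2 = |x-y|^2 +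
  4|(x+y)/2 - u|^2. The dependence on u splits off as one Gaussian of known integral.\<close>

lemma gauss_mult: "gauss (2 * t) x u * gauss (2 * t) y u = gauss t x y * gauss (4 * t) ((x + y) / 2) u"
proof -
  have "2 * (cmod (x - u))\<^sup>2 + 2 * (cmod (y - u))\<^sup>2 = (cmod (x - y))\<^sup>2 + 4 * (cmod ((x + y) / 2 - u))\<^sup>2"
    unfolding cmod_power2 by (simp add: field_simps power2_eq_square)
  moreover have "- (2 * t) * A + - (2 * t) * B = - t * C + - (4 * t) * D" if h: "2 * A + 2 * B = C + 4 * D" for A B C D :: real
  proof -
    have "- (2 * t) * A + - (2 * t) * B = - t * (2 * A + 2 * B)" by (simp add: algebra_simps)
    also have "\<dots> = - t * (C + 4 * D)" by (simp only: h)
    finally show ?thesis by (simp add: algebra_simps)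
  qed
  ultimately have "- (2 * t) * (cmod (x - u))\<^sup>2 + - (2 * t) * (cmod (y - u))\<^sup>2 =
      - t * (cmod (x - y))\<^sup>2 + - (4 * t) * (cmod ((x + y) / 2 - u))\<^sup>2"
    by blast
  then show ?thesis unfolding gauss_def by (simp only: exp_add[symmetric])
qed

lemma nn_integral_gauss:
  assumes "t > 0"
  shows "(\<integral>\<^sup>+u. ennreal (gauss t x u) \<partial>lborel) = ennreal (pi / t)"
proof -
  have "(\<integral>\<^sup>+u. ennreal (gauss t x u) \<partial>lborel) = (\<integral>\<^sup>+u. ennreal (gauss t x u) \<partial>distr lborel borel ((+) x))"
    by (simp add: lborel_distr_plus)
  also have "\<dots> = (\<integral>\<^sup>+u. ennreal (exp (- t * (cmod u)\<^sup>2)) \<partial>lborel)"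
    by (subst nn_integral_distr) (auto simp: gauss_def)
  finally show ?thesis using nn_integral_gaussian_complex[OF assms] by simp
qed

text \<open>Frullani's integral: each quotient is the integral of exp(-ts)/2 over s in [a,b], and
  Tonelli leaves the integral of 1/(2s). With a = r^2 and b = D^2 the value is log(D/r).\<close>

lemma frullani_exp:
  assumes a: "0 < a" "a \<le> b"
  shows "(\<integral>\<^sup>+t\<in>{0<..}. ennreal ((exp (- t * a) - exp (- t * b)) / (2 * t)) \<partial>lborel) = ennreal ((ln b - ln a) / 2)"
proof -
  have 1: "ennreal ((exp (- t * a) - exp (- t * b)) / (2 * t)) = (\<integral>\<^sup>+s. ennreal (exp (- t * s) / 2) * indicator {a..b} s \<partial>lborel)"
    if t: "t > 0" for t
  proof -
    have "(\<integral>\<^sup>+s. ennreal (exp (- t * s) / 2) * indicator {a..b} s \<partial>lborel) = ennreal (- exp (- t * b) / (2 * t) - - exp (- t * a) / (2 * t))"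
      by (rule nn_integral_FTC_Icc) (use t a in \<open>auto intro!: derivative_eq_intros\<close>)
    then show ?thesis by (simp add: diff_divide_distrib)
  qed
  have 2: "(\<integral>\<^sup>+t\<in>{0<..}. ennreal (exp (- t * s) / 2) \<partial>lborel) = ennreal (1 / (2 * s))" if s: "s > 0" for s
  proof -
    have "(\<integral>\<^sup>+t\<in>{0<..}. ennreal (exp (- t * s) / 2) \<partial>lborel) = (\<integral>\<^sup>+t\<in>{0..}. ennreal (exp (- t * s) / 2) \<partial>lborel)"
      using AE_lborel_singleton[of 0]
      by (intro nn_integral_cong_AE) (auto simp: indicator_def)
    also have "\<dots> = ennreal (0 - (- exp (- 0 * s) / (2 * s)))"
    proof (rule nn_integral_FTC_atLeast)
      show "((\<lambda>t. - exp (- t * s) / (2 * s)) \<longlongrightarrow> 0) at_top" using s by real_asymp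
    qed (use s in \<open>auto intro!: derivative_eq_intros\<close>)
    finally show ?thesis by simp
  qed
  have "(\<integral>\<^sup>+t\<in>{0<..}. ennreal ((exp (- t * a) - exp (- t * b)) / (2 * t)) \<partial>lborel)
     = (\<integral>\<^sup>+t. (\<integral>\<^sup>+s. ennreal (exp (- t * s) / 2) * indicator {a..b} s * indicator {0<..} t \<partial>lborel) \<partial>lborel)"
  proof (rule nn_integral_cong)
    fix t :: real
    show "ennreal ((exp (- t * a) - exp (- t * b)) / (2 * t)) * indicator {0<..} t
       = (\<integral>\<^sup>+s. ennreal (exp (- t * s) / 2) * indicator {a..b} s * indicator {0<..} t \<partial>lborel)"
    proof (cases "t > 0")
      case True
      then show ?thesis unfolding 1[OF True] by simp
    qed simp
  qed
  also have "\<dots> = (\<integral>\<^sup>+s. (\<integral>\<^sup>+t. ennreal (exp (- t * s) / 2) * indicator {a..b} s * indicator {0<..} t \<partial>lborel) \<partial>lborel)"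
    by (rule lborel_pair.Fubini') measurable
  also have "\<dots> = (\<integral>\<^sup>+s. ennreal (1 / (2 * s)) * indicator {a..b} s \<partial>lborel)"
  proof (rule nn_integral_cong)
    fix s :: real
    show "(\<integral>\<^sup>+t. ennreal (exp (- t * s) / 2) * indicator {a..b} s * indicator {0<..} t \<partial>lborel)
       = ennreal (1 / (2 * s)) * indicator {a..b} s"
    proof (cases "s \<in> {a..b}")
      case True
      then show ?thesis using 2[of s] a by simp
    qed simp
  qed
  also have "\<dots> = ennreal (ln b / 2 - ln a / 2)"
    by (rule nn_integral_FTC_Icc) (use a in \<open>auto intro!: derivative_eq_intros simp: field_simps\<close>)
  finally show ?thesis by (simp add: diff_divide_distrib)
qed

text \<open>The diagonal case a = 0, matching the value \<infinity> of \<open>log_kernel\<close>: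
  the integrand dominates those for all positive a, whose integrals are unbounded.\<close>

lemma frullani_exp_0:
  assumes b: "0 < b"
  shows "(\<integral>\<^sup>+t\<in>{0<..}. ennreal ((1 - exp (- t * b)) / (2 * t)) \<partial>lborel) = \<infinity>"
proof (rule ccontr)
  let ?I = "\<integral>\<^sup>+t\<in>{0<..}. ennreal ((1 - exp (- t * b)) / (2 * t)) \<partial>lborel"
  assume "?I \<noteq> \<infinity>"
  then obtain c where c: "?I = ennreal c" "c \<ge> 0" by (cases ?I) auto
  \<comment> \<open>Chosen such that (ln b - ln a)/2 = c + 1 exceeds the alleged value.\<close>
  define a where "a = b * exp (- 2 * c - 2)"
  have a: "0 < a" "a \<le> b" using b c by (auto simp: a_def mult_le_cancel_left1)
  have "ennreal ((ln b - ln a) / 2) = (\<integral>\<^sup>+t\<in>{0<..}. ennreal ((exp (- t * a) - exp (- t * b)) / (2 * t)) \<partial>lborel)"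
    by (rule frullani_exp[OF a, symmetric])
  also have "\<dots> \<le> ?I"
    using a by (intro nn_integral_mono) (auto simp: indicator_def intro!: ennreal_leI divide_right_mono)
  finally have "(ln b - ln a) / 2 \<le> c" using c by simp
  moreover have "ln a = ln b - 2 * c - 2" using b by (simp add: a_def ln_mult)
  ultimately show False by simp
qed

lemma borel_measurable_gauss_potential [measurable]:
  assumes "\<nu> \<in> prob_measures_on K"
  shows "gauss_potential t \<nu> \<in> borel_measurable borel"
proof -
  note [measurable_cong] = prob_measures_onD(2)[OF assms]
  interpret prob_space \<nu> using prob_measures_onD(1)[OF assms] .
  show ?thesis unfolding gauss_potential_def by measurable
qed

lemma integrable_gauss:
  assumes "\<nu> \<in> prob_measures_on K" "t \<ge> 0"
  shows "integrable \<nu> (\<lambda>x. gauss t x u)"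
proof -
  note [measurable_cong] = prob_measures_onD(2)[OF assms(1)]
  interpret prob_space \<nu> using prob_measures_onD(1)[OF assms(1)] .
  show ?thesis by (rule integrable_const_bound[where B = 1]) (use gauss_bounds assms(2) in auto)
qed

lemma gauss_potential_bounds:
  assumes "\<nu> \<in> prob_measures_on K" "t \<ge> 0"
  shows "0 \<le> gauss_potential t \<nu> u" "gauss_potential t \<nu> u \<le> 1"
proof -
  interpret prob_space \<nu> using prob_measures_onD(1)[OF assms(1)] .
  show "0 \<le> gauss_potential t \<nu> u" unfolding gauss_potential_def by (simp add: gauss_bounds)
  have "gauss_potential t \<nu> u \<le> (LINT x|\<nu>. 1)" unfolding gauss_potential_def
    by (intro integral_mono integrable_gauss[OF assms(1)]) (use assms(2) in \<open>auto simp: gauss_bounds\<close>)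
  then show "gauss_potential t \<nu> u \<le> 1" by (simp add: prob_space)
qed

text \<open>A Gaussian majorant that depends on the disc but not on the measure: |u|^2 \<le> 2|x|^2
  + 2|x-u|^2 moves the centre to 0, and squaring is harmless as the potential is at most 1. It
  serves as dominating function in limits of integrals over u.\<close>

lemma gauss_potential_decay:
  assumes \<nu>: "\<nu> \<in> prob_measures_on K" and K: "compact K" "K \<subseteq> cball 0 R" and t: "t \<ge> 0"
  shows "(gauss_potential t \<nu> u)\<^sup>2 \<le> exp (2 * t * R\<^sup>2) * gauss t 0 u"
proof -
  interpret prob_space \<nu> using prob_measures_onD(1)[OF \<nu>] .
  have "(gauss_potential t \<nu> u)\<^sup>2 \<le> gauss_potential t \<nu> u"
    unfolding power2_eq_square using gauss_potential_bounds[OF \<nu> t] by (intro mult_left_le) auto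
  also have "\<dots> \<le> (LINT x|\<nu>. exp (2 * t * R\<^sup>2) * gauss t 0 u)"
    unfolding gauss_potential_def
  proof (rule integral_mono_prob_measures_on[OF \<nu> compact_imp_closed[OF K(1)]])
    fix x assume "x \<in> K"
    then have "norm x \<le> R" using K by auto
    then have R: "(cmod x)\<^sup>2 \<le> R\<^sup>2" by (intro power_mono) auto
    have "(cmod u)\<^sup>2 \<le> 2 * (cmod x)\<^sup>2 + 2 * (cmod (x - u))\<^sup>2"
    proof -
      have "(cmod u)\<^sup>2 \<le> (cmod x + cmod (x - u))\<^sup>2"
        by (intro power_mono) (metis add_diff_cancel_left' norm_triangle_ineq4 diff_diff_eq2 add_diff_cancel, simp)
      also have "\<dots> \<le> 2 * (cmod x)\<^sup>2 + 2 * (cmod (x - u))\<^sup>2"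
        using sum_squares_bound[of "cmod x" "cmod (x - u)"] by (simp add: power2_sum)
      finally show ?thesis .
    qed
    then have "t * (cmod u)\<^sup>2 \<le> t * (2 * R\<^sup>2 + 2 * (cmod (x - u))\<^sup>2)"
      using R t by (intro mult_left_mono) auto
    then show "gauss (2 * t) x u \<le> exp (2 * t * R\<^sup>2) * gauss t 0 u"
      unfolding gauss_def exp_add[symmetric] by (simp add: algebra_simps)
  qed (use t integrable_gauss[OF \<nu>] in auto)
  finally show ?thesis by (simp add: prob_space)
qed

lemma integrable_gauss_lborel: "t > 0 \<Longrightarrow> integrable lborel (\<lambda>u. c * gauss t x u)"
  using nn_integral_gauss[of t x]
  by (intro integrable_mult_right integrableI_nonneg) (auto simp: gauss_bounds)

lemma integrable_gauss_potential_mult: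
  assumes \<nu>: "\<nu> \<in> prob_measures_on K" and \<mu>: "\<mu> \<in> prob_measures_on K" and K: "compact K" and t: "t > 0"
  shows "integrable lborel (\<lambda>u. gauss_potential t \<nu> u * gauss_potential t \<mu> u)"
proof -
  obtain R where R: "K \<subseteq> cball 0 R" by (rule compact_subset_cball[OF K]) blast
  note [measurable] = borel_measurable_gauss_potential[OF \<nu>] borel_measurable_gauss_potential[OF \<mu>]
  show ?thesis
  proof (rule Bochner_Integration.integrable_bound[OF integrable_gauss_lborel[of t "exp (2 * t * R\<^sup>2)" 0]])
    show "AE u in lborel. norm (gauss_potential t \<nu> u * gauss_potential t \<mu> u) \<le> norm (exp (2 * t * R\<^sup>2) * gauss t 0 u)"
    proof (rule AE_I2)
      fix u
      let ?a = "gauss_potential t \<nu> u" and ?b = "gauss_potential t \<mu> u"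
      have "?a * ?b \<le> (?a\<^sup>2 + ?b\<^sup>2) / 2" using sum_squares_bound[of ?a ?b] by simp
      also have "\<dots> \<le> exp (2 * t * R\<^sup>2) * gauss t 0 u"
        using gauss_potential_decay[OF \<nu> K R, of t u] gauss_potential_decay[OF \<mu> K R, of t u] t by simp
      finally show "norm (?a * ?b) \<le> norm (exp (2 * t * R\<^sup>2) * gauss t 0 u)"
        using gauss_potential_bounds[OF \<nu>, of t u] gauss_potential_bounds[OF \<mu>, of t u] t 
        by (simp add: gauss_bounds)
    qed
  qed (use t in auto)
qed

text \<open>Tonelli for the square of the potential: by \<open>gauss_mult\<close> the integral over
  u is pi/(4t) times \<open>gauss t\<close>, which cancels the normalizing factor.\<close>

lemma gauss_energy_eq:
  assumes \<nu>: "\<nu> \<in> prob_measures_on K" and K: "compact K" and t: "t > 0"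
  shows "gauss_energy t \<nu> = (LINT p|(\<nu> \<Otimes>\<^sub>M \<nu>). gauss t (fst p) (snd p))"
proof -
  note [measurable_cong] = prob_measures_onD(2)[OF \<nu>]
  note [measurable] = borel_measurable_gauss_potential[OF \<nu>]
  interpret prob_space \<nu> using prob_measures_onD(1)[OF \<nu>] .
  interpret P: pair_prob_space \<nu> \<nu> ..
  interpret Q: pair_sigma_finite "\<nu> \<Otimes>\<^sub>M \<nu>" "lborel :: complex measure" ..
  have gi: "integrable (\<nu> \<Otimes>\<^sub>M \<nu>) (\<lambda>p. gauss t (fst p) (snd p))"
    by (rule P.integrable_const_bound[where B = 1]) (use gauss_bounds t in auto)
  have "ennreal (LINT u|lborel. (gauss_potential t \<nu> u)\<^sup>2) = (\<integral>\<^sup>+u. ennreal ((gauss_potential t \<nu> u)\<^sup>2) \<partial>lborel)"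
    using integrable_gauss_potential_mult[OF \<nu> \<nu> K t] by (intro nn_integral_eq_integral[symmetric]) (auto simp: power2_eq_square)
  also have "\<dots> = (\<integral>\<^sup>+u. (\<integral>\<^sup>+p. ennreal (gauss (2 * t) (fst p) u * gauss (2 * t) (snd p) u) \<partial>(\<nu> \<Otimes>\<^sub>M \<nu>)) \<partial>lborel)"
  proof (rule nn_integral_cong)
    fix u
    have e: "ennreal (gauss_potential t \<nu> u) = (\<integral>\<^sup>+x. ennreal (gauss (2 * t) x u) \<partial>\<nu>)"
      unfolding gauss_potential_def using t
      by (intro nn_integral_eq_integral[symmetric] integrable_gauss[OF \<nu>]) (auto simp: gauss_bounds)
    have "(\<integral>\<^sup>+p. ennreal (gauss (2 * t) (fst p) u * gauss (2 * t) (snd p) u) \<partial>(\<nu> \<Otimes>\<^sub>M \<nu>))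
       = (\<integral>\<^sup>+x. \<integral>\<^sup>+y. ennreal (gauss (2 * t) x u) * ennreal (gauss (2 * t) y u) \<partial>\<nu> \<partial>\<nu>)"
      by (subst nn_integral_fst[symmetric]) (auto simp: ennreal_mult gauss_bounds)
    also have "\<dots> = ennreal (gauss_potential t \<nu> u) * ennreal (gauss_potential t \<nu> u)"
      by (simp add: nn_integral_cmult nn_integral_multc flip: e)
    finally show "ennreal ((gauss_potential t \<nu> u)\<^sup>2) = (\<integral>\<^sup>+p. ennreal (gauss (2 * t) (fst p) u * gauss (2 * t) (snd p) u) \<partial>(\<nu> \<Otimes>\<^sub>M \<nu>))"
      using gauss_potential_bounds[OF \<nu>, of t u] t by (simp add: power2_eq_square ennreal_mult)
  qed
  also have "\<dots> = (\<integral>\<^sup>+p. (\<integral>\<^sup>+u. ennreal (gauss (2 * t) (fst p) u * gauss (2 * t) (snd p) u) \<partial>lborel) \<partial>(\<nu> \<Otimes>\<^sub>M \<nu>))"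
    by (rule Q.Fubini') measurable
  also have "\<dots> = (\<integral>\<^sup>+p. ennreal (gauss t (fst p) (snd p)) * ennreal (pi / (4 * t)) \<partial>(\<nu> \<Otimes>\<^sub>M \<nu>))"
    unfolding gauss_mult using t by (intro nn_integral_cong) (simp add: ennreal_mult gauss_bounds nn_integral_cmult nn_integral_gauss)
  also have "\<dots> = ennreal (LINT p|(\<nu> \<Otimes>\<^sub>M \<nu>). gauss t (fst p) (snd p)) * ennreal (pi / (4 * t))"
    using gi by (subst nn_integral_multc) (auto simp: gauss_bounds nn_integral_eq_integral)
  finally have "(LINT u|lborel. (gauss_potential t \<nu> u)\<^sup>2) = (LINT p|(\<nu> \<Otimes>\<^sub>M \<nu>). gauss t (fst p) (snd p)) * (pi / (4 * t))"
    using t by (simp add: gauss_bounds flip: ennreal_mult)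
  then show ?thesis using t by (simp add: gauss_energy_def)
qed

lemma AE_pair_prob_measures_on:
  assumes \<nu>: "\<nu> \<in> prob_measures_on K" and K: "closed K"
  shows "AE p in \<nu> \<Otimes>\<^sub>M \<nu>. fst p \<in> K \<and> snd p \<in> K"
proof -
  note [measurable_cong] = prob_measures_onD(2)[OF \<nu>]
  interpret prob_space \<nu> using prob_measures_onD(1)[OF \<nu>] .
  interpret P: pair_prob_space \<nu> \<nu> ..
  have [measurable]: "K \<in> sets borel" using K by simp
  show ?thesis
  proof (rule P.AE_pair_measure)
    show "{p \<in> space (\<nu> \<Otimes>\<^sub>M \<nu>). fst p \<in> K \<and> snd p \<in> K} \<in> sets (\<nu> \<Otimes>\<^sub>M \<nu>)" by measurable
    show "AE x in \<nu>. AE y in \<nu>. fst (x, y) \<in> K \<and> snd (x, y) \<in> K"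
      using AE_prob_measures_on[OF \<nu> K] by auto
  qed
qed

text \<open>The number 2R bounds all distances on the support, so exp(-t(2R)^2) lies below
  \<open>gauss t\<close> and the Frullani integrand is nonnegative. Tonelli then exchanges t with
  the pair of points even when the energy is infinite, and the constant ln(2R) is subtracted at the
  end.\<close>

lemma log_energy_eq:
  assumes \<nu>: "\<nu> \<in> prob_measures_on K" and K: "compact K" "K \<subseteq> cball 0 R" and R: "R \<ge> 1"
  shows "log_energy \<nu> = enn2ereal (\<integral>\<^sup>+t\<in>{0<..}. ennreal ((gauss_energy t \<nu> - exp (- t * (2 * R)\<^sup>2)) / (2 * t)) \<partial>lborel) - ereal (ln (2 * R))"
    and "t > 0 \<Longrightarrow> exp (- t * (2 * R)\<^sup>2) \<le> gauss_energy t \<nu>"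
proof -
  note [measurable_cong] = prob_measures_onD(2)[OF \<nu>]
  interpret prob_space \<nu> using prob_measures_onD(1)[OF \<nu>] .
  interpret P: pair_prob_space \<nu> \<nu> ..
  interpret Q: pair_sigma_finite "\<nu> \<Otimes>\<^sub>M \<nu>" "lborel :: real measure" ..
  let ?P = "\<nu> \<Otimes>\<^sub>M \<nu>"
  define D where "D = 2 * R"
  have D: "D \<ge> 1" using R by (simp add: D_def)
  have dist: "AE p in ?P. cmod (fst p - snd p) \<le> D"
    using AE_pair_prob_measures_on[OF \<nu> compact_imp_closed[OF K(1)]]
  proof eventually_elim
    case (elim p)
    then have "norm (fst p) \<le> R" "norm (snd p) \<le> R" using K by auto
    then show ?case using norm_triangle_ineq4[of "fst p" "snd p"] by (simp add: D_def)
  qed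
  have gi: "integrable ?P (\<lambda>p. gauss t (fst p) (snd p))" if "t > 0" for t
    by (rule P.integrable_const_bound[where B = 1]) (use gauss_bounds that in auto)
  have pos: "AE p in ?P. 0 \<le> gauss t (fst p) (snd p) - exp (- t * D\<^sup>2)" if "t > 0" for t
    using dist
  proof eventually_elim
    case (elim p)
    then have "(cmod (fst p - snd p))\<^sup>2 \<le> D\<^sup>2" by (intro power_mono) auto
    then show ?case using that by (simp add: gauss_def)
  qed
  have int_diff: "(LINT p|?P. gauss t (fst p) (snd p) - exp (- t * D\<^sup>2)) = gauss_energy t \<nu> - exp (- t * D\<^sup>2)" if "t > 0" for t
    using gi[OF that] by (simp add: gauss_energy_eq[OF \<nu> K(1) that] P.prob_space)
  show "exp (- t * (2 * R)\<^sup>2) \<le> gauss_energy t \<nu>" if "t > 0"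
    using integral_nonneg_AE[OF pos[OF that]] unfolding int_diff[OF that] by (simp add: D_def)
  define k where "k p = (\<integral>\<^sup>+t\<in>{0<..}. ennreal ((gauss t (fst p) (snd p) - exp (- t * D\<^sup>2)) / (2 * t)) \<partial>lborel)" for p :: "complex \<times> complex"
  have J: "(\<integral>\<^sup>+p. k p \<partial>?P) = (\<integral>\<^sup>+t\<in>{0<..}. ennreal ((gauss_energy t \<nu> - exp (- t * D\<^sup>2)) / (2 * t)) \<partial>lborel)"
  proof -
    have "(\<integral>\<^sup>+p. k p \<partial>?P) = (\<integral>\<^sup>+t. (\<integral>\<^sup>+p. ennreal ((gauss t (fst p) (snd p) - exp (- t * D\<^sup>2)) / (2 * t)) * indicator {0<..} t \<partial>?P) \<partial>lborel)"
      unfolding k_def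
      by (rule Q.Fubini'[symmetric]) measurable
    also have "\<dots> = (\<integral>\<^sup>+t\<in>{0<..}. ennreal ((gauss_energy t \<nu> - exp (- t * D\<^sup>2)) / (2 * t)) \<partial>lborel)"
    proof (rule nn_integral_cong)
      fix t :: real
      show "(\<integral>\<^sup>+p. ennreal ((gauss t (fst p) (snd p) - exp (- t * D\<^sup>2)) / (2 * t)) * indicator {0<..} t \<partial>?P)
         = ennreal ((gauss_energy t \<nu> - exp (- t * D\<^sup>2)) / (2 * t)) * indicator {0<..} t"
      proof (cases "t > 0")
        case True
        have "(\<integral>\<^sup>+p. ennreal ((gauss t (fst p) (snd p) - exp (- t * D\<^sup>2)) / (2 * t)) \<partial>?P) 
          = ennreal (LINT p|?P. (gauss t (fst p) (snd p) - exp (- t * D\<^sup>2)) / (2 * t))"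
          using gi[OF True] pos[OF True] True by (intro nn_integral_eq_integral) (auto elim!: eventually_mono)
        also have "(LINT p|?P. (gauss t (fst p) (snd p) - exp (- t * D\<^sup>2)) / (2 * t)) = (gauss_energy t \<nu> - exp (- t * D\<^sup>2)) / (2 * t)"
          by (subst integral_divide_zero) (simp only: int_diff[OF True])
        finally show ?thesis using True by simp
      qed simp
    qed
    finally show ?thesis .
  qed
  \<comment> \<open>Written without subtraction, the identity holds on the diagonal as well, where
    both sides are infinite.\<close>
  have kern: "AE p in ?P. e2ennreal (log_kernel (fst p) (snd p)) + ennreal (ln D) = k p + e2ennreal (- log_kernel (fst p) (snd p))
      \<and> e2ennreal (- log_kernel (fst p) (snd p)) \<le> ennreal (ln D)"
    using dist
  proof eventually_elim
    case (elim p)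
    show ?case
    proof (cases "fst p = snd p")
      case True
      have "k p = \<infinity>" using frullani_exp_0[of "D\<^sup>2"] D True by (simp add: k_def gauss_def)
      moreover have "log_kernel (fst p) (snd p) = \<infinity>" using True by (simp add: log_kernel_def)
      ultimately show ?thesis by (simp add: e2ennreal_neg)
    next
      case False
      define r where "r = cmod (fst p - snd p)"
      have r: "0 < r" "r \<le> D" using elim False by (auto simp: r_def)
      have "r\<^sup>2 \<le> D\<^sup>2" using r by (intro power_mono) auto
      then have "k p = ennreal ((ln (D\<^sup>2) - ln (r\<^sup>2)) / 2)"
        unfolding k_def gauss_def using frullani_exp[of "r\<^sup>2" "D\<^sup>2"] r by (simp add: r_def)
      then have k: "k p = ennreal (ln D - ln r)" using r D by (simp add: ln_realpow)
      have l: "log_kernel (fst p) (snd p) = ereal (- ln r)" using False r by (simp add: log_kernel_def r_def ln_div)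
      have le: "ln r \<le> ln D" "0 \<le> ln D" using r D by auto
      show ?thesis
      proof (cases "ln r \<ge> 0")
        case True
        then show ?thesis unfolding k l using le
          by (simp add: e2ennreal_ereal ennreal_neg flip: ennreal_plus)
      next
        case False
        then show ?thesis unfolding k l using le
          by (simp add: e2ennreal_ereal ennreal_neg flip: ennreal_plus)
      qed
    qed
  qed
  have [measurable]: "(\<lambda>p. log_kernel (fst p) (snd p)) \<in> borel_measurable ?P"
    unfolding log_kernel_def by measurable
  have [measurable]: "k \<in> borel_measurable ?P"
    unfolding k_def by measurable
  let ?a = "\<integral>\<^sup>+p. e2ennreal (log_kernel (fst p) (snd p)) \<partial>?P" and ?b = "\<integral>\<^sup>+p. e2ennreal (- log_kernel (fst p) (snd p)) \<partial>?P"
  have "?a + ennreal (ln D) = (\<integral>\<^sup>+p. e2ennreal (log_kernel (fst p) (snd p)) + ennreal (ln D) \<partial>?P)"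
    by (subst nn_integral_add) (auto simp: P.emeasure_space_1)
  also have "\<dots> = (\<integral>\<^sup>+p. k p + e2ennreal (- log_kernel (fst p) (snd p)) \<partial>?P)"
    using kern by (intro nn_integral_cong_AE) (auto elim!: eventually_mono)
  also have "\<dots> = (\<integral>\<^sup>+p. k p \<partial>?P) + ?b" by (rule nn_integral_add) auto
  finally have eq: "?a + ennreal (ln D) = (\<integral>\<^sup>+p. k p \<partial>?P) + ?b" .
  have "?b \<le> (\<integral>\<^sup>+p. ennreal (ln D) \<partial>?P)"
    using kern by (intro nn_integral_mono_AE) (auto elim!: eventually_mono)
  then have "?b \<le> ennreal (ln D)" by (simp add: P.emeasure_space_1)
  then obtain b where b: "?b = ennreal b" "b \<ge> 0" by (cases ?b) (auto simp: top_unique)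
  have lnD: "ln D \<ge> 0" using D by simp
  \<comment> \<open>Subtraction returns only here. The negative part \<open>?b\<close> is finite, so
    the cases are an infinite and a finite positive part.\<close>
  have "enn2ereal ?a - enn2ereal ?b = enn2ereal (\<integral>\<^sup>+p. k p \<partial>?P) - ereal (ln D)"
  proof (cases ?a)
    case top
    then have "(\<integral>\<^sup>+p. k p \<partial>?P) = \<infinity>" using eq b by (cases "\<integral>\<^sup>+p. k p \<partial>?P") (auto simp flip: ennreal_plus)
    then show ?thesis using b by (simp add: top)
  next
    case (real a)
    then obtain c where c: "(\<integral>\<^sup>+p. k p \<partial>?P) = ennreal c" "c \<ge> 0" using eq lnD by (cases "\<integral>\<^sup>+p. k p \<partial>?P") (auto simp flip: ennreal_plus)
    have "a + ln D = c + b" using eq lnD b(2) c(2) real(1) unfolding real(2) c(1) b(1) by (simp flip: ennreal_plus)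
    then show ?thesis using lnD b(2) c(2) real(1) unfolding real(2) c(1) b(1) by simp
  qed
  then show "log_energy \<nu> = enn2ereal (\<integral>\<^sup>+t\<in>{0<..}. ennreal ((gauss_energy t \<nu> - exp (- t * (2 * R)\<^sup>2)) / (2 * t)) \<partial>lborel) - ereal (ln (2 * R))"
    unfolding log_energy_def J[unfolded D_def] by (simp add: split_beta' D_def J[unfolded D_def])
qed

section \<open>The equilibrium measure\<close>

lemma prob_measures_on_mono:
  assumes "\<nu> \<in> prob_measures_on E" "E \<subseteq> K" "K \<in> sets borel"
  shows "\<nu> \<in> prob_measures_on K"
proof -
  interpret prob_space \<nu> using prob_measures_onD(1)[OF assms(1)] .
  have "emeasure \<nu> E \<le> emeasure \<nu> K"
    using assms prob_measures_onD(2)[OF assms(1)] by (intro emeasure_mono) auto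
  then have "emeasure \<nu> K = 1"
    unfolding prob_measures_onD(4)[OF assms(1)] by (intro antisym emeasure_le_1)
  then show ?thesis using assms(1) by (simp add: prob_measures_on_def)
qed

lemma borel_measurable_gauss_energy:
  assumes "\<nu> \<in> prob_measures_on K"
  shows "(\<lambda>t. gauss_energy t \<nu>) \<in> borel_measurable borel"
proof -
  note [measurable_cong] = prob_measures_onD(2)[OF assms]
  interpret prob_space \<nu> using prob_measures_onD(1)[OF assms] .
  show ?thesis unfolding gauss_energy_def gauss_potential_def by measurable
qed

text \<open>For fixed t the Gaussian is continuous, so the potentials converge pointwise, and
  \<open>gauss_potential_decay\<close> dominates them uniformly in n.\<close>

lemma weak_limit_gauss_energy:
  assumes lim: "weak_limit \<nu> \<mu>" and \<nu>: "\<And>n. \<nu> n \<in> prob_measures_on K" and \<mu>: "\<mu> \<in> prob_measures_on K"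
    and K: "compact K" and t: "t > 0"
  shows "(\<lambda>n. gauss_energy t (\<nu> n)) \<longlonglongrightarrow> gauss_energy t \<mu>"
proof -
  obtain R where R: "K \<subseteq> cball 0 R" by (rule compact_subset_cball[OF K]) blast
  have "(\<lambda>n. LINT u|lborel. (gauss_potential t (\<nu> n) u)\<^sup>2) \<longlonglongrightarrow> (LINT u|lborel. (gauss_potential t \<mu> u)\<^sup>2)"
  proof (rule integral_dominated_convergence[where w = "\<lambda>u. exp (2 * t * R\<^sup>2) * gauss t 0 u"])
    have "(\<lambda>n. gauss_potential t (\<nu> n) u) \<longlonglongrightarrow> gauss_potential t \<mu> u" for u
    proof -
      have "continuous_on UNIV (\<lambda>x. gauss (2 * t) x u)" unfolding gauss_def by (intro continuous_intros)
      then show ?thesis using lim unfolding weak_limit_def gauss_potential_def by blast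
    qed
    then show "AE u in lborel. (\<lambda>n. (gauss_potential t (\<nu> n) u)\<^sup>2) \<longlonglongrightarrow> (gauss_potential t \<mu> u)\<^sup>2"
      by (intro AE_I2 tendsto_intros)
    show "AE u in lborel. norm ((gauss_potential t (\<nu> n) u)\<^sup>2) \<le> exp (2 * t * R\<^sup>2) * gauss t 0 u" for n
      using gauss_potential_decay[OF \<nu> K R] t by simp
    show "integrable lborel (\<lambda>u. exp (2 * t * R\<^sup>2) * gauss t 0 u)" by (rule integrable_gauss_lborel[OF t])
  qed (use borel_measurable_gauss_potential[OF \<nu>] borel_measurable_gauss_potential[OF \<mu>] in auto)
  then show ?thesis unfolding gauss_energy_def by (intro tendsto_intros)
qed

text \<open>Lower semicontinuity of the energy by Fatou's lemma in t. The numbers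
  \<open>\<delta> n\<close> admit discrete measures: with d equal atoms the diagonal contributes 1/d
  to each Gaussian energy, and the pairs off it carry the mass 1 - 1/d. With \<delta> = 0 this is
  the usual statement.\<close>

lemma log_energy_le_limit:
  fixes \<delta> :: "nat \<Rightarrow> real"
  assumes lim: "weak_limit \<nu> \<mu>" and \<nu>: "\<And>n. \<nu> n \<in> prob_measures_on (cball 0 R)"
    and \<mu>: "\<mu> \<in> prob_measures_on (cball 0 R)" and R: "R \<ge> 1"
    and \<delta>: "\<delta> \<longlonglongrightarrow> 0" and C: "C \<longlonglongrightarrow> c" and c: "c \<ge> 0"
    and bound: "\<And>n. (\<integral>\<^sup>+t\<in>{0<..}. ennreal ((gauss_energy t (\<nu> n) - \<delta> n - (1 - \<delta> n) * exp (- t * (2 * R)\<^sup>2)) / (2 * t)) \<partial>lborel) \<le> ennreal (C n)"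
  shows "log_energy \<mu> \<le> ereal (c - ln (2 * R))"
proof -
  note [measurable] = borel_measurable_gauss_energy[OF \<nu>] borel_measurable_gauss_energy[OF \<mu>]
  let ?h = "\<lambda>n t. ennreal ((gauss_energy t (\<nu> n) - \<delta> n - (1 - \<delta> n) * exp (- t * (2 * R)\<^sup>2)) / (2 * t)) * indicator {0<..} t"
  let ?I = "\<integral>\<^sup>+t\<in>{0<..}. ennreal ((gauss_energy t \<mu> - exp (- t * (2 * R)\<^sup>2)) / (2 * t)) \<partial>lborel"
  have "?I = (\<integral>\<^sup>+t. liminf (\<lambda>n. ?h n t) \<partial>lborel)"
  proof (rule nn_integral_cong)
    fix t :: real
    have "(\<lambda>n. ?h n t) \<longlonglongrightarrow> ennreal ((gauss_energy t \<mu> - 0 - (1 - 0) * exp (- t * (2 * R)\<^sup>2)) / (2 * t)) * indicator {0<..} t"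
    proof (cases "t > 0")
      case True
      have "(\<lambda>n. ennreal ((gauss_energy t (\<nu> n) - \<delta> n - (1 - \<delta> n) * exp (- t * (2 * R)\<^sup>2)) / (2 * t)))
        \<longlonglongrightarrow> ennreal ((gauss_energy t \<mu> - 0 - (1 - 0) * exp (- t * (2 * R)\<^sup>2)) / (2 * t))"
        using True by (intro tendsto_ennrealI tendsto_intros weak_limit_gauss_energy[OF lim \<nu> \<mu>] \<delta>) auto
      then show ?thesis using True by simp
    qed simp
    then show "ennreal ((gauss_energy t \<mu> - exp (- t * (2 * R)\<^sup>2)) / (2 * t)) * indicator {0<..} t = liminf (\<lambda>n. ?h n t)"
      using lim_imp_Liminf[OF trivial_limit_sequentially] by fastforce
  qed
  also have "\<dots> \<le> liminf (\<lambda>n. \<integral>\<^sup>+t. ?h n t \<partial>lborel)" by (rule nn_integral_liminf) measurable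
  also have "\<dots> \<le> liminf (\<lambda>n. ennreal (C n))" by (intro Liminf_mono always_eventually allI bound)
  also have "\<dots> = ennreal c" by (intro lim_imp_Liminf tendsto_ennrealI C) simp
  finally have "enn2ereal ?I \<le> enn2ereal (ennreal c)" by (simp only: less_eq_ennreal.rep_eq)
  then have "enn2ereal ?I \<le> ereal c" using c by simp
  then have "enn2ereal ?I - ereal (ln (2 * R)) \<le> ereal c - ereal (ln (2 * R))" by (rule ereal_minus_mono) simp
  then show ?thesis unfolding log_energy_eq(1)[OF \<mu> compact_cball subset_refl R] by simp
qed

text \<open>Carries energy bounds from extended reals to \<open>ennreal\<close>, where possibly
  infinite integrals can be added. The sign condition on V + ln(2R) is stated separately because
  \<open>ennreal\<close> sends negative numbers to 0.\<close>

lemma log_energy_ennreal: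
  assumes \<nu>: "\<nu> \<in> prob_measures_on (cball 0 R)" and R: "R \<ge> 1"
  shows "log_energy \<nu> \<le> ereal V \<longleftrightarrow>
    (\<integral>\<^sup>+t\<in>{0<..}. ennreal ((gauss_energy t \<nu> - exp (- t * (2 * R)\<^sup>2)) / (2 * t)) \<partial>lborel) \<le> ennreal (V + ln (2 * R)) \<and> V + ln (2 * R) \<ge> 0"
    (is "_ \<longleftrightarrow> ?I \<le> _ \<and> _")
    and "ereal V \<le> log_energy \<nu> \<Longrightarrow> ennreal (V + ln (2 * R)) \<le>
    (\<integral>\<^sup>+t\<in>{0<..}. ennreal ((gauss_energy t \<nu> - exp (- t * (2 * R)\<^sup>2)) / (2 * t)) \<partial>lborel)"
proof -
  note eq = log_energy_eq(1)[OF \<nu> compact_cball subset_refl R]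
  show "log_energy \<nu> \<le> ereal V \<longleftrightarrow> ?I \<le> ennreal (V + ln (2 * R)) \<and> V + ln (2 * R) \<ge> 0"
  proof (cases ?I)
    case (real i)
    then show ?thesis unfolding eq real(2) by (auto simp: ennreal_le_iff)
  next
    case top
    then show ?thesis unfolding eq top by (simp add: top_unique)
  qed
  show "ennreal (V + ln (2 * R)) \<le> ?I" if "ereal V \<le> log_energy \<nu>"
  proof (cases ?I)
    case (real i)
    then show ?thesis using that unfolding eq real(2) by (auto intro!: ennreal_leI)
  next
    case top
    then show ?thesis unfolding top by simp
  qed
qed

text \<open>The direct method: a minimizing sequence, a weak limit, and lower semicontinuity with
  \<delta> = 0.\<close>

lemma log_energy_minimizer_exists:
  assumes E: "compact E" and V: "min_log_energy E = ereal V"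
  obtains \<mu> where "\<mu> \<in> prob_measures_on E" "log_energy \<mu> = ereal V"
proof -
  obtain R where R: "R \<ge> 1" "E \<subseteq> cball 0 R" by (rule compact_subset_cball[OF E]) blast
  have "\<exists>\<nu>\<in>prob_measures_on E. log_energy \<nu> < ereal (V + 1 / Suc n)" for n
  proof -
    have "min_log_energy E < ereal (V + 1 / Suc n)" unfolding V by simp
    then show ?thesis unfolding min_log_energy_def by (simp only: INF_less_iff)
  qed
  then obtain \<nu> where \<nu>: "\<And>n. \<nu> n \<in> prob_measures_on E" "\<And>n. log_energy (\<nu> n) < ereal (V + 1 / Suc n)"
    by metis
  obtain r \<mu> where r: "strict_mono r" "\<mu> \<in> prob_measures_on E" "weak_limit (\<nu> \<circ> r) \<mu>"
    by (rule weak_compactness[OF E \<nu>(1)])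
  have on: "\<nu> n \<in> prob_measures_on (cball 0 R)" "\<mu> \<in> prob_measures_on (cball 0 R)" for n
    using prob_measures_on_mono[OF \<nu>(1) R(2)] prob_measures_on_mono[OF r(2) R(2)] by simp_all
  note b = log_energy_ennreal(1)[OF on(1) R(1), THEN iffD1, OF order_less_imp_le[OF \<nu>(2)]]
  have C: "(\<lambda>n. V + 1 / Suc n + ln (2 * R)) \<longlonglongrightarrow> V + ln (2 * R)" by real_asymp
  have "log_energy \<mu> \<le> ereal (V + ln (2 * R) - ln (2 * R))"
  proof (rule log_energy_le_limit[OF r(3) _ on(2) R(1)])
    show "(\<lambda>n. 0) \<longlonglongrightarrow> (0::real)" by simp
    show "(\<lambda>n. V + 1 / Suc (r n) + ln (2 * R)) \<longlonglongrightarrow> V + ln (2 * R)"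
      using LIMSEQ_subseq_LIMSEQ[OF C r(1)] by (simp add: comp_def)
    show "V + ln (2 * R) \<ge> 0" using LIMSEQ_le_const[OF C] b by blast
    show "(\<integral>\<^sup>+t\<in>{0<..}. ennreal ((gauss_energy t ((\<nu> \<circ> r) n) - 0 - (1 - 0) * exp (- t * (2 * R)\<^sup>2)) / (2 * t)) \<partial>lborel)
       \<le> ennreal (V + 1 / Suc (r n) + ln (2 * R))" for n
      using b[of "r n"] by (simp only: comp_def diff_zero mult_1)
  qed (use on in auto)
  moreover have "ereal V \<le> log_energy \<mu>" unfolding V[symmetric] min_log_energy_def by (rule INF_lower[OF r(2)])
  ultimately have "log_energy \<mu> = ereal V" by (intro antisym) simp_all
  with that r(2) show thesis by blast
qed

text \<open>A fair coin chooses between the two measures. Only the potential of the mixture is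
  exported, since Gaussian energies are defined from potentials.\<close>

lemma midpoint_measure_exists:
  assumes \<mu>: "\<mu> \<in> prob_measures_on K" and \<nu>: "\<nu> \<in> prob_measures_on K" and K: "compact K"
  obtains m where "m \<in> prob_measures_on K"
    "\<And>t u. t \<ge> 0 \<Longrightarrow> gauss_potential t m u = (gauss_potential t \<mu> u + gauss_potential t \<nu> u) / 2"
proof -
  define N where "N b = (if b then \<mu> else \<nu>)" for b
  define m where "m = bind (measure_pmf (bernoulli_pmf (1/2))) N"
  have N: "prob_space (N b)" "sets (N b) = sets borel" "space (N b) = UNIV" for b
    using prob_measures_onD[OF \<mu>] prob_measures_onD[OF \<nu>] by (auto simp: N_def)
  have NM: "N \<in> measurable (measure_pmf (bernoulli_pmf (1/2))) (subprob_algebra borel)"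
    using N prob_space_imp_subprob_space[OF N(1)] by (auto simp: space_subprob_algebra)
  have sets_m: "sets m = sets borel" unfolding m_def by (rule sets_bind) (use N in auto)
  have nn: "(\<integral>\<^sup>+x. f x \<partial>m) = (\<integral>\<^sup>+x. f x \<partial>\<mu>) * ennreal (1/2) + (\<integral>\<^sup>+x. f x \<partial>\<nu>) * ennreal (1/2)"
    if "f \<in> borel_measurable borel" for f
    unfolding m_def by (subst nn_integral_bind[OF that NM]) (simp add: N_def)
  have pm: "prob_space m" unfolding m_def
    by (rule prob_space.prob_space_bind[OF _ _ NM]) (auto simp: N measure_pmf.prob_space_axioms)
  have "emeasure m K = 1"
    using nn[of "indicator K"] prob_measures_onD[OF \<mu>] prob_measures_onD[OF \<nu>] compact_imp_closed[OF K] sets_m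
      ennreal_plus[of "1/2" "1/2"] by simp
  then have mK: "m \<in> prob_measures_on K" using sets_m pm by (simp add: prob_measures_on_def)
  show thesis
  proof (rule that[OF mK])
    fix t u assume t: "t \<ge> (0::real)"
    have e: "ennreal (gauss_potential t \<kappa> u) = (\<integral>\<^sup>+x. ennreal (gauss (2 * t) x u) \<partial>\<kappa>)" if "\<kappa> \<in> prob_measures_on K" for \<kappa>
      unfolding gauss_potential_def using t
      by (intro nn_integral_eq_integral[symmetric] integrable_gauss[OF that]) (auto simp: gauss_bounds)
    have "ennreal (gauss_potential t m u) = ennreal (gauss_potential t \<mu> u) * ennreal (1/2) + ennreal (gauss_potential t \<nu> u) * ennreal (1/2)"
      unfolding e[OF mK] e[OF \<mu>] e[OF \<nu>] by (rule nn) measurable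
    also have "\<dots> = ennreal (gauss_potential t \<mu> u * (1/2) + gauss_potential t \<nu> u * (1/2))"
      using gauss_potential_bounds(1)[OF \<mu> t] gauss_potential_bounds(1)[OF \<nu> t]
      by (simp only: ennreal_mult[symmetric] ennreal_plus[symmetric] mult_nonneg_nonneg zero_le_divide_1_iff zero_le_numeral)
    finally show "gauss_potential t m u = (gauss_potential t \<mu> u + gauss_potential t \<nu> u) / 2"
      using gauss_potential_bounds[OF \<mu> t] gauss_potential_bounds[OF \<nu> t] gauss_potential_bounds[OF mK t]
      by (subst (asm) ennreal_inj) auto
  qed
qed

section \<open>Injectivity of the Gaussian potential\<close>

lemma continuous_on_gauss_potential:
  assumes \<nu>: "\<nu> \<in> prob_measures_on K" and t: "t \<ge> 0"
  shows "continuous_on UNIV (gauss_potential t \<nu>)"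
proof -
  note [measurable_cong] = prob_measures_onD(2)[OF \<nu>]
  interpret prob_space \<nu> using prob_measures_onD(1)[OF \<nu>] .
  show ?thesis
    unfolding continuous_on_sequentially
  proof (intro ballI allI impI)
    fix a :: complex and x :: "nat \<Rightarrow> complex"
    assume "(\<forall>n. x n \<in> UNIV) \<and> x \<longlonglongrightarrow> a"
    then have x: "x \<longlonglongrightarrow> a" by simp
    show "(gauss_potential t \<nu> \<circ> x) \<longlonglongrightarrow> gauss_potential t \<nu> a"
      unfolding gauss_potential_def comp_def
    proof (rule integral_dominated_convergence[where w = "\<lambda>_. 1"])
      show "AE z in \<nu>. (\<lambda>n. gauss (2 * t) z (x n)) \<longlonglongrightarrow> gauss (2 * t) z a"
        unfolding gauss_def by (intro AE_I2 tendsto_intros x)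
    qed (use t gauss_bounds in auto)
  qed
qed

lemma continuous_AE_eq:
  fixes f g :: "complex \<Rightarrow> real"
  assumes f: "continuous_on UNIV f" and g: "continuous_on UNIV g" and ae: "AE u in lborel. f u = g u"
  shows "f = g"
proof (rule ccontr)
  assume "f \<noteq> g"
  then obtain a where a: "f a \<noteq> g a" by auto
  have "open {u. f u \<noteq> g u}" using f g by (rule open_Collect_neq)
  then obtain e where e: "e > 0" "ball a e \<subseteq> {u. f u \<noteq> g u}" using a by (auto simp: open_contains_ball)
  have "AE u in lborel. u \<notin> ball a e" using ae by eventually_elim (use e in auto)
  then have "emeasure lborel (ball a e) = 0" by (subst (asm) AE_iff_measurable[of "ball a e"]) auto
  then show False using e(1) by (simp add: emeasure_lborel_complex_ball)
qed

text \<open>Linear combinations of real exponentials form an algebra that separates points.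
  Multiplied by one fixed Gaussian, each exponential becomes a multiple of a translated Gaussian,
  whose integral is a value of the potential.\<close>

inductive_set exp_span :: "(complex \<Rightarrow> real) set" where
  exp: "(\<lambda>x. c * exp (Re (x * v))) \<in> exp_span"
| add: "f \<in> exp_span \<Longrightarrow> g \<in> exp_span \<Longrightarrow> (\<lambda>x. f x + g x) \<in> exp_span"

lemma exp_span_mult: "f \<in> exp_span \<Longrightarrow> g \<in> exp_span \<Longrightarrow> (\<lambda>x. f x * g x) \<in> exp_span"
proof (induction rule: exp_span.induct)
  case (exp c v)
  then show ?case
  proof (induction rule: exp_span.induct)
    case (exp d w)
    have "(\<lambda>x. c * exp (Re (x * v)) * (d * exp (Re (x * w)))) = (\<lambda>x. (c * d) * exp (Re (x * (v + w))))"
      by (simp add: algebra_simps exp_add[symmetric])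
    then show ?case by (simp only: exp_span.exp)
  next
    case (add f g)
    from exp_span.add[OF add.IH] show ?case by (simp only: distrib_left)
  qed
next
  case (add f1 f2)
  from exp_span.add[OF add.IH[OF add.prems]] show ?case by (simp only: distrib_right)
qed

lemma continuous_on_exp_span: "f \<in> exp_span \<Longrightarrow> continuous_on S f"
  by (induction rule: exp_span.induct) (auto intro!: continuous_intros)

text \<open>Completing the square writes exp(-2t|x|^2) exp(Re(xv)) as a multiple of the Gaussian
  centred at u = cnj v / (4t). Equal potentials therefore give equal integrals of
  \<open>exp_span\<close> with weight \<open>w\<close>, and Stone-Weierstrass extends this to
  continuous functions.\<close>

lemma gauss_potential_inject:
  assumes \<mu>: "\<mu> \<in> prob_measures_on K" and \<nu>: "\<nu> \<in> prob_measures_on K" and K: "compact K" and t: "t > 0"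
    and eq: "gauss_potential t \<mu> = gauss_potential t \<nu>"
  shows "\<mu> = \<nu>"
proof (rule measure_eqI_test_function)
  interpret R: function_ring_on exp_span K
  proof
    show "(\<lambda>_. c) \<in> exp_span" for c using exp_span.exp[of c 0] by simp
    show "\<exists>f\<in>exp_span. f x \<noteq> f y" if "x \<noteq> y" for x y
    proof
      show "(\<lambda>z. 1 * exp (Re (z * cnj (x - y)))) \<in> exp_span" by (rule exp_span.exp)
      have "Re (x * cnj (x - y)) - Re (y * cnj (x - y)) = (cmod (x - y))\<^sup>2"
        unfolding cmod_power2 by (simp add: algebra_simps power2_eq_square)
      then show "1 * exp (Re (x * cnj (x - y))) \<noteq> 1 * exp (Re (y * cnj (x - y)))" using that by auto
    qed
  qed (auto intro: K continuous_on_exp_span exp_span.add exp_span_mult)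
  define w where "w x = exp (- (2 * t) * (cmod x)\<^sup>2)" for x
  have w: "continuous_on S w" "w x > 0" "w x \<le> 1" for x S unfolding w_def using t by (auto intro!: continuous_intros)
  have span: "(LINT x|\<mu>. w x * g x) = (LINT x|\<nu>. w x * g x)" if "g \<in> exp_span" for g
    using that
  proof (induction rule: exp_span.induct)
    case (exp c v)
    define u where "u = cnj v / (4 * t)"
    have "w x * (c * exp (Re (x * v))) = c * exp (2 * t * (cmod u)\<^sup>2) * gauss (2 * t) x u" for x
    proof -
      have "- (2 * t) * (cmod x)\<^sup>2 + Re (x * v) = 2 * t * (cmod u)\<^sup>2 + - (2 * t) * (cmod (x - u))\<^sup>2"
        unfolding cmod_power2 using t by (simp add: u_def field_simps power2_eq_square)
      then show ?thesis unfolding w_def gauss_def by (simp only: mult.assoc exp_add[symmetric] mult.left_commute[of _ c])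
    qed
    then show ?case using fun_cong[OF eq, of u] by (simp only: gauss_potential_def integral_mult_right_zero)
  next
    case (add f g)
    have i: "integrable \<kappa> (\<lambda>x. w x * h x)" if "\<kappa> \<in> prob_measures_on K" "h \<in> exp_span" for \<kappa> h
      by (intro integrable_continuous_prob_measures_on[OF that(1) K] continuous_intros w continuous_on_exp_span that)
    show ?case using add by (simp add: distrib_left i \<mu> \<nu>)
  qed
  fix \<phi> :: "complex \<Rightarrow> real" assume "test_function \<phi>"
  then have \<phi>: "continuous_on UNIV \<phi>" by (rule test_function_continuous)
  have close: "\<bar>(LINT z|\<mu>. \<phi> z) - (LINT z|\<nu>. \<phi> z)\<bar> \<le> e" if e: "e > 0" for e
  proof -
    \<comment> \<open>The weight is divided out before approximating; as 0 < w \<le> 1, multiplying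
      it back does not enlarge the error.\<close>
    have "continuous_on K (\<lambda>x. \<phi> x / w x)"
      using w(2) by (intro continuous_intros w continuous_on_subset[OF \<phi>]) (auto simp: less_le)
    from R.Stone_Weierstrass_basic[OF this half_gt_zero[OF e]]
    obtain g where g: "g \<in> exp_span" "\<forall>x\<in>K. \<bar>\<phi> x / w x - g x\<bar> < e / 2" by blast
    have gb: "\<bar>\<phi> x - w x * g x\<bar> \<le> e / 2" if "x \<in> K" for x
    proof -
      have "\<bar>\<phi> x - w x * g x\<bar> = w x * \<bar>\<phi> x / w x - g x\<bar>"
        using w(2)[of x] by (simp add: abs_mult_pos' right_diff_distrib)
      also have "\<dots> \<le> 1 * \<bar>\<phi> x / w x - g x\<bar>" using w(3) by (intro mult_right_mono) auto
      finally show ?thesis using bspec[OF g(2) that] by simp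
    qed
    have d: "\<bar>(LINT z|\<kappa>. \<phi> z) - (LINT z|\<kappa>. w z * g z)\<bar> \<le> e / 2" if \<kappa>: "\<kappa> \<in> prob_measures_on K" for \<kappa>
    proof -
      interpret prob_space \<kappa> using prob_measures_onD(1)[OF \<kappa>] .
      have i: "integrable \<kappa> \<phi>" "integrable \<kappa> (\<lambda>z. w z * g z)"
        by (intro integrable_continuous_prob_measures_on[OF \<kappa> K] continuous_intros \<phi> w continuous_on_exp_span g(1))+
      have "\<bar>LINT z|\<kappa>. \<phi> z - w z * g z\<bar> \<le> (LINT z|\<kappa>. \<bar>\<phi> z - w z * g z\<bar>)" by (rule integral_abs_bound)
      also have "\<dots> \<le> (LINT z|\<kappa>. e / 2)"
        using i gb by (intro integral_mono_prob_measures_on[OF \<kappa> compact_imp_closed[OF K]]) auto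
      finally show ?thesis using i by (simp add: prob_space)
    qed
    show ?thesis using d[OF \<mu>] d[OF \<nu>] span[OF g(1)] by linarith
  qed
  have "\<bar>(LINT z|\<mu>. \<phi> z) - (LINT z|\<nu>. \<phi> z)\<bar> \<le> 0"
    by (rule field_le_epsilon, unfold add_0) (rule close)
  then show "(LINT z|\<mu>. \<phi> z) = (LINT z|\<nu>. \<phi> z)" by simp
qed (use prob_measures_onD[OF \<mu>] prob_measures_onD[OF \<nu>] in auto)

text \<open>Strict convexity: by the parallelogram law the midpoint of two minimizers saves the
  integral of q(t)/(2t), where q(t) is t/pi times the squared L^2-distance of the potentials.
  Minimality forces the saving to be 0, so the potentials agree for some t, and a single t
  determines the measure.\<close>

lemma log_energy_minimizer_unique:
  assumes E: "compact E" and V: "min_log_energy E = ereal V"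
    and \<mu>: "\<mu> \<in> prob_measures_on E" "log_energy \<mu> \<le> ereal V"
    and \<nu>: "\<nu> \<in> prob_measures_on E" "log_energy \<nu> \<le> ereal V"
  shows "\<mu> = \<nu>"
proof -
  obtain R where R: "R \<ge> 1" "E \<subseteq> cball 0 R" by (rule compact_subset_cball[OF E]) blast
  obtain m where m: "m \<in> prob_measures_on E"
    and mid: "\<And>t u. t \<ge> 0 \<Longrightarrow> gauss_potential t m u = (gauss_potential t \<mu> u + gauss_potential t \<nu> u) / 2"
    by (rule midpoint_measure_exists[OF \<mu>(1) \<nu>(1) E]) blast
  have Vm: "ereal V \<le> log_energy m" unfolding V[symmetric] min_log_energy_def by (rule INF_lower[OF m])
  have on: "\<kappa> \<in> prob_measures_on (cball 0 R)" if "\<kappa> \<in> prob_measures_on E" for \<kappa>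
    using prob_measures_on_mono[OF that R(2)] by simp
  note [measurable] = borel_measurable_gauss_energy[OF \<mu>(1)] borel_measurable_gauss_energy[OF \<nu>(1)] borel_measurable_gauss_energy[OF m]
  define q where "q t = (gauss_energy t \<mu> + gauss_energy t \<nu>) / 2 - gauss_energy t m" for t
  have [measurable]: "q \<in> borel_measurable borel" unfolding q_def by measurable
  have i: "integrable lborel (\<lambda>u. gauss_potential t \<kappa> u * gauss_potential t \<kappa>' u)"
    if "\<kappa> \<in> prob_measures_on E" "\<kappa>' \<in> prob_measures_on E" "t > 0" for t \<kappa> \<kappa>'
    by (rule integrable_gauss_potential_mult[OF that(1,2) E that(3)])
  have q: "q t = t / pi * (LINT u|lborel. (gauss_potential t \<mu> u - gauss_potential t \<nu> u)\<^sup>2)"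
    and iq: "integrable lborel (\<lambda>u. (gauss_potential t \<mu> u - gauss_potential t \<nu> u)\<^sup>2)" if t: "t > 0" for t
  proof -
    have 1: "(gauss_potential t \<mu> u - gauss_potential t \<nu> u)\<^sup>2
      = gauss_potential t \<mu> u * gauss_potential t \<mu> u - 2 * (gauss_potential t \<mu> u * gauss_potential t \<nu> u) + gauss_potential t \<nu> u * gauss_potential t \<nu> u" for u
      by (simp add: power2_eq_square algebra_simps)
    have 2: "(gauss_potential t m u)\<^sup>2
      = (gauss_potential t \<mu> u * gauss_potential t \<mu> u + 2 * (gauss_potential t \<mu> u * gauss_potential t \<nu> u) + gauss_potential t \<nu> u * gauss_potential t \<nu> u) / 4" for u
      using t by (simp add: mid power2_eq_square algebra_simps)
    show "integrable lborel (\<lambda>u. (gauss_potential t \<mu> u - gauss_potential t \<nu> u)\<^sup>2)"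
      unfolding 1 using i[OF \<mu>(1) \<mu>(1) t] i[OF \<mu>(1) \<nu>(1) t] i[OF \<nu>(1) \<nu>(1) t] by simp
    show "q t = t / pi * (LINT u|lborel. (gauss_potential t \<mu> u - gauss_potential t \<nu> u)\<^sup>2)"
      unfolding q_def gauss_energy_def 1 2 using i[OF \<mu>(1) \<mu>(1) t] i[OF \<mu>(1) \<nu>(1) t] i[OF \<nu>(1) \<nu>(1) t] t
      by (simp add: power2_eq_square field_simps)
  qed
  have q0: "q t \<ge> 0" if "t > 0" for t unfolding q[OF that] using that by simp
  let ?H = "\<lambda>\<kappa> t. (gauss_energy t \<kappa> - exp (- t * (2 * R)\<^sup>2)) / (2 * t)"
  let ?I = "\<lambda>\<kappa>. \<integral>\<^sup>+t\<in>{0<..}. ennreal (?H \<kappa> t) \<partial>lborel"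
  have H0: "?H \<kappa> t \<ge> 0" if "\<kappa> \<in> prob_measures_on E" "t > 0" for \<kappa> t
    using log_energy_eq(2)[OF on[OF that(1)] compact_cball subset_refl R(1) that(2)] that(2) by simp
  define c where "c = V + ln (2 * R)"
  have c: "c \<ge> 0" "?I \<mu> \<le> ennreal c" "?I \<nu> \<le> ennreal c" "ennreal c \<le> ?I m"
    unfolding c_def using log_energy_ennreal(1)[OF on[OF \<mu>(1)] R(1)] log_energy_ennreal(1)[OF on[OF \<nu>(1)] R(1)] 
      log_energy_ennreal(2)[OF on[OF m] R(1) Vm] \<mu>(2) \<nu>(2) by blast+
  have "?I m + (\<integral>\<^sup>+t\<in>{0<..}. ennreal (q t / (2 * t)) \<partial>lborel)
      = (\<integral>\<^sup>+t. ennreal (?H m t) * indicator {0<..} t + ennreal (q t / (2 * t)) * indicator {0<..} t \<partial>lborel)"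
    by (rule nn_integral_add[symmetric]) measurable
  also have "\<dots> = (\<integral>\<^sup>+t. ennreal (1/2) * (ennreal (?H \<mu> t) * indicator {0<..} t) + ennreal (1/2) * (ennreal (?H \<nu> t) * indicator {0<..} t) \<partial>lborel)"
  proof (rule nn_integral_cong)
    fix t :: real
    show "ennreal (?H m t) * indicator {0<..} t + ennreal (q t / (2 * t)) * indicator {0<..} t
      = ennreal (1/2) * (ennreal (?H \<mu> t) * indicator {0<..} t) + ennreal (1/2) * (ennreal (?H \<nu> t) * indicator {0<..} t)"
    proof (cases "t > 0")
      case True
      have "?H m t + q t / (2 * t) = 1/2 * ?H \<mu> t + 1/2 * ?H \<nu> t"
        unfolding q_def using True by (simp add: field_simps)
      then have "ennreal (?H m t + q t / (2 * t)) = ennreal (1/2 * ?H \<mu> t + 1/2 * ?H \<nu> t)" by (simp only:)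
      moreover have "ennreal (?H m t + q t / (2 * t)) = ennreal (?H m t) + ennreal (q t / (2 * t))"
        by (rule ennreal_plus[OF H0[OF m True]]) (use q0[OF True] True in simp)
      moreover have "ennreal (1/2 * ?H \<mu> t + 1/2 * ?H \<nu> t) = ennreal (1/2 * ?H \<mu> t) + ennreal (1/2 * ?H \<nu> t)"
        by (rule ennreal_plus) (intro mult_nonneg_nonneg H0[OF \<mu>(1) True] H0[OF \<nu>(1) True], simp)+
      moreover have "ennreal (1/2 * ?H \<mu> t) = ennreal (1/2) * ennreal (?H \<mu> t)" "ennreal (1/2 * ?H \<nu> t) = ennreal (1/2) * ennreal (?H \<nu> t)"
        by (intro ennreal_mult H0[OF \<mu>(1) True] H0[OF \<nu>(1) True], simp)+
      ultimately show ?thesis using True by simp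
    qed simp
  qed
  also have "\<dots> = ennreal (1/2) * ?I \<mu> + ennreal (1/2) * ?I \<nu>"
    by (subst nn_integral_add) (auto simp: nn_integral_cmult)
  also have "\<dots> \<le> ennreal (1/2) * ennreal c + ennreal (1/2) * ennreal c"
    by (intro add_mono mult_left_mono c) auto
  also have "\<dots> = ennreal (1/2 * c + 1/2 * c)"
    using c(1) by (simp only: ennreal_mult[symmetric] ennreal_plus[symmetric] mult_nonneg_nonneg zero_le_divide_1_iff zero_le_numeral)
  also have "1/2 * c + 1/2 * c = c" by simp
  finally have le: "?I m + (\<integral>\<^sup>+t\<in>{0<..}. ennreal (q t / (2 * t)) \<partial>lborel) \<le> ennreal c" .
  have "(\<integral>\<^sup>+t\<in>{0<..}. ennreal (q t / (2 * t)) \<partial>lborel) = 0"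
  proof (rule ccontr)
    let ?q = "\<integral>\<^sup>+t\<in>{0<..}. ennreal (q t / (2 * t)) \<partial>lborel"
    assume ne: "?q \<noteq> 0"
    \<comment> \<open>The finite \<open>c\<close> cancels; an infinite minimal energy would not
      allow this.\<close>
    have "ennreal c + ?q \<le> ennreal c" using le add_right_mono[OF c(4), of ?q] by (rule order_trans[rotated])
    then show False using ne c(1) by (cases ?q) (auto simp: top_unique simp flip: ennreal_plus)
  qed
  then have "AE t in lborel. ennreal (q t / (2 * t)) * indicator {0<..} t = 0"
    by (subst (asm) nn_integral_0_iff_AE) auto
  \<comment> \<open>One t with q t = 0 is wanted, so any set of positive measure serves; on the unit
    interval the denominator 2t is positive.\<close>
  then have "AE t in lborel. t \<in> {0<..<1} \<longrightarrow> q t = 0"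
  proof eventually_elim
    case (elim t)
    show ?case
    proof
      assume t: "t \<in> {0<..<1}"
      then have "q t / (2 * t) \<le> 0" using elim by (simp add: ennreal_eq_0_iff)
      then show "q t = 0" using t q0[of t] by (simp add: divide_le_0_iff)
    qed
  qed
  then obtain t where t: "t > 0" "q t = 0"
  proof -
    assume ae: "AE t in lborel. t \<in> {0<..<1} \<longrightarrow> q t = 0" and th: "\<And>t. 0 < t \<Longrightarrow> q t = 0 \<Longrightarrow> thesis"
    show thesis
    proof (rule ccontr)
      assume "\<not> thesis"
      with th have "q t \<noteq> 0" if "t > 0" for t using that by blast
      with ae have "AE t in lborel. t \<notin> {0<..<1::real}" by (auto elim!: eventually_mono)
      then have "emeasure lborel {0<..<1::real} = 0" by (subst (asm) AE_iff_measurable[of "{0<..<1}"]) auto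
      then show False by simp
    qed
  qed
  then have "(LINT u|lborel. (gauss_potential t \<mu> u - gauss_potential t \<nu> u)\<^sup>2) = 0"
    using q[OF t(1)] by simp
  then have "AE u in lborel. (gauss_potential t \<mu> u - gauss_potential t \<nu> u)\<^sup>2 = 0"
    using integral_nonneg_eq_0_iff_AE[OF iq[OF t(1)]] by simp
  then have "AE u in lborel. gauss_potential t \<mu> u = gauss_potential t \<nu> u" by simp
  then have "gauss_potential t \<mu> = gauss_potential t \<nu>"
    using continuous_on_gauss_potential[OF \<mu>(1), of t] continuous_on_gauss_potential[OF \<nu>(1), of t] t(1)
    by (intro continuous_AE_eq) auto
  then show ?thesis by (rule gauss_potential_inject[OF \<mu>(1) \<nu>(1) E t(1)])
qed

lemma equilibrium_measure_minimizes:
  assumes E: "compact E" and V: "min_log_energy E = ereal V"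
  shows "equilibrium_measure E \<in> prob_measures_on E" "log_energy (equilibrium_measure E) = ereal V"
    and "\<And>\<nu>. \<nu> \<in> prob_measures_on E \<Longrightarrow> log_energy \<nu> \<le> ereal V \<Longrightarrow> \<nu> = equilibrium_measure E"
proof -
  obtain \<mu> where \<mu>: "\<mu> \<in> prob_measures_on E" "log_energy \<mu> = ereal V"
    by (rule log_energy_minimizer_exists[OF E V])
  have u: "\<nu> = \<mu>" if "\<nu> \<in> prob_measures_on E" "log_energy \<nu> \<le> ereal V" for \<nu>
    using log_energy_minimizer_unique[OF E V that \<mu>(1)] \<mu>(2) by simp
  have eq: "equilibrium_measure E = \<mu>"
    unfolding equilibrium_measure_def V
  proof (rule the_equality)
    show "\<mu> \<in> prob_measures_on E \<and> log_energy \<mu> = ereal V" using \<mu> by simp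
    show "\<nu> = \<mu>" if "\<nu> \<in> prob_measures_on E \<and> log_energy \<nu> = ereal V" for \<nu>
      by (rule u) (use that in simp_all)
  qed
  show "equilibrium_measure E \<in> prob_measures_on E" "log_energy (equilibrium_measure E) = ereal V"
    unfolding eq by fact+
  show "\<And>\<nu>. \<nu> \<in> prob_measures_on E \<Longrightarrow> log_energy \<nu> \<le> ereal V \<Longrightarrow> \<nu> = equilibrium_measure E"
    unfolding eq by (rule u)
qed

text \<open>As \<open>real_of_ereal\<close> sends -\<infinity> to 0, the equation for the capacity
  alone would also admit the minimum -\<infinity>. The lower bound -ln(2R) for all energies on
  \<open>E\<close> excludes it.\<close>

lemma min_log_energy_log_capacity:
  assumes E: "compact E" and cap: "log_capacity E = 1"
  shows "min_log_energy E = 0"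
proof -
  obtain R where R: "R \<ge> 1" "E \<subseteq> cball 0 R" by (rule compact_subset_cball[OF E]) blast
  have "ereal (- ln (2 * R)) \<le> log_energy \<nu>" if "\<nu> \<in> prob_measures_on E" for \<nu>
  proof -
    have "0 - ereal (ln (2 * R)) \<le> log_energy \<nu>"
      unfolding log_energy_eq(1)[OF that E R(2) R(1)] by (intro ereal_minus_mono) auto
    then show ?thesis by (simp add: zero_ereal_def)
  qed
  then have "ereal (- ln (2 * R)) \<le> min_log_energy E" unfolding min_log_energy_def by (rule INF_greatest)
  moreover have "min_log_energy E \<noteq> \<infinity>" "real_of_ereal (min_log_energy E) = 0"
    using cap by (auto simp: log_capacity_def split: if_splits)
  ultimately show ?thesis by (cases "min_log_energy E") auto
qed

section \<open>Discriminants of integer polynomials\<close>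

text \<open>Pseudo-division multiplies the dividend by a power of the leading coefficient, which is
  1 here.\<close>

lemma monic_int_poly_division:
  fixes p f :: "int poly"
  assumes "lead_coeff p = 1" "degree p > 0"
  obtains q r where "f = p * q + r" "degree r < degree p"
proof -
  obtain q r where qr: "pseudo_divmod f p = (q, r)" by fastforce
  have "p \<noteq> 0" using assms by auto
  from pseudo_divmod[OF this qr] assms that[of q r] show thesis by auto
qed

lemma poly_as_sum_lessThan:
  fixes r :: "'a :: comm_semiring_1 poly"
  assumes "degree r < n"
  shows "poly r x = (\<Sum>k<n. coeff r k * x ^ k)"
proof -
  have "poly r x = (\<Sum>k\<le>degree r. coeff r k * x ^ k)" by (rule poly_altdef)
  also have "\<dots> = (\<Sum>k<n. coeff r k * x ^ k)"
    using assms by (intro sum.mono_neutral_left) (auto simp: coeff_eq_0)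
  finally show ?thesis .
qed

text \<open>Multiplication by $Q$ on $\mathbb{Z}[x]/(p)$ has an integer matrix which the Vandermonde
  matrix of the roots of $p$ diagonalizes, with eigenvalues the values of $Q$ at the roots.\<close>

lemma prod_poly_roots_is_int:
  fixes p Q :: "int poly" and xs :: "complex list"
  assumes p: "lead_coeff p = 1" and len: "length xs = degree p" and dist: "distinct xs"
    and roots: "\<And>x. x \<in> set xs \<Longrightarrow> poly (map_poly of_int p) x = 0"
  shows "\<exists>k::int. (\<Prod>i<degree p. poly (map_poly of_int Q) (xs ! i)) = of_int k"
proof (cases "degree p = 0")
  case True
  then show ?thesis by (auto intro: exI[of _ 1])
next
  case False
  define n where "n = degree p"
  have n: "n > 0" using False by (simp add: n_def)
  have "\<exists>q r. monom 1 j * Q = p * q + r \<and> degree r < n" for j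
    by (rule monic_int_poly_division[of p "monom 1 j * Q"]) (use p n in \<open>auto simp: n_def\<close>)
  then obtain q r where qr: "\<And>j. monom 1 j * Q = p * q j + r j" "\<And>j. degree (r j) < n" by metis
  define d where "d i = poly (map_poly of_int Q) (xs ! i)" for i
  have root: "poly (map_poly of_int p) (xs ! i) = 0" if "i < n" for i
    using that len roots by (simp add: n_def)
  have ev: "(xs ! i) ^ j * d i = (\<Sum>k<n. of_int (coeff (r j) k) * (xs ! i) ^ k)" if "i < n" for i j
  proof -
    have "poly (map_poly of_int (monom 1 j * Q)) (xs ! i) = poly (map_poly of_int (p * q j + r j)) (xs ! i)"
      by (simp only: qr(1))
    then have "(xs ! i) ^ j * d i = poly (map_poly of_int (r j)) (xs ! i)"
      by (simp add: of_int_poly_hom.hom_mult of_int_poly_hom.hom_add root[OF that] d_def map_poly_monom poly_monom)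
    also have "\<dots> = (\<Sum>k<n. of_int (coeff (r j) k) * (xs ! i) ^ k)"
      using qr(2)[of j] by (subst poly_as_sum_lessThan[of _ n]) (auto simp: coeff_map_poly)
    finally show ?thesis .
  qed
  define V where "V = mat n n (\<lambda>(k, i). (xs ! i) ^ k)"
  define M where "M = mat n n (\<lambda>(j, k). coeff (r j) k)"
  define D where "D = mat n n (\<lambda>(i, j). if i = j then d i else 0)"
  have carr: "V \<in> carrier_mat n n" "M \<in> carrier_mat n n" "D \<in> carrier_mat n n" "map_mat of_int M \<in> carrier_mat n n"
    by (auto simp: V_def M_def D_def)
  have "map_mat of_int M * V = V * D"
  proof (rule eq_matI)
    fix j i assume "j < dim_row (V * D)" "i < dim_col (V * D)"
    then have ji: "j < n" "i < n" using carr by auto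
    have "(map_mat of_int M * V) $$ (j, i) = (\<Sum>k<n. of_int (coeff (r j) k) * (xs ! i) ^ k)"
      using ji by (auto simp: V_def M_def scalar_prod_def lessThan_atLeast0)
    also have "\<dots> = (xs ! i) ^ j * d i" using ev[OF ji(2)] by simp
    also have "\<dots> = (\<Sum>k<n. (xs ! k) ^ j * (if k = i then d k else 0))" 
      using ji by (simp add: if_distrib[of "\<lambda>x. _ * x"] sum.delta cong: if_cong)
    also have "\<dots> = (V * D) $$ (j, i)"
      using ji by (auto simp: V_def D_def scalar_prod_def lessThan_atLeast0)
    finally show "(map_mat of_int M * V) $$ (j, i) = (V * D) $$ (j, i)" .
  qed (use carr in auto)
  then have "det (map_mat of_int M :: complex mat) * det V = det V * det D"
    by (simp only: det_mult[OF carr(4,1), symmetric] det_mult[OF carr(1,3), symmetric])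
  then have eq: "det V * det D = det V * det (map_mat of_int M)" by (simp only: mult.commute)
  \<comment> \<open>Vandermonde: a vector in the left kernel lists the coefficients of a nonzero
    polynomial of degree below n that vanishes at n distinct points.\<close>
  have "det V \<noteq> 0"
  proof
    assume "det V = 0"
    then have "det (transpose_mat V) = 0" using det_transpose[OF carr(1)] by simp
    moreover have "transpose_mat V \<in> carrier_mat n n" using carr by simp
    ultimately obtain v where v: "v \<in> carrier_vec n" "v \<noteq> 0\<^sub>v n" "transpose_mat V *\<^sub>v v = 0\<^sub>v n"
      using det_0_iff_vec_prod_zero_field by blast
    define f where "f = (\<Sum>k<n. monom (v $ k) k)"
    have coeff_f: "coeff f k = (if k < n then v $ k else 0)" for k
      unfolding f_def coeff_sum by (simp add: sum.delta' cong: if_cong)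
    have "poly f x = 0" if x: "x \<in> set xs" for x
    proof -
      obtain i where i: "i < n" "x = xs ! i" using x len by (auto simp: in_set_conv_nth n_def)
      have "poly f x = (\<Sum>k<n. v $ k * x ^ k)" by (simp add: f_def poly_sum poly_monom)
      also have "\<dots> = (transpose_mat V *\<^sub>v v) $ i"
        using i v(1) by (auto simp: V_def scalar_prod_def lessThan_atLeast0 mult.commute)
      finally show ?thesis using v(3) i by simp
    qed
    then have sub: "set xs \<subseteq> {x. poly f x = 0}" by auto
    have "f \<noteq> 0"
    proof
      assume "f = 0"
      then have "v $ k = 0" if "k < n" for k using coeff_f[of k] that by simp
      then have "v = 0\<^sub>v n" using v(1) by (intro eq_vecI) auto
      then show False using v(2) by simp
    qed
    then have "card {x. poly f x = 0} \<le> degree f" "finite {x. poly f x = 0}"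
      using card_poly_roots_bound poly_roots_finite by blast+
    then have "n \<le> degree f" using card_mono[OF _ sub] distinct_card[OF dist] len by (simp add: n_def)
    moreover have "degree f < n" using \<open>f \<noteq> 0\<close> coeff_f[of "degree f"] by (metis leading_coeff_0_iff)
    ultimately show False by simp
  qed
  then have "det D = det (map_mat of_int M)" using eq by (rule mult_left_cancel[THEN iffD1])
  also have "\<dots> = of_int (det M)" by (rule of_int_hom.hom_det)
  also have "det D = prod_list (diag_mat D)"
    by (rule det_upper_triangular[OF _ carr(3)]) (auto simp: D_def)
  also have "\<dots> = (\<Prod>i<n. d i)"
    by (simp add: diag_mat_def D_def prod.list_conv_set_nth lessThan_atLeast0)
  finally show ?thesis unfolding d_def n_def by blast
qed

lemma poly_pderiv_prod_linear:
  fixes xs :: "'a :: {comm_ring_1, ring_no_zero_divisors} list"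
  assumes "i < length xs"
  shows "poly (pderiv (\<Prod>j<length xs. [:- (xs ! j), 1:])) (xs ! i) = (\<Prod>j\<in>{..<length xs} - {i}. xs ! i - xs ! j)"
proof -
  have "poly (pderiv (\<Prod>j<length xs. [:- (xs ! j), 1:])) (xs ! i)
     = (\<Sum>a<length xs. \<Prod>j\<in>{..<length xs} - {a}. xs ! i - xs ! j)"
    by (simp add: pderiv_prod poly_sum poly_prod pderiv_pCons)
  also have "\<dots> = (\<Sum>a<length xs. if a = i then \<Prod>j\<in>{..<length xs} - {i}. xs ! i - xs ! j else 0)"
    using assms by (intro sum.cong refl) (auto intro!: prod_zero)
  finally show ?thesis using assms by (simp add: sum.delta)
qed

text \<open>The double product of the root differences is the product of the values p'(x_i), an
  integer by \<open>prod_poly_roots_is_int\<close> and up to sign the discriminant. Distinct roots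
  make it nonzero, hence of modulus at least 1.\<close>

lemma sum_ln_root_distances_nonneg:
  fixes p :: "int poly" and xs :: "complex list"
  assumes p: "lead_coeff p = 1" and fact: "map_poly of_int p = (\<Prod>j<length xs. [:- (xs ! j), 1:])" and dist: "distinct xs"
  shows "0 \<le> (\<Sum>i<length xs. \<Sum>j\<in>{..<length xs} - {i}. ln (cmod (xs ! i - xs ! j)))"
proof -
  define n where "n = length xs"
  have deg: "degree p = n"
  proof -
    have "degree p = degree (map_poly of_int p :: complex poly)" by simp
    also have "\<dots> = n" unfolding fact by (subst degree_prod_eq_sum_degree) (auto simp: n_def)
    finally show ?thesis .
  qed
  have roots: "poly (map_poly of_int p) x = 0" if "x \<in> set xs" for x
    using that unfolding fact poly_prod by (auto simp: in_set_conv_nth intro!: prod_zero)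
  obtain k :: int where k: "(\<Prod>i<degree p. poly (map_poly of_int (pderiv p)) (xs ! i)) = of_int k"
    using prod_poly_roots_is_int[OF p _ dist roots, of "pderiv p"] deg n_def by auto
  have "poly (map_poly of_int (pderiv p)) (xs ! i) = (\<Prod>j\<in>{..<n} - {i}. xs ! i - xs ! j)" if "i < n" for i
    using poly_pderiv_prod_linear[of i xs] that fact unfolding n_def by (simp add: of_int_hom.map_poly_pderiv)
  then have k': "(\<Prod>i<n. \<Prod>j\<in>{..<n} - {i}. xs ! i - xs ! j) = of_int k"
    using k deg by simp
  have ne: "xs ! i - xs ! j \<noteq> 0" if "i < n" "j \<in> {..<n} - {i}" for i j
    using that dist by (auto simp: nth_eq_iff_index_eq n_def)
  then have "(\<Prod>i<n. \<Prod>j\<in>{..<n} - {i}. xs ! i - xs ! j) \<noteq> 0" by auto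
  then have "k \<noteq> 0" using k' by auto
  then have "1 \<le> \<bar>k\<bar>" by simp
  then have "(1::real) \<le> \<bar>of_int k\<bar>" by linarith
  also have "\<dots> = cmod (of_int k)" by simp
  also have "\<dots> = (\<Prod>i<n. \<Prod>j\<in>{..<n} - {i}. cmod (xs ! i - xs ! j))"
    unfolding k'[symmetric] by (simp add: prod_norm[symmetric])
  finally have "0 \<le> ln (\<Prod>i<n. \<Prod>j\<in>{..<n} - {i}. cmod (xs ! i - xs ! j))" by simp
  also have "\<dots> = (\<Sum>i<n. \<Sum>j\<in>{..<n} - {i}. ln (cmod (xs ! i - xs ! j)))"
    using ne by (subst ln_prod) (auto intro!: prod_pos sum.cong ln_prod)
  finally show ?thesis by (simp add: n_def)
qed

section \<open>Factorization and separability of minimal polynomials\<close>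

lemma monic_complex_poly_factorization:
  fixes p :: "complex poly"
  assumes "lead_coeff p = 1"
  obtains xs :: "complex list" where "length xs = degree p" "p = (\<Prod>j<length xs. [:- (xs ! j), 1:])"
proof -
  have "p \<noteq> 0" using assms by auto
  then obtain A where A: "size A = degree p" "p = Polynomial.smult (lead_coeff p) (\<Prod>x\<in>#A. [:-x, 1:])"
    using alg_closed_imp_factorization by blast
  obtain xs where xs: "mset xs = A" using ex_mset by blast
  have "p = (\<Prod>x\<in>#mset xs. [:-x, 1:])" using A assms xs by simp
  also have "\<dots> = prod_list (map (\<lambda>x. [:-x, 1:]) xs)" by (simp flip: prod_mset_prod_list)
  also have "\<dots> = (\<Prod>j<length xs. [:- (xs ! j), 1:])" by (simp add: prod.list_conv_set_nth lessThan_atLeast0)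
  finally show thesis using that[of xs] A(1) xs by auto
qed

text \<open>Minimality is known at \<alpha> only, while the double root \<beta> may be any
  conjugate. A rational q of least degree vanishing at \<beta> divides p and p'. Its degree is below
  that of p, so it does not vanish at \<alpha>; hence the cofactor does, and minimality leaves
  degree 0 for q.\<close>

lemma minimal_int_poly_separable:
  assumes "is_minimal_int_poly p \<alpha>" and \<beta>: "poly (map_poly of_int p) (\<beta>::complex) = 0"
  shows "poly (pderiv (map_poly of_int p)) \<beta> \<noteq> 0"
proof
  assume \<beta>': "poly (pderiv (map_poly of_int p)) \<beta> = 0"
  interpret H: map_poly_comm_ring_hom "of_rat :: rat \<Rightarrow> complex" ..
  have p: "lead_coeff p = 1" "poly (map_poly of_int p) \<alpha> = 0"
    and min: "\<And>q :: rat poly. q \<noteq> 0 \<Longrightarrow> poly (map_poly of_rat q) \<alpha> = 0 \<Longrightarrow> degree p \<le> degree q"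
    using assms(1) by (auto simp: is_minimal_int_poly_def)
  define P where "P = (map_poly of_int p :: rat poly)"
  have PP: "map_poly of_rat P = (map_poly of_int p :: complex poly)"
    unfolding P_def by (subst map_poly_map_poly) (auto simp: comp_def)
  have dP: "degree P = degree p" unfolding P_def by simp
  have "degree p \<noteq> 0"
  proof
    assume "degree p = 0"
    then obtain c where c: "p = [:c:]" by (rule degree_eq_zeroE)
    then have "c = 1" using p(1) by simp
    then show False using p(2) c by simp
  qed
  then have P0: "P \<noteq> 0" "degree P > 0" using dP by auto
  have dP': "degree (pderiv P) = degree P - 1" by (rule degree_pderiv)
  have P'0: "pderiv P \<noteq> 0" using P0(2) by (simp add: pderiv_eq_0_iff)
  let ?van = "\<lambda>q :: rat poly. q \<noteq> 0 \<and> poly (map_poly of_rat q) \<beta> = 0"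
  have PP': "map_poly of_rat (pderiv P) = pderiv (map_poly of_int p :: complex poly)"
    unfolding PP[symmetric] by (rule of_rat_hom.map_poly_pderiv)
  have "?van P" using P0(1) \<beta> PP by simp
  then obtain q where q: "?van q" "\<And>r. ?van r \<Longrightarrow> degree q \<le> degree r"
    using ex_has_least_nat[of ?van P degree] by blast
  have dvd: "q dvd f" if "poly (map_poly of_rat f) \<beta> = 0" for f
  proof -
    have "map_poly of_rat (f div q * q + f mod q) = (map_poly of_rat f :: complex poly)" by simp
    from arg_cong[OF this, of "\<lambda>f. poly f \<beta>"] have "poly (map_poly of_rat (f mod q)) \<beta> = 0"
      using that q(1) by (simp only: H.hom_add H.hom_mult poly_add poly_mult mult_zero_right add_0)
    then have "f mod q = 0" using q degree_mod_less'[of q f] by (meson not_le)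
    then show ?thesis by (simp add: dvd_eq_mod_eq_0)
  qed
  have "q dvd P" "q dvd pderiv P" using \<beta> \<beta>' by (auto intro!: dvd simp: PP PP')
  then obtain H where H: "P = q * H" by (elim dvdE)
  have H0: "H \<noteq> 0" using H P0(1) by auto
  have "poly (map_poly of_rat q) \<alpha> * poly (map_poly of_rat H) \<alpha> = 0"
    using p(2) unfolding PP[symmetric] H by (simp add: H.hom_mult)
  moreover have "poly (map_poly of_rat q) \<alpha> \<noteq> 0"
  proof
    assume "poly (map_poly of_rat q) \<alpha> = 0"
    then have "degree p \<le> degree q" using q(1) by (intro min) simp_all
    moreover have "degree q \<le> degree (pderiv P)" by (intro dvd_imp_degree_le P'0) fact
    ultimately show False using dP' P0(2) dP by simp
  qed
  ultimately have "poly (map_poly of_rat H) \<alpha> = 0" by simp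
  then have "degree p \<le> degree H" by (rule min[OF H0])
  moreover have "degree P = degree q + degree H" unfolding H using q(1) H0 by (intro degree_mult_eq) auto
  ultimately have "degree q = 0" using dP by simp
  then obtain c where c: "q = [:c:]" by (rule degree_eq_zeroE)
  then have "map_poly of_rat q = [:complex_of_rat c:]"
    by (intro poly_eqI) (simp add: coeff_map_poly coeff_pCons split: nat.split)
  then show False using q(1) c by simp
qed

lemma minimal_int_poly_roots:
  assumes "is_minimal_int_poly p \<alpha>"
  obtains xs where "length xs = degree p" "distinct xs" "set xs = complex_roots p" "\<alpha> \<in> set xs"
    "map_poly of_int p = (\<Prod>j<length xs. [:- (xs ! j), 1:])"
proof -
  have p: "lead_coeff p = 1" "poly (map_poly of_int p) \<alpha> = 0"
    using assms by (auto simp: is_minimal_int_poly_def)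
  have "lead_coeff (map_poly of_int p :: complex poly) = 1" using p(1) by simp
  then obtain xs :: "complex list" where xs: "length xs = degree (map_poly of_int p :: complex poly)"
      "map_poly of_int p = (\<Prod>j<length xs. [:- (xs ! j), 1:])"
    by (rule monic_complex_poly_factorization)
  have set: "set xs = complex_roots p"
    unfolding complex_roots_def xs(2) by (auto simp: poly_prod in_set_conv_nth)
  have "distinct xs"
    unfolding distinct_conv_nth
  proof (intro allI impI notI)
    fix i j assume ij: "i < length xs" "j < length xs" "i \<noteq> j" "xs ! i = xs ! j"
    have "poly (pderiv (map_poly of_int p)) (xs ! i) = (\<Prod>j\<in>{..<length xs} - {i}. xs ! i - xs ! j)"
      unfolding xs(2) by (rule poly_pderiv_prod_linear[OF ij(1)])
    also have "\<dots> = 0" using ij by (intro prod_zero) auto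
    finally have 0: "poly (pderiv (map_poly of_int p)) (xs ! i) = 0" .
    have "xs ! i \<in> set xs" using ij(1) by simp
    then have "poly (map_poly of_int p) (xs ! i) = 0" unfolding set complex_roots_def by simp
    from minimal_int_poly_separable[OF assms this] 0 show False by (rule notE)
  qed
  moreover have "\<alpha> \<in> set xs" using p(2) unfolding set by (simp add: complex_roots_def)
  moreover have "length xs = degree p" unfolding xs(1) by simp
  ultimately show thesis using that set xs(2) by blast
qed

section \<open>Root measures\<close>

lemma LIMSEQ_subsequence_principle:
  fixes x :: "nat \<Rightarrow> 'a :: metric_space"
  assumes "\<And>s :: nat \<Rightarrow> nat. strict_mono s \<Longrightarrow> \<exists>r :: nat \<Rightarrow> nat. strict_mono r \<and> (\<lambda>k. x (s (r k))) \<longlonglongrightarrow> l"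
  shows "x \<longlonglongrightarrow> l"
proof (rule ccontr)
  assume "\<not> x \<longlonglongrightarrow> l"
  then obtain e where e: "e > 0" "\<And>N. \<exists>n\<ge>N. dist (x n) l \<ge> e"
    unfolding lim_sequentially by (auto simp: not_less)
  then have "infinite {n. dist (x n) l \<ge> e}" by (auto simp: infinite_nat_iff_unbounded_le)
  from infinite_enumerate[OF this] obtain s :: "nat \<Rightarrow> nat" where s: "strict_mono s" "\<And>k. dist (x (s k)) l \<ge> e" by auto
  from assms[OF s(1)] obtain r :: "nat \<Rightarrow> nat" where "(\<lambda>k. x (s (r k))) \<longlonglongrightarrow> l" by blast
  from tendstoD[OF this e(1)] have "\<forall>\<^sub>F k in sequentially. dist (x (s (r k))) l < e" .
  then have "\<forall>\<^sub>F k in sequentially. False" by eventually_elim (use s(2) in \<open>simp add: not_less[symmetric]\<close>)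
  then show False by simp
qed

text \<open>Choosing a position in the list counts repeated entries with multiplicity, as the
  preimages of a point under an iterate require.\<close>

definition root_measure :: "complex list \<Rightarrow> complex measure" where
  "root_measure xs = distr (measure_pmf (pmf_of_set {..<length xs})) borel (\<lambda>i. xs ! i)"

lemma integral_root_measure:
  fixes f :: "complex \<Rightarrow> real"
  assumes "xs \<noteq> []" "f \<in> borel_measurable borel"
  shows "(LINT z|root_measure xs. f z) = (\<Sum>i<length xs. f (xs ! i)) / length xs"
proof -
  have "{..<length xs} \<noteq> {}" using assms(1) by (simp add: lessThan_empty_iff)
  then show ?thesis
    unfolding root_measure_def using assms
    by (subst integral_distr) (auto simp: integral_pmf_of_set)
qed

lemma root_measure_in_prob_measures_on:
  assumes "xs \<noteq> []" "set xs \<subseteq> K" "K \<in> sets borel"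
  shows "root_measure xs \<in> prob_measures_on K"
proof -
  interpret prob_space "root_measure xs"
    unfolding root_measure_def by (rule measure_pmf.prob_space_distr) simp
  have "{..<length xs} \<noteq> {}" using assms(1) by (simp add: lessThan_empty_iff)
  then have set: "set_pmf (pmf_of_set {..<length xs}) = {..<length xs}" by (intro set_pmf_of_set) auto
  have "AE z in root_measure xs. z \<in> K"
    unfolding root_measure_def using assms
    by (subst AE_distr_iff) (auto simp: AE_measure_pmf_iff set)
  then have "emeasure (root_measure xs) K = 1"
    using emeasure_eq_1_AE[of K] assms(3) by (simp add: root_measure_def)
  then show ?thesis using prob_space_axioms by (simp add: prob_measures_on_def root_measure_def)
qed

lemma gauss_energy_root_measure:
  assumes "xs \<noteq> []" "t > 0"
  shows "gauss_energy t (root_measure xs) = (\<Sum>i<length xs. \<Sum>j<length xs. gauss t (xs ! i) (xs ! j)) / (length xs)\<^sup>2"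
proof -
  have \<nu>: "root_measure xs \<in> prob_measures_on (set xs)"
    using assms by (intro root_measure_in_prob_measures_on) (auto simp: finite_imp_closed)
  note [measurable_cong] = prob_measures_onD(2)[OF \<nu>]
  interpret prob_space "root_measure xs" using prob_measures_onD(1)[OF \<nu>] .
  interpret P: pair_prob_space "root_measure xs" "root_measure xs" ..
  have gi: "integrable (root_measure xs \<Otimes>\<^sub>M root_measure xs) (\<lambda>(x, y). gauss t x y)"
    by (rule P.integrable_const_bound[where B = 1]) (use gauss_bounds assms in \<open>auto simp: split_beta'\<close>)
  have "gauss_energy t (root_measure xs) = (LINT p|(root_measure xs \<Otimes>\<^sub>M root_measure xs). (case p of (x, y) \<Rightarrow> gauss t x y))"
    using gauss_energy_eq[OF \<nu> finite_imp_compact[OF finite_set] assms(2)] by (simp add: split_beta')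
  also have "\<dots> = (LINT x|root_measure xs. LINT y|root_measure xs. gauss t x y)"
    by (rule P.integral_fst[OF gi, symmetric])
  also have "\<dots> = (LINT x|root_measure xs. (\<Sum>j<length xs. gauss t x (xs ! j)) / length xs)"
    using assms by (subst integral_root_measure) auto
  also have "\<dots> = (\<Sum>i<length xs. (\<Sum>j<length xs. gauss t (xs ! i) (xs ! j)) / length xs) / length xs"
    using assms by (subst integral_root_measure) auto
  finally show ?thesis by (simp add: sum_divide_distrib power2_eq_square)
qed

lemma discrete_energy_bound:
  assumes ne: "xs \<noteq> []" and dist: "distinct xs" and sub: "set xs \<subseteq> cball 0 R" and R: "R \<ge> 1"
    and disc: "0 \<le> (\<Sum>i<length xs. \<Sum>j\<in>{..<length xs} - {i}. ln (cmod (xs ! i - xs ! j)))"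
  shows "(\<integral>\<^sup>+t\<in>{0<..}. ennreal ((gauss_energy t (root_measure xs) - 1 / length xs
     - (1 - 1 / length xs) * exp (- t * (2 * R)\<^sup>2)) / (2 * t)) \<partial>lborel) \<le> ennreal (ln (2 * R))"
proof -
  define d where "d = length xs"
  have d: "d > 0" using ne by (simp add: d_def)
  define D where "D = 2 * R"
  have D: "D \<ge> 1" using R by (simp add: D_def)
  define S where "S = Sigma {..<d} (\<lambda>i. {..<d} - {i})"
  define r where "r p = cmod (xs ! fst p - xs ! snd p)" for p
  have sumS: "(\<Sum>p\<in>S. F p) = (\<Sum>i<d. \<Sum>j\<in>{..<d} - {i}. F (i, j))" for F :: "nat \<times> nat \<Rightarrow> real"
    unfolding S_def by (subst sum.Sigma) (auto simp: split_def)
  have r: "0 < r p" "r p \<le> D" if "p \<in> S" for p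
  proof -
    have ij: "fst p < length xs" "snd p < length xs" "fst p \<noteq> snd p" using that by (auto simp: S_def d_def)
    then show "0 < r p" using dist by (auto simp: r_def nth_eq_iff_index_eq)
    have "xs ! fst p \<in> cball 0 R" "xs ! snd p \<in> cball 0 R" using ij sub nth_mem by blast+
    then show "r p \<le> D" using norm_triangle_ineq4[of "xs ! fst p" "xs ! snd p"] by (simp add: r_def D_def)
  qed
  have cardS: "real (card S) = real d * (real d - 1)" using d by (simp add: S_def of_nat_diff)
  define h where "h p t = (exp (- t * (r p)\<^sup>2) - exp (- t * D\<^sup>2)) / (2 * t)" for p t
  have h0: "h p t \<ge> 0" if "p \<in> S" "t > 0" for p t
    unfolding h_def using that r[OF that(1)] by (auto intro!: divide_nonneg_pos mult_left_mono power_mono)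
  have key: "(gauss_energy t (root_measure xs) - 1 / d - (1 - 1 / d) * exp (- t * D\<^sup>2)) / (2 * t) = (\<Sum>p\<in>S. h p t) / d\<^sup>2"
    if t: "t > 0" for t
  proof -
    have "(\<Sum>i<d. \<Sum>j<d. gauss t (xs ! i) (xs ! j)) = (\<Sum>i<d. 1 + (\<Sum>j\<in>{..<d} - {i}. gauss t (xs ! i) (xs ! j)))"
      by (intro sum.cong refl) (subst sum.remove, auto simp: gauss_def)
    also have "\<dots> = d + (\<Sum>p\<in>S. exp (- t * (r p)\<^sup>2))"
      unfolding sumS by (simp add: sum.distrib gauss_def r_def)
    finally have g: "gauss_energy t (root_measure xs) = (d + (\<Sum>p\<in>S. exp (- t * (r p)\<^sup>2))) / d\<^sup>2"
      using gauss_energy_root_measure[OF ne t] by (simp add: d_def)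
    have s: "(\<Sum>p\<in>S. h p t) = ((\<Sum>p\<in>S. exp (- t * (r p)\<^sup>2)) - real d * (real d - 1) * exp (- t * D\<^sup>2)) / (2 * t)"
      unfolding h_def sum_divide_distrib[symmetric] sum_subtractf by (simp add: cardS)
    have alg: "(d + X) / d\<^sup>2 - 1 / d - (1 - 1 / d) * Y = (X - real d * (real d - 1) * Y) / d\<^sup>2" for X Y :: real
    proof -
      have a: "1 / real d = real d / (real d)\<^sup>2" "1 - real d / (real d)\<^sup>2 = real d * (real d - 1) / (real d)\<^sup>2"
        using d by (simp_all add: power2_eq_square right_diff_distrib diff_divide_distrib)
      show ?thesis unfolding a by (simp add: add_divide_distrib diff_divide_distrib)
    qed
    show ?thesis unfolding g alg s by simp
  qed
  have "(\<integral>\<^sup>+t\<in>{0<..}. ennreal ((gauss_energy t (root_measure xs) - 1 / d - (1 - 1 / d) * exp (- t * D\<^sup>2)) / (2 * t)) \<partial>lborel)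
    = (\<integral>\<^sup>+t. (\<Sum>p\<in>S. ennreal (1 / d\<^sup>2) * (ennreal (h p t) * indicator {0<..} t)) \<partial>lborel)"
  proof (rule nn_integral_cong)
    fix t :: real
    show "ennreal ((gauss_energy t (root_measure xs) - 1 / d - (1 - 1 / d) * exp (- t * D\<^sup>2)) / (2 * t)) * indicator {0<..} t
      = (\<Sum>p\<in>S. ennreal (1 / d\<^sup>2) * (ennreal (h p t) * indicator {0<..} t))"
    proof (cases "t > 0")
      case True
      have "(\<Sum>p\<in>S. ennreal (1 / d\<^sup>2) * ennreal (h p t)) = (\<Sum>p\<in>S. ennreal (1 / d\<^sup>2 * h p t))"
        by (intro sum.cong refl ennreal_mult[symmetric] h0[OF _ True]) simp
      also have "\<dots> = ennreal (\<Sum>p\<in>S. 1 / d\<^sup>2 * h p t)"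
        by (intro sum_ennreal mult_nonneg_nonneg h0[OF _ True]) auto
      also have "(\<Sum>p\<in>S. 1 / d\<^sup>2 * h p t) = (\<Sum>p\<in>S. h p t) / d\<^sup>2" by (simp add: sum_divide_distrib)
      finally show ?thesis unfolding key[OF True] using True by simp
    qed simp
  qed
  also have "\<dots> = (\<Sum>p\<in>S. ennreal (1 / d\<^sup>2) * (\<integral>\<^sup>+t\<in>{0<..}. ennreal (h p t) \<partial>lborel))"
    by (subst nn_integral_sum) (auto simp: h_def intro!: sum.cong nn_integral_cmult)
  also have "\<dots> = (\<Sum>p\<in>S. ennreal (1 / d\<^sup>2 * (ln D - ln (r p))))"
  proof (rule sum.cong[OF refl])
    fix p assume p: "p \<in> S"
    have "(r p)\<^sup>2 \<le> D\<^sup>2" using r[OF p] by (intro power_mono) auto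
    then have "(\<integral>\<^sup>+t\<in>{0<..}. ennreal (h p t) \<partial>lborel) = ennreal ((ln (D\<^sup>2) - ln ((r p)\<^sup>2)) / 2)"
      unfolding h_def using r[OF p] by (intro frullani_exp) auto
    also have "(ln (D\<^sup>2) - ln ((r p)\<^sup>2)) / 2 = ln D - ln (r p)" using r[OF p] D by (simp add: ln_realpow)
    finally have 1: "(\<integral>\<^sup>+t\<in>{0<..}. ennreal (h p t) \<partial>lborel) = ennreal (ln D - ln (r p))" .
    have "ln (r p) \<le> ln D" using r[OF p] by simp
    then show "ennreal (1 / d\<^sup>2) * (\<integral>\<^sup>+t\<in>{0<..}. ennreal (h p t) \<partial>lborel) = ennreal (1 / d\<^sup>2 * (ln D - ln (r p)))"
      unfolding 1 by (intro ennreal_mult[symmetric]) auto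
  qed
  also have "\<dots> = ennreal (\<Sum>p\<in>S. 1 / d\<^sup>2 * (ln D - ln (r p)))"
  proof (rule sum_ennreal)
    fix p assume p: "p \<in> S"
    have "ln (r p) \<le> ln D" using r[OF p] by simp
    then show "0 \<le> 1 / d\<^sup>2 * (ln D - ln (r p))" by simp
  qed
  also have "(\<Sum>p\<in>S. 1 / d\<^sup>2 * (ln D - ln (r p))) = (real d * (real d - 1) * ln D - (\<Sum>p\<in>S. ln (r p))) / d\<^sup>2"
    by (simp add: sum_divide_distrib[symmetric] sum_subtractf cardS)
  also have "ennreal \<dots> \<le> ennreal (ln D)"
  proof (rule ennreal_leI)
    have "(\<Sum>p\<in>S. ln (r p)) \<ge> 0"
      using disc unfolding sumS r_def d_def by simp
    then have "(real d * (real d - 1) * ln D - (\<Sum>p\<in>S. ln (r p))) / d\<^sup>2 \<le> real d * real d * ln D / d\<^sup>2"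
      using D d by (intro divide_right_mono) (auto simp: algebra_simps)
    then show "(real d * (real d - 1) * ln D - (\<Sum>p\<in>S. ln (r p))) / d\<^sup>2 \<le> ln D" using d by (simp add: power2_eq_square)
  qed
  finally show ?thesis unfolding d_def D_def .
qed

section \<open>Degrees of the minimal polynomials\<close>

lemma coeff_prod_linear_bound:
  fixes f :: "nat \<Rightarrow> complex"
  assumes "\<And>j. j < n \<Longrightarrow> cmod (f j) \<le> R" "R \<ge> 0"
  shows "cmod (coeff (\<Prod>j<n. [:- f j, 1:]) k) \<le> (1 + R) ^ n"
  using assms(1)
proof (induction n arbitrary: k)
  case 0
  then show ?case by simp
next
  case (Suc n)
  let ?q = "\<Prod>j<n. [:- f j, 1:]"
  have IH: "cmod (coeff ?q k) \<le> (1 + R) ^ n" for k using Suc by simp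
  have "coeff (\<Prod>j<Suc n. [:- f j, 1:]) k = (case k of 0 \<Rightarrow> 0 | Suc k \<Rightarrow> coeff ?q k) - f n * coeff ?q k"
    by (simp add: mult.commute[of ?q] coeff_pCons)
  also have "cmod \<dots> \<le> (1 + R) ^ n + R * (1 + R) ^ n"
    using assms(2) IH Suc.prems[of n]
    by (intro order_trans[OF norm_triangle_ineq4] add_mono) (auto simp: norm_mult intro!: mult_mono split: nat.split)
  finally show ?case by (simp add: algebra_simps)
qed

lemma finite_bounded_int_polys: "finite {p :: int poly. degree p \<le> d \<and> (\<forall>k. \<bar>coeff p k\<bar> \<le> B)}" (is "finite ?S")
proof (rule finite_imageD)
  let ?f = "\<lambda>p. map (coeff p) [0..<Suc d]"
  have "?f ` ?S \<subseteq> {l. set l \<subseteq> {-B..B} \<and> length l = Suc d}" by (auto simp: abs_le_iff minus_le_iff)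
  then show "finite (?f ` ?S)" by (rule finite_subset) (rule finite_lists_length_eq, simp)
  show "inj_on ?f ?S"
  proof (rule inj_onI)
    fix p q assume pq: "p \<in> ?S" "q \<in> ?S" "?f p = ?f q"
    have "coeff p k = coeff q k" for k
    proof (cases "k < Suc d")
      case True
      then show ?thesis using pq(3) by (metis map_eq_conv atLeast_upt lessThan_iff)
    next
      case False
      then show ?thesis using pq by (simp add: coeff_eq_0)
    qed
    then show "p = q" by (rule poly_eqI)
  qed
qed

text \<open>Northcott's argument: roots in a fixed disc bound the coefficients, so only finitely
  many integer polynomials of bounded degree occur. Together they have finitely many roots, and the
  \<open>\<alpha> n\<close> are distinct.\<close>

lemma degree_minimal_int_poly_at_top:
  fixes P :: "nat \<Rightarrow> int poly"
  assumes inj: "inj \<alpha>" and min: "\<And>n. is_minimal_int_poly (P n) (\<alpha> n)" and R: "R \<ge> 0"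
    and bd: "\<And>n. n \<ge> N \<Longrightarrow> complex_roots (P n) \<subseteq> cball 0 R"
  shows "filterlim (\<lambda>n. degree (P n)) at_top sequentially"
  unfolding filterlim_at_top
proof
  fix d
  define B :: int where "B = \<lceil>(1 + R) ^ d\<rceil>"
  define F where "F = {p :: int poly. degree p \<le> d \<and> (\<forall>k. \<bar>coeff p k\<bar> \<le> B)}"
  have mem: "P n \<in> F" if n: "n \<ge> N" "degree (P n) < d" for n
  proof -
    obtain xs where xs: "length xs = degree (P n)" "set xs = complex_roots (P n)"
      "map_poly of_int (P n) = (\<Prod>j<length xs. [:- (xs ! j), 1:])"
      by (rule minimal_int_poly_roots[OF min[of n]]) blast
    have "\<bar>coeff (P n) k\<bar> \<le> B" for k
    proof -
      have "real_of_int \<bar>coeff (P n) k\<bar> = cmod (coeff (map_poly of_int (P n)) k)" by (simp add: coeff_map_poly)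
      also have "\<dots> \<le> (1 + R) ^ length xs"
        unfolding xs(3) using bd[OF n(1)] xs(2) R nth_mem by (intro coeff_prod_linear_bound) fastforce+
      also have "\<dots> \<le> (1 + R) ^ d" using n xs R by (intro power_increasing) auto
      finally show ?thesis unfolding B_def by linarith
    qed
    then show ?thesis using n by (simp add: F_def)
  qed
  \<comment> \<open>The zero polynomial satisfies the coefficient bounds, but every number is a root
    of it.\<close>
  have "finite (\<Union>p\<in>F - {0}. complex_roots p)"
    unfolding complex_roots_def using finite_bounded_int_polys[of d B]
    by (intro finite_UN_I) (auto simp: F_def poly_roots_finite)
  moreover have "\<alpha> ` {n. n \<ge> N \<and> degree (P n) < d} \<subseteq> (\<Union>p\<in>F - {0}. complex_roots p)"
  proof (rule image_subsetI)
    fix n assume "n \<in> {n. n \<ge> N \<and> degree (P n) < d}"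
    then have "P n \<in> F" using mem by simp
    moreover have "P n \<noteq> 0" "\<alpha> n \<in> complex_roots (P n)" using min[of n] by (auto simp: is_minimal_int_poly_def complex_roots_def)
    ultimately show "\<alpha> n \<in> (\<Union>p\<in>F - {0}. complex_roots p)" by blast
  qed
  ultimately have "finite (\<alpha> ` {n. n \<ge> N \<and> degree (P n) < d})" by (rule finite_subset[rotated])
  then have "finite {n. n \<ge> N \<and> degree (P n) < d}" by (rule finite_imageD) (rule inj_on_subset[OF inj subset_UNIV])
  then have "\<forall>\<^sub>F n in sequentially. n \<notin> {n. n \<ge> N \<and> degree (P n) < d}" 
    by (simp add: eventually_cofinite flip: cofinite_eq_sequentially)
  then show "\<forall>\<^sub>F n in sequentially. d \<le> degree (P n)"
    using eventually_ge_at_top[of N] by eventually_elim auto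
qed

section \<open>Equidistribution and uniform convergence\<close>

lemma abs_ln_diff_le:
  fixes a b c :: real
  assumes "c > 0" "a \<ge> c" "b \<ge> c"
  shows "\<bar>ln a - ln b\<bar> \<le> \<bar>a - b\<bar> / c"
proof -
  have *: "ln x - ln y \<le> \<bar>x - y\<bar> / c" if "x \<ge> c" "y \<ge> c" for x y :: real
  proof (cases "x \<ge> y")
    case True
    have "ln x - ln y = ln (x / y)" using that assms(1) by (simp add: ln_div)
    also have "\<dots> \<le> x / y - 1" using that assms(1) by (intro ln_le_minus_one) auto
    also have "\<dots> = (x - y) / y" using that assms(1) by (simp add: field_simps)
    also have "\<dots> \<le> (x - y) / c" using True that assms(1) by (intro divide_left_mono) auto
    finally show ?thesis using True by simp
  next
    case False
    then have "ln x - ln y \<le> 0" using that assms(1) by simp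
    also have "0 \<le> \<bar>x - y\<bar> / c" using assms(1) by simp
    finally show ?thesis .
  qed
  show ?thesis using *[OF assms(2,3)] *[OF assms(3,2)] by (simp add: abs_le_iff abs_minus_commute)
qed

text \<open>A continuous majorant of ln|w| for w \<noteq> 0, on which weak limits may be tested; the
  two agree where |w| is at least exp(-M).\<close>

definition trunc_ln :: "real \<Rightarrow> complex \<Rightarrow> real" where
  "trunc_ln M w = ln (max (cmod w) (exp (- M)))"

lemma trunc_ln_lipschitz: "\<bar>trunc_ln M a - trunc_ln M b\<bar> \<le> exp M * dist a b"
proof -
  have "\<bar>trunc_ln M a - trunc_ln M b\<bar> \<le> \<bar>max (cmod a) (exp (- M)) - max (cmod b) (exp (- M))\<bar> / exp (- M)"
    unfolding trunc_ln_def by (intro abs_ln_diff_le) auto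
  also have "\<dots> \<le> dist a b / exp (- M)"
    using norm_triangle_ineq3[of a b] by (intro divide_right_mono) (auto simp: dist_norm)
  finally show ?thesis by (simp add: exp_minus divide_inverse mult.commute)
qed

lemma continuous_on_trunc_ln [continuous_intros]: "continuous_on S f \<Longrightarrow> continuous_on S (\<lambda>x. trunc_ln M (f x))"
  unfolding trunc_ln_def by (intro continuous_intros) (auto simp: max_def not_le intro: less_trans[OF exp_gt_zero])

lemma trunc_ln_eq: "exp (- M) \<le> cmod w \<Longrightarrow> trunc_ln M w = ln (cmod w)"
  by (simp add: trunc_ln_def)

lemma ln_le_trunc_ln: "w \<noteq> 0 \<Longrightarrow> ln (cmod w) \<le> trunc_ln M w"
  by (simp add: trunc_ln_def max_def)

text \<open>The evaluation points move along with the measures. The Lipschitz constant exp(M) of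
  \<open>trunc_ln M\<close> controls the shift from \<open>z k\<close> to \<open>w\<close> uniformly
  over all measures.\<close>

lemma weak_limit_trunc_ln:
  assumes lim: "weak_limit \<nu> \<mu>" and \<nu>: "\<And>k. \<nu> k \<in> prob_measures_on K" and K: "compact K"
    and z: "z \<longlonglongrightarrow> w"
  shows "(\<lambda>k. LINT \<zeta>|\<nu> k. trunc_ln M (z k - \<zeta>)) \<longlonglongrightarrow> (LINT \<zeta>|\<mu>. trunc_ln M (w - \<zeta>))"
proof -
  have c: "continuous_on UNIV (\<lambda>\<zeta>. trunc_ln M (v - \<zeta>))" for v by (intro continuous_intros)
  have 1: "(\<lambda>k. LINT \<zeta>|\<nu> k. trunc_ln M (w - \<zeta>)) \<longlonglongrightarrow> (LINT \<zeta>|\<mu>. trunc_ln M (w - \<zeta>))"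
    using lim c unfolding weak_limit_def by blast
  have b: "norm ((LINT \<zeta>|\<nu> k. trunc_ln M (z k - \<zeta>)) - (LINT \<zeta>|\<nu> k. trunc_ln M (w - \<zeta>))) \<le> exp M * dist (z k) w" for k
  proof -
    interpret prob_space "\<nu> k" using prob_measures_onD(1)[OF \<nu>] .
    note i = integrable_continuous_prob_measures_on[OF \<nu> K c]
    have "\<bar>LINT \<zeta>|\<nu> k. trunc_ln M (z k - \<zeta>) - trunc_ln M (w - \<zeta>)\<bar> \<le> (LINT \<zeta>|\<nu> k. \<bar>trunc_ln M (z k - \<zeta>) - trunc_ln M (w - \<zeta>)\<bar>)"
      by (rule integral_abs_bound)
    also have "\<dots> \<le> (LINT \<zeta>|\<nu> k. exp M * dist (z k) w)"
    proof (rule integral_mono)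
      show "\<bar>trunc_ln M (z k - \<zeta>) - trunc_ln M (w - \<zeta>)\<bar> \<le> exp M * dist (z k) w" for \<zeta>
        using trunc_ln_lipschitz[of M "z k - \<zeta>" "w - \<zeta>"] by (simp add: dist_norm)
    qed (use i in auto)
    finally show ?thesis using i by (simp add: prob_space)
  qed
  have "(\<lambda>k. exp M * dist (z k) w) \<longlonglongrightarrow> 0"
    using tendsto_mult_right_zero[OF tendsto_dist_iff[THEN iffD1, OF z]] by simp
  from Lim_null_comparison[OF always_eventually[OF allI[OF b]] this]
  have "(\<lambda>k. (LINT \<zeta>|\<nu> k. trunc_ln M (z k - \<zeta>)) - (LINT \<zeta>|\<nu> k. trunc_ln M (w - \<zeta>))) \<longlonglongrightarrow> 0" .
  from tendsto_add[OF this 1] show ?thesis by simp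
qed

lemma weak_limit_subseq: "weak_limit \<nu> \<mu> \<Longrightarrow> strict_mono s \<Longrightarrow> weak_limit (\<lambda>k. \<nu> (s k)) \<mu>"
  unfolding weak_limit_def using LIMSEQ_subseq_LIMSEQ by (fastforce simp: comp_def)

text \<open>Where the logarithmic potential is $-\infty$ the Bochner integral has the junk value $0$,
  which is still an upper bound.\<close>

lemma trunc_ln_potential_less:
  assumes \<mu>: "\<mu> \<in> prob_measures_on K" and K: "compact K" and e: "e > 0"
  shows "\<exists>M. (LINT \<zeta>|\<mu>. trunc_ln M (z - \<zeta>)) < (LINT \<zeta>|\<mu>. ln (cmod (z - \<zeta>))) + e"
proof (rule ccontr)
  define c where "c = (LINT \<zeta>|\<mu>. ln (cmod (z - \<zeta>))) + e"
  assume "\<nexists>M. (LINT \<zeta>|\<mu>. trunc_ln M (z - \<zeta>)) < (LINT \<zeta>|\<mu>. ln (cmod (z - \<zeta>))) + e"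
  then have c: "c \<le> (LINT \<zeta>|\<mu>. trunc_ln M (z - \<zeta>))" for M by (auto simp: c_def not_less)
  note [measurable_cong] = prob_measures_onD(2)[OF \<mu>]
  interpret prob_space \<mu> using prob_measures_onD(1)[OF \<mu>] .
  obtain R where R: "K \<subseteq> cball 0 R" by (rule compact_subset_cball[OF K]) blast
  define B where "B = ln (max (cmod z + R) 1)"
  have dist: "cmod (z - \<zeta>) \<le> max (cmod z + R) 1" if "\<zeta> \<in> K" for \<zeta>
    using that R norm_triangle_ineq4[of z \<zeta>] by fastforce
  have TB: "trunc_ln M (z - \<zeta>) \<le> B" if "\<zeta> \<in> K" "M \<ge> 0" for \<zeta> M
    unfolding trunc_ln_def B_def using dist[OF that(1)] that(2)
    by (intro ln_mono) (auto simp: less_max_iff_disj intro: order_trans[of _ 1])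
  have i: "integrable \<mu> (\<lambda>\<zeta>. trunc_ln M (z - \<zeta>))" for M
    by (intro integrable_continuous_prob_measures_on[OF \<mu> K] continuous_intros)
  \<comment> \<open>An atom at z would make the truncated integrals fall linearly in M, below the
    assumed bound \<open>c\<close>.\<close>
  have "measure \<mu> {z} = 0"
  proof (rule ccontr)
    assume "measure \<mu> {z} \<noteq> 0"
    then have m: "measure \<mu> {z} > 0" using measure_nonneg[of \<mu> "{z}"] by linarith
    \<comment> \<open>With m the mass of the atom, this makes the loss (B + M) m at least B - c + m,
      more than the B - c that is available.\<close>
    define M where "M = max 0 ((B - c) / measure \<mu> {z} + 1 - B)"
    have "c \<le> (LINT \<zeta>|\<mu>. B - (B + M) * indicator {z} \<zeta>)"
    proof (rule order_trans[OF c[of M]], rule integral_mono_prob_measures_on[OF \<mu> compact_imp_closed[OF K] i])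
      show "integrable \<mu> (\<lambda>\<zeta>. B - (B + M) * indicator {z} \<zeta>)"
        using prob_measures_onD(2)[OF \<mu>] by (intro Bochner_Integration.integrable_diff integrable_mult_right) (auto simp: less_top[symmetric])
      show "trunc_ln M (z - \<zeta>) \<le> B - (B + M) * indicator {z} \<zeta>" if "\<zeta> \<in> K" for \<zeta>
        using TB[OF that, of M] by (auto simp: indicator_def trunc_ln_def M_def)
    qed
    also have "\<dots> = B - (B + M) * measure \<mu> {z}"
      using prob_measures_onD(2)[OF \<mu>] prob_measures_onD(3)[OF \<mu>] prob_space[unfolded prob_measures_onD(3)[OF \<mu>]]
      by (subst Bochner_Integration.integral_diff) (auto simp: less_top[symmetric] prob_space)
    finally have "(B + M) * measure \<mu> {z} \<le> B - c" by simp
    moreover have "(B - c) / measure \<mu> {z} + 1 \<le> B + M" unfolding M_def by linarith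
    then have "((B - c) / measure \<mu> {z} + 1) * measure \<mu> {z} \<le> (B + M) * measure \<mu> {z}"
      using m by (intro mult_right_mono) auto
    moreover have "((B - c) / measure \<mu> {z} + 1) * measure \<mu> {z} = B - c + measure \<mu> {z}" using m by (simp add: field_simps)
    ultimately show False using m by linarith
  qed
  then have ne: "AE \<zeta> in \<mu>. \<zeta> \<noteq> z"
    using prob_measures_onD(2,3)[OF \<mu>] by (intro AE_I[of _ _ "{z}"]) (auto simp: emeasure_eq_measure)
  have inK: "AE \<zeta> in \<mu>. \<zeta> \<in> K" by (rule AE_prob_measures_on[OF \<mu> compact_imp_closed[OF K]])
  \<comment> \<open>By Fatou the lower bound \<open>c\<close> for all truncated integrals bounds the
    integral of the nonnegative \<open>?h\<close> by B - c. So under the negated claim the logarithm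
    is integrable, no default value occurs, and its integral is at least \<open>c\<close>, which
    exceeds it by e.\<close>
  let ?h = "\<lambda>\<zeta>. B - ln (cmod (z - \<zeta>))"
  have pos: "AE \<zeta> in \<mu>. 0 \<le> ?h \<zeta>"
    using ne inK
  proof eventually_elim
    case (elim \<zeta>)
    then show ?case unfolding B_def using dist[of \<zeta>] by (simp add: ln_le_cancel_iff[symmetric] less_max_iff_disj del: ln_le_cancel_iff) 
  qed
  have "(\<integral>\<^sup>+\<zeta>. ennreal (?h \<zeta>) \<partial>\<mu>) = (\<integral>\<^sup>+\<zeta>. liminf (\<lambda>M. ennreal (B - trunc_ln (real M) (z - \<zeta>))) \<partial>\<mu>)"
  proof (rule nn_integral_cong_AE)
    show "AE \<zeta> in \<mu>. ennreal (?h \<zeta>) = liminf (\<lambda>M. ennreal (B - trunc_ln (real M) (z - \<zeta>)))"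
      using ne
    proof eventually_elim
      case (elim \<zeta>)
      have "(\<lambda>M. exp (- real M)) \<longlonglongrightarrow> 0" by real_asymp
      then have "\<forall>\<^sub>F M in sequentially. exp (- real M) < cmod (z - \<zeta>)" using elim by (intro order_tendstoD(2)) auto
      then have "\<forall>\<^sub>F M in sequentially. ennreal (B - trunc_ln (real M) (z - \<zeta>)) = ennreal (?h \<zeta>)"
        by eventually_elim (simp add: trunc_ln_eq)
      then have "(\<lambda>M. ennreal (B - trunc_ln (real M) (z - \<zeta>))) \<longlonglongrightarrow> ennreal (?h \<zeta>)" by (rule tendsto_eventually)
      then show ?case using lim_imp_Liminf[OF trivial_limit_sequentially] by metis
    qed
  qed
  also have "\<dots> \<le> liminf (\<lambda>M. \<integral>\<^sup>+\<zeta>. ennreal (B - trunc_ln (real M) (z - \<zeta>)) \<partial>\<mu>)"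
    by (rule nn_integral_liminf) (unfold trunc_ln_def, measurable)
  also have "\<dots> \<le> liminf (\<lambda>M. ennreal (B - c))"
  proof (intro Liminf_mono always_eventually allI)
    fix M :: nat
    have "(\<integral>\<^sup>+\<zeta>. ennreal (B - trunc_ln (real M) (z - \<zeta>)) \<partial>\<mu>) = ennreal (LINT \<zeta>|\<mu>. B - trunc_ln (real M) (z - \<zeta>))"
      using i[of "real M"] inK TB by (intro nn_integral_eq_integral) (auto elim!: eventually_mono)
    also have "(LINT \<zeta>|\<mu>. B - trunc_ln (real M) (z - \<zeta>)) = B - (LINT \<zeta>|\<mu>. trunc_ln (real M) (z - \<zeta>))"
      using i[of "real M"] by (simp add: prob_space)
    finally show "(\<integral>\<^sup>+\<zeta>. ennreal (B - trunc_ln (real M) (z - \<zeta>)) \<partial>\<mu>) \<le> ennreal (B - c)"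
      using c[of "real M"] by (simp add: ennreal_leI)
  qed
  also have "\<dots> = ennreal (B - c)" by (simp add: Liminf_const)
  finally have le: "(\<integral>\<^sup>+\<zeta>. ennreal (?h \<zeta>) \<partial>\<mu>) \<le> ennreal (B - c)" .
  have ih: "integrable \<mu> ?h"
  proof (rule integrableI_nonneg[OF _ pos])
    show "?h \<in> borel_measurable \<mu>" by measurable
    show "(\<integral>\<^sup>+\<zeta>. ennreal (?h \<zeta>) \<partial>\<mu>) < \<infinity>" using le by (rule order_le_less_trans) simp
  qed
  have "ennreal (LINT \<zeta>|\<mu>. ?h \<zeta>) \<le> ennreal (B - c)"
    using le unfolding nn_integral_eq_integral[OF ih pos] .
  moreover have "B - c \<ge> 0"
  proof -
    have "c \<le> (LINT \<zeta>|\<mu>. B)"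
      by (rule order_trans[OF c[of 0]], rule integral_mono_prob_measures_on[OF \<mu> compact_imp_closed[OF K] i]) (auto simp: TB)
    then show ?thesis by (simp add: prob_space)
  qed
  ultimately have "(LINT \<zeta>|\<mu>. ?h \<zeta>) \<le> B - c" by (simp add: ennreal_le_iff)
  moreover have "integrable \<mu> (\<lambda>\<zeta>. ln (cmod (z - \<zeta>)))"
    using Bochner_Integration.integrable_diff[OF integrable_const[of B] ih] by simp
  then have "(LINT \<zeta>|\<mu>. ?h \<zeta>) = B - (LINT \<zeta>|\<mu>. ln (cmod (z - \<zeta>)))" by (simp add: prob_space)
  ultimately show False using e by (simp add: c_def)
qed

text \<open>Regularity enters through \<open>cont\<close> and \<open>zero\<close>. Because the
  capacity is 1, the Green function is the bare potential of the equilibrium measure. The bounds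
  hold at every index, so a sequence has to be shifted before it can be plugged in.\<close>

locale equidistribution =
  fixes E :: "complex set" and xs :: "nat \<Rightarrow> complex list" and R :: real and \<delta> :: "nat \<Rightarrow> real"
  assumes E: "compact E" and energy: "min_log_energy E = ereal 0"
    and R: "R \<ge> 1" and ER: "E \<subseteq> cball 0 R"
    and ne: "\<And>n. xs n \<noteq> []" and distinct: "\<And>n. distinct (xs n)" and xsR: "\<And>n. set (xs n) \<subseteq> cball 0 R"
    and len: "filterlim (\<lambda>n. length (xs n)) at_top sequentially"
    and disc: "\<And>n. 0 \<le> (\<Sum>i<length (xs n). \<Sum>j\<in>{..<length (xs n)} - {i}. ln (cmod (xs n ! i - xs n ! j)))"
    and near: "\<And>n \<zeta>. \<zeta> \<in> set (xs n) \<Longrightarrow> infdist \<zeta> E \<le> \<delta> n" and \<delta>: "\<delta> \<longlonglongrightarrow> 0"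
    and cont: "continuous_on UNIV (\<lambda>z. LINT \<zeta>|equilibrium_measure E. ln (cmod (z - \<zeta>)))"
    and zero: "\<And>z. z \<in> E \<Longrightarrow> (LINT \<zeta>|equilibrium_measure E. ln (cmod (z - \<zeta>))) = 0"
begin

abbreviation "\<mu> \<equiv> equilibrium_measure E"
abbreviation "\<nu> n \<equiv> root_measure (xs n)"

definition g :: "complex \<Rightarrow> real" where
  "g z = (LINT \<zeta>|\<mu>. ln (cmod (z - \<zeta>)))"

definition u :: "nat \<Rightarrow> complex \<Rightarrow> real" where
  "u n z = (\<Sum>i<length (xs n). ln (cmod (z - xs n ! i))) / length (xs n)"

text \<open>The product stays inside the logarithm: at a root, \<open>ln 0 = 0\<close> then gives
  the value 0 that log^+ has there, whereas the sum in \<open>u\<close> would merely lose the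
  vanishing factor.\<close>

definition f :: "nat \<Rightarrow> complex \<Rightarrow> real" where
  "f n z = log_plus (cmod (\<Prod>i<length (xs n). z - xs n ! i)) / length (xs n)"

lemma \<mu>: "\<mu> \<in> prob_measures_on E" by (rule equilibrium_measure_minimizes[OF E energy])

lemma \<mu>R: "\<mu> \<in> prob_measures_on (cball 0 R)" by (rule prob_measures_on_mono[OF \<mu> ER]) simp

lemma \<nu>: "\<nu> n \<in> prob_measures_on (cball 0 R)"
  by (rule root_measure_in_prob_measures_on[OF ne xsR]) simp

lemma E_nonempty: "E \<noteq> {}" using prob_measures_onD(4)[OF \<mu>] by auto

text \<open>Uniqueness of the minimizer holds among measures on \<open>E\<close>, so a subsequential
  limit \<kappa> must first be placed on \<open>E\<close>: its integral of the distance to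
  \<open>E\<close> is at most the limit of \<delta>. The energy bound then applies with the diagonal
  share 1/d removed.\<close>

lemma weak_limit_roots: "weak_limit \<nu> \<mu>"
  unfolding weak_limit_def
proof (intro allI impI LIMSEQ_subsequence_principle)
  fix \<phi> :: "complex \<Rightarrow> real" and s :: "nat \<Rightarrow> nat"
  assume \<phi>: "continuous_on UNIV \<phi>" and s: "strict_mono s"
  obtain r \<kappa> where r: "strict_mono r" "\<kappa> \<in> prob_measures_on (cball 0 R)" "weak_limit ((\<lambda>k. \<nu> (s k)) \<circ> r) \<kappa>"
    by (rule weak_compactness[OF compact_cball, of "\<lambda>k. \<nu> (s k)"]) (use \<nu> in blast)+
  have lim: "weak_limit (\<lambda>k. \<nu> (s (r k))) \<kappa>" using r(3) by (simp add: comp_def)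
  have sr: "strict_mono (\<lambda>k. s (r k))" using s r(1) by (simp add: strict_mono_def)
  interpret \<kappa>: prob_space \<kappa> using prob_measures_onD(1)[OF r(2)] .
  have "AE z in \<kappa>. z \<in> E"
  proof -
    have c: "continuous_on UNIV (\<lambda>z. infdist z E)" by (intro continuous_intros)
    have "(\<lambda>k. LINT z|\<nu> (s (r k)). infdist z E) \<longlonglongrightarrow> (LINT z|\<kappa>. infdist z E)"
      using lim c unfolding weak_limit_def by blast
    moreover have "(LINT z|\<nu> (s (r k)). infdist z E) \<le> \<delta> (s (r k))" for k
    proof -
      let ?n = "s (r k)"
      have "(\<Sum>i<length (xs ?n). infdist (xs ?n ! i) E) \<le> (\<Sum>i<length (xs ?n). \<delta> ?n)"
        using near by (intro sum_mono) auto
      then show ?thesis using ne[of ?n]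
        by (subst integral_root_measure[OF ne]) (auto intro!: borel_measurable_continuous_onI c simp: field_simps)
    qed
    moreover have "(\<lambda>k. \<delta> (s (r k))) \<longlonglongrightarrow> 0" using LIMSEQ_subseq_LIMSEQ[OF \<delta> sr] by (simp add: comp_def)
    ultimately have "(LINT z|\<kappa>. infdist z E) \<le> 0" by (intro LIMSEQ_le[of _ _ "\<lambda>k. \<delta> (s (r k))"]) auto
    moreover have "integrable \<kappa> (\<lambda>z. infdist z E)" by (rule integrable_continuous_prob_measures_on[OF r(2) compact_cball c])
    moreover have "(LINT z|\<kappa>. infdist z E) \<ge> 0" by (simp add: infdist_nonneg)
    ultimately have "AE z in \<kappa>. infdist z E = 0"
      using integral_nonneg_eq_0_iff_AE[of \<kappa> "\<lambda>z. infdist z E"] by (simp add: infdist_nonneg)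
    then show ?thesis using in_closed_iff_infdist_zero[OF compact_imp_closed[OF E] E_nonempty] by simp
  qed
  then have "emeasure \<kappa> E = 1" 
    using \<kappa>.emeasure_eq_1_AE[of E] prob_measures_onD(2)[OF r(2)] compact_imp_closed[OF E] by simp
  then have \<kappa>E: "\<kappa> \<in> prob_measures_on E" using r(2) by (simp add: prob_measures_on_def)
  have "log_energy \<kappa> \<le> ereal (ln (2 * R) - ln (2 * R))"
  proof (rule log_energy_le_limit[OF lim \<nu> r(2) R])
    have "filterlim (\<lambda>k. real (length (xs (s (r k))))) at_top sequentially"
      by (intro filterlim_compose[OF filterlim_real_sequentially] filterlim_compose[OF len] filterlim_subseq sr)
    then show "(\<lambda>k. 1 / real (length (xs (s (r k))))) \<longlonglongrightarrow> 0" by (rule real_tendsto_divide_at_top[OF tendsto_const])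
    show "(\<lambda>k. ln (2 * R)) \<longlonglongrightarrow> ln (2 * R)" by simp
    show "ln (2 * R) \<ge> 0" using R by simp
    show "(\<integral>\<^sup>+t\<in>{0<..}. ennreal ((gauss_energy t (\<nu> (s (r k))) - 1 / length (xs (s (r k)))
       - (1 - 1 / length (xs (s (r k)))) * exp (- t * (2 * R)\<^sup>2)) / (2 * t)) \<partial>lborel) \<le> ennreal (ln (2 * R))" for k
      by (rule discrete_energy_bound[OF ne distinct xsR R disc])
  qed
  then have "\<kappa> = \<mu>" by (intro equilibrium_measure_minimizes(3)[OF E energy \<kappa>E]) simp
  then show "\<exists>r. strict_mono r \<and> (\<lambda>k. LINT z|\<nu> (s (r k)). \<phi> z) \<longlonglongrightarrow> (LINT z|\<mu>. \<phi> z)"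
    using lim r(1) \<phi> unfolding weak_limit_def by blast
qed

lemma trunc_ln_limit:
  assumes "strict_mono s" "z \<longlonglongrightarrow> w"
  shows "(\<lambda>k. LINT \<zeta>|\<nu> (s k). trunc_ln M (z k - \<zeta>)) \<longlonglongrightarrow> (LINT \<zeta>|\<mu>. trunc_ln M (w - \<zeta>))"
  by (rule weak_limit_trunc_ln[OF weak_limit_subseq[OF weak_limit_roots assms(1)] \<nu> compact_cball assms(2)])

lemma integral_trunc_ln_roots:
  "(LINT \<zeta>|\<nu> n. trunc_ln M (z - \<zeta>)) = (\<Sum>i<length (xs n). trunc_ln M (z - xs n ! i)) / length (xs n)"
  by (intro integral_root_measure ne borel_measurable_continuous_onI continuous_intros)

lemma f_eq_u: "z \<notin> set (xs n) \<Longrightarrow> f n z = max (u n z) 0"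
proof -
  assume z: "z \<notin> set (xs n)"
  have "ln (cmod (\<Prod>i<length (xs n). z - xs n ! i)) = (\<Sum>i<length (xs n). ln (cmod (z - xs n ! i)))"
    unfolding prod_norm[symmetric] using z nth_mem by (intro ln_prod) fastforce+
  then show ?thesis
    by (simp add: f_def u_def log_plus_def max_def divide_le_0_iff not_le)
qed

lemma f_nonneg: "f n z \<ge> 0" by (simp add: f_def log_plus_def)

lemma f_le_trunc_ln: "f n z \<le> max (LINT \<zeta>|\<nu> n. trunc_ln M (z - \<zeta>)) 0"
proof (cases "z \<in> set (xs n)")
  case True
  then have 0: "(\<Prod>i<length (xs n). z - xs n ! i) = 0" by (auto simp: in_set_conv_nth)
  show ?thesis unfolding f_def 0 by (simp add: log_plus_def)
next
  case False
  have "u n z \<le> (LINT \<zeta>|\<nu> n. trunc_ln M (z - \<zeta>))"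
    unfolding u_def integral_trunc_ln_roots using False nth_mem
    by (intro divide_right_mono sum_mono ln_le_trunc_ln) fastforce+
  then show ?thesis using f_eq_u[OF False] by simp
qed

text \<open>Off \<open>E\<close> the truncation is inactive: for large k all roots stay away from
  \<open>z k\<close>, so the truncated potentials, which converge, are the true ones. The points
  move so that compactness can later give uniformity.\<close>

lemma u_limit:
  assumes s: "strict_mono s" and z: "z \<longlonglongrightarrow> w" and w: "w \<notin> E"
  shows "(\<lambda>k. u (s k) (z k)) \<longlonglongrightarrow> g w" "\<forall>\<^sub>F k in sequentially. z k \<notin> set (xs (s k))"
proof -
  \<comment> \<open>The distance from w to \<open>E\<close> is 4e. A root is eventually within e of
    \<open>E\<close> and \<open>z k\<close> within e of w, which leaves at least 2e between
    them.\<close>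
  define e where "e = infdist w E / 4"
  have e: "e > 0" using infdist_pos_not_in_closed[OF compact_imp_closed[OF E] E_nonempty w] by (simp add: e_def)
  define M where "M = - ln e"
  have M: "exp (- M) = e" using e by (simp add: M_def)
  have "(\<lambda>k. \<delta> (s k)) \<longlonglongrightarrow> 0" using LIMSEQ_subseq_LIMSEQ[OF \<delta> s] by (simp add: comp_def)
  then have ev: "\<forall>\<^sub>F k in sequentially. \<delta> (s k) < e \<and> dist (z k) w < e"
    using e z by (intro eventually_conj order_tendstoD(2)[where a = e] tendstoD) auto
  then have far: "\<forall>\<^sub>F k in sequentially. \<forall>\<zeta>\<in>set (xs (s k)). e \<le> cmod (z k - \<zeta>)"
  proof eventually_elim
    case (elim k)
    show ?case
    proof
      fix \<zeta> assume "\<zeta> \<in> set (xs (s k))"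
      then have "infdist \<zeta> E \<le> e" using near elim by fastforce
      moreover have "infdist w E \<le> infdist \<zeta> E + dist w \<zeta>" by (rule infdist_triangle)
      moreover have "dist w \<zeta> \<le> dist (z k) w + dist (z k) \<zeta>" by (rule dist_triangle3)
      ultimately show "e \<le> cmod (z k - \<zeta>)"
        using elim[THEN conjunct2] e unfolding e_def dist_norm[of "z k" \<zeta>] by linarith
    qed
  qed
  then show "\<forall>\<^sub>F k in sequentially. z k \<notin> set (xs (s k))"
    by eventually_elim (use e in fastforce)
  have "\<forall>\<^sub>F k in sequentially. (LINT \<zeta>|\<nu> (s k). trunc_ln M (z k - \<zeta>)) = u (s k) (z k)"
    using far
  proof eventually_elim
    case (elim k)
    then have "trunc_ln M (z k - xs (s k) ! i) = ln (cmod (z k - xs (s k) ! i))" if "i < length (xs (s k))" for i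
      using that by (intro trunc_ln_eq) (simp add: M)
    then show ?case unfolding integral_trunc_ln_roots u_def by simp
  qed
  moreover have "(LINT \<zeta>|\<mu>. trunc_ln M (w - \<zeta>)) = g w"
    unfolding g_def
  proof (rule integral_cong_AE)
    show "AE \<zeta> in \<mu>. trunc_ln M (w - \<zeta>) = ln (cmod (w - \<zeta>))"
      using AE_prob_measures_on[OF \<mu> compact_imp_closed[OF E]]
    proof eventually_elim
      case (elim \<zeta>)
      then have "infdist w E \<le> dist w \<zeta>" by (rule infdist_le)
      then show ?case using e by (intro trunc_ln_eq) (simp add: M e_def dist_norm)
    qed
    show "(\<lambda>\<zeta>. trunc_ln M (w - \<zeta>)) \<in> borel_measurable \<mu>" "(\<lambda>\<zeta>. ln (cmod (w - \<zeta>))) \<in> borel_measurable \<mu>"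
      by (rule borel_measurable_prob_measures_on[OF \<mu>], simp add: trunc_ln_def)+
  qed
  ultimately show "(\<lambda>k. u (s k) (z k)) \<longlonglongrightarrow> g w"
    using trunc_ln_limit[OF s z, of M] by (simp add: Lim_transform_eventually)
qed

lemma ln_shift_bound: "cmod \<zeta> \<le> R \<Longrightarrow> 2 * R \<le> cmod z \<Longrightarrow> \<bar>ln (cmod (z - \<zeta>)) - ln (cmod z)\<bar> \<le> 2 * R / cmod z"
proof -
  assume \<zeta>: "cmod \<zeta> \<le> R" and z: "2 * R \<le> cmod z"
  have "cmod z - cmod \<zeta> \<le> cmod (z - \<zeta>)" by (rule norm_triangle_ineq2)
  then have "\<bar>ln (cmod (z - \<zeta>)) - ln (cmod z)\<bar> \<le> \<bar>cmod (z - \<zeta>) - cmod z\<bar> / (cmod z / 2)"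
    using \<zeta> z R by (intro abs_ln_diff_le) auto
  also have "\<dots> \<le> R / (cmod z / 2)"
    using norm_triangle_ineq3[of "z - \<zeta>" z] \<zeta> by (intro divide_right_mono) auto
  finally show ?thesis by (simp add: mult.commute)
qed

text \<open>All masses sit in the disc of radius R, so near infinity both potentials are ln|z| up to
  2R/|z|, uniformly in n. This reduces uniform convergence to compact sets.\<close>

lemma far_bounds:
  assumes z: "2 * R \<le> cmod z"
  shows "\<bar>u n z - ln (cmod z)\<bar> \<le> 2 * R / cmod z" "\<bar>g z - ln (cmod z)\<bar> \<le> 2 * R / cmod z" "z \<notin> set (xs n)"
proof -
  have l: "length (xs n) > 0" using ne by simp
  have "u n z - ln (cmod z) = (\<Sum>i<length (xs n). ln (cmod (z - xs n ! i)) - ln (cmod z)) / length (xs n)"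
    using l ne[of n] by (simp add: u_def sum_subtractf diff_divide_distrib)
  also have "\<bar>\<dots>\<bar> \<le> (\<Sum>i<length (xs n). 2 * R / cmod z) / length (xs n)"
    unfolding abs_divide abs_of_nat
  proof (intro divide_right_mono order_trans[OF sum_abs] sum_mono ln_shift_bound z)
    fix i assume "i \<in> {..<length (xs n)}"
    then show "cmod (xs n ! i) \<le> R" using xsR[of n] nth_mem by fastforce
  qed simp
  also have "\<dots> = 2 * R / cmod z" using l ne[of n] by simp
  finally show "\<bar>u n z - ln (cmod z)\<bar> \<le> 2 * R / cmod z" .
  show "z \<notin> set (xs n)" using xsR[of n] z R by fastforce
  interpret prob_space \<mu> using prob_measures_onD(1)[OF \<mu>] .
  have b: "\<bar>ln (cmod (z - \<zeta>)) - ln (cmod z)\<bar> \<le> 2 * R / cmod z" if "\<zeta> \<in> E" for \<zeta>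
    using that ER by (intro ln_shift_bound z) auto
  have i: "integrable \<mu> (\<lambda>\<zeta>. ln (cmod (z - \<zeta>)) - ln (cmod z))"
    by (rule integrable_prob_measures_on[OF \<mu> E _ b]) measurable
  have "integrable \<mu> (\<lambda>\<zeta>. ln (cmod (z - \<zeta>)))"
    using Bochner_Integration.integrable_add[OF i integrable_const[of "ln (cmod z)"]] by simp
  then have "g z - ln (cmod z) = (LINT \<zeta>|\<mu>. ln (cmod (z - \<zeta>)) - ln (cmod z))"
    by (simp add: g_def prob_space)
  also have "\<bar>\<dots>\<bar> \<le> (LINT \<zeta>|\<mu>. \<bar>ln (cmod (z - \<zeta>)) - ln (cmod z)\<bar>)" by (rule integral_abs_bound)
  also have "\<dots> \<le> (LINT \<zeta>|\<mu>. 2 * R / cmod z)"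
    by (rule integral_mono_prob_measures_on[OF \<mu> compact_imp_closed[OF E]]) (use i b in auto)
  finally show "\<bar>g z - ln (cmod z)\<bar> \<le> 2 * R / cmod z" by (simp add: prob_space)
qed

lemma continuous_g: "continuous_on S g"
  using cont unfolding g_def by (rule continuous_on_subset) simp

text \<open>Sequential compactness applied to \<open>u_limit\<close> with moving points. One index
  is enough, since \<open>g_nonneg\<close> compares \<open>g\<close> with a single
  polynomial.\<close>

lemma u_uniform_limit:
  assumes C: "compact C" "C \<inter> E = {}" and e: "e > 0"
  shows "\<exists>n. \<forall>z\<in>C. z \<notin> set (xs n) \<and> \<bar>u n z - g z\<bar> < e"
proof (rule ccontr)
  assume "\<not> ?thesis"
  then have "\<forall>n. \<exists>z\<in>C. z \<in> set (xs n) \<or> \<not> \<bar>u n z - g z\<bar> < e" by blast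
  then obtain z where z: "\<And>n. z n \<in> C" "\<And>n. z n \<in> set (xs n) \<or> \<not> \<bar>u n (z n) - g (z n)\<bar> < e" by metis
  have "\<forall>n. z n \<in> C" using z(1) by blast
  then obtain l s where s: "l \<in> C" "strict_mono s" "(z \<circ> s) \<longlonglongrightarrow> l"
    by (rule seq_compactE[OF compact_imp_seq_compact[OF C(1)]])
  have zl: "(\<lambda>k. z (s k)) \<longlonglongrightarrow> l" using s(3) by (simp add: comp_def)
  have "l \<notin> E" using s(1) C(2) by blast
  note lim = u_limit[OF s(2) zl this]
  have "(\<lambda>k. g (z (s k))) \<longlonglongrightarrow> g l" by (rule continuous_on_tendsto_compose[OF continuous_g[of UNIV] zl]) auto
  from tendsto_diff[OF lim(1) this] have "(\<lambda>k. u (s k) (z (s k)) - g (z (s k))) \<longlonglongrightarrow> 0" by simp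
  from tendstoD[OF this e] have "\<forall>\<^sub>F k in sequentially. \<bar>u (s k) (z (s k)) - g (z (s k))\<bar> < e" by (simp add: dist_real_def)
  with lim(2) have "\<forall>\<^sub>F k in sequentially. False" by eventually_elim (use z(2) in blast)
  then show False by simp
qed

end

section \<open>Nonnegativity of the Green function and uniform convergence\<close>

context equidistribution
begin

lemma ln_gt_1_far:
  assumes "2 * R * exp 1 < cmod w"
  shows "2 * R \<le> cmod w" "1 < ln (cmod w)"
proof -
  have "2 * R * 1 \<le> 2 * R * exp 1" using R by (intro mult_left_mono) auto
  then show "2 * R \<le> cmod w" using assms by simp
  have "1 * exp 1 \<le> 2 * R * exp (1 :: real)" using R by (intro mult_right_mono) auto
  then have *: "exp 1 < cmod w" using assms by linarith
  then have "ln (exp 1) < ln (cmod w)" using less_trans[OF exp_gt_zero *] by (subst ln_less_cancel_iff) auto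
  then show "1 < ln (cmod w)" by simp
qed

text \<open>If g(z) < 0, the set where g < -\<eta> is bounded, as g grows at infinity, and its
  closure misses \<open>E\<close>, where g = 0. There g is nearly (1/l) ln|q| for a polynomial q
  without zeros on the closure. The maximum modulus principle for 1/q bounds -g(z) by roughly the
  boundary value \<eta>, against g(z) = -2 \<eta>.\<close>

lemma g_nonneg: "g z \<ge> 0"
proof (rule ccontr)
  assume "\<not> g z \<ge> 0"
  define \<eta> where "\<eta> = - g z / 2"
  have \<eta>: "\<eta> > 0" "g z = - 2 * \<eta>" using \<open>\<not> g z \<ge> 0\<close> by (auto simp: \<eta>_def)
  define U where "U = {w. g w < - \<eta>}"
  have "open U" unfolding U_def by (intro open_Collect_less continuous_g continuous_intros)
  have zU: "z \<in> U" using \<eta> by (simp add: U_def)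
  have "U \<subseteq> cball 0 (2 * R * exp 1)"
  proof
    fix w assume w: "w \<in> U"
    show "w \<in> cball 0 (2 * R * exp 1)"
    proof (rule ccontr)
      assume "w \<notin> cball 0 (2 * R * exp 1)"
      then have large: "2 * R * exp 1 < cmod w" by simp
      note 2 = ln_gt_1_far(1)[OF large]
      have "1 < ln (cmod w)" by (rule ln_gt_1_far(2)[OF large])
      moreover have "2 * R / cmod w \<le> 1" using 2 R by (simp add: divide_le_eq_1)
      ultimately have "g w > 0" using far_bounds(2)[OF 2] by linarith
      then show False using w \<eta> by (simp add: U_def)
    qed
  qed
  then have bdd: "bounded U" by (rule bounded_subset[rotated]) simp
  have cl: "closure U \<subseteq> {w. g w \<le> - \<eta>}"
    by (rule closure_minimal) (auto simp: U_def intro!: closed_Collect_le continuous_g continuous_intros)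
  have "closure U \<inter> E = {}"
    using cl \<eta> zero unfolding g_def by fastforce
  moreover have "compact (closure U)" using bdd by (simp add: compact_closure)
  \<comment> \<open>The precision \<eta>/4 leaves room: on the boundary -u is at most 5 \<eta>/4,
    whereas at z it is at least 7 \<eta>/4.\<close>
  ultimately obtain n where n: "\<And>w. w \<in> closure U \<Longrightarrow> w \<notin> set (xs n) \<and> \<bar>u n w - g w\<bar> < \<eta> / 4"
    using u_uniform_limit[of "closure U" "\<eta> / 4"] \<eta> by auto
  define l where "l = length (xs n)"
  have l: "l > 0" using ne by (simp add: l_def)
  define q where "q w = (\<Prod>i<l. w - xs n ! i)" for w
  have q0: "q w \<noteq> 0" if "w \<in> closure U" for w
    using n[OF that] nth_mem by (fastforce simp: q_def l_def)
  have uq: "cmod (q w) = exp (l * u n w)" if w: "w \<in> closure U" for w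
  proof -
    have "ln (cmod (q w)) = (\<Sum>i<l. ln (cmod (w - xs n ! i)))"
      unfolding q_def prod_norm[symmetric] using n[OF w] nth_mem by (intro ln_prod) (fastforce simp: l_def)+
    then have "ln (cmod (q w)) = l * u n w" using l by (simp add: u_def l_def)
    then show ?thesis using q0[OF w] exp_ln[of "cmod (q w)"] by simp
  qed
  have inv: "norm (1 / q w) = exp (l * (- u n w))" if "w \<in> closure U" for w
    unfolding norm_divide uq[OF that] by (simp add: exp_minus divide_inverse)
  have hol: "q holomorphic_on S" for S unfolding q_def by (intro holomorphic_intros)
  have frontier: "g w = - \<eta>" if "w \<in> frontier U" for w
  proof -
    have "w \<in> closure U" "w \<notin> U" using that \<open>open U\<close> by (auto simp: frontier_def interior_open)
    then show ?thesis using cl by (auto simp: U_def)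
  qed
  have "norm (1 / q z) \<le> exp (l * (5 * \<eta> / 4))"
  proof (rule maximum_modulus_frontier[OF _ _ bdd _ zU])
    show "(\<lambda>w. 1 / q w) holomorphic_on interior U"
      using q0 interior_subset closure_subset by (intro holomorphic_intros hol) blast
    show "continuous_on (closure U) (\<lambda>w. 1 / q w)"
      using q0 by (intro continuous_intros holomorphic_on_imp_continuous_on hol) auto
    show "norm (1 / q w) \<le> exp (l * (5 * \<eta> / 4))" if w: "w \<in> frontier U" for w
    proof -
      have c: "w \<in> closure U" using w by (simp add: frontier_def)
      have "- (5 * \<eta> / 4) \<le> u n w" using n[OF c] frontier[OF w] by linarith
      then have "l * (- u n w) \<le> l * (5 * \<eta> / 4)" by (intro mult_left_mono) auto
      then show ?thesis unfolding inv[OF c] by (simp only: exp_le_cancel_iff)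
    qed
  qed
  moreover have zc: "z \<in> closure U" using zU closure_subset by blast
  ultimately have "exp (l * (- u n z)) \<le> exp (l * (5 * \<eta> / 4))"
    by (simp only: inv)
  then have "l * (- u n z) \<le> l * (5 * \<eta> / 4)" by (simp only: exp_le_cancel_iff)
  then have "- u n z \<le> 5 * \<eta> / 4" using l by (simp only: mult_le_cancel_left_pos of_nat_0_less_iff)
  then show False using n[OF zc] \<eta> by linarith
qed

text \<open>From above, \<open>f\<close> is at most the positive part of a truncated potential,
  whose limit is close to g(w) for suitable M. From below, on \<open>E\<close> it is enough that f
  is nonnegative and g = 0, and off \<open>E\<close> the potentials themselves converge.\<close>

lemma f_limit:
  assumes s: "strict_mono s" and z: "z \<longlonglongrightarrow> w"
  shows "(\<lambda>k. f (s k) (z k)) \<longlonglongrightarrow> g w"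
proof (rule order_tendstoI)
  fix a assume a: "g w < a"
  obtain M where M: "(LINT \<zeta>|\<mu>. trunc_ln M (w - \<zeta>)) < g w + (a - g w)"
    using trunc_ln_potential_less[OF \<mu> E, of "a - g w" w] a unfolding g_def by auto
  then have "\<forall>\<^sub>F k in sequentially. (LINT \<zeta>|\<nu> (s k). trunc_ln M (z k - \<zeta>)) < a"
    by (intro order_tendstoD(2)[OF trunc_ln_limit[OF s z]]) simp
  then show "\<forall>\<^sub>F k in sequentially. f (s k) (z k) < a"
  proof eventually_elim
    case (elim k)
    then show ?case using f_le_trunc_ln[of "s k" "z k" M] a g_nonneg[of w] by linarith
  qed
next
  fix a assume a: "a < g w"
  show "\<forall>\<^sub>F k in sequentially. a < f (s k) (z k)"
  proof (cases "w \<in> E")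
    case True
    then have "a < 0" using a zero[OF True] by (simp add: g_def)
    then show ?thesis by (intro always_eventually allI) (rule less_le_trans[OF _ f_nonneg])
  next
    case False
    note lim = u_limit[OF s z False]
    show ?thesis using order_tendstoD(1)[OF lim(1) a] lim(2)
      by eventually_elim (simp add: f_eq_u)
  qed
qed

lemma f_uniform_limit:
  assumes e: "e > 0"
  shows "\<forall>\<^sub>F n in sequentially. \<forall>z. \<bar>f n z - g z\<bar> \<le> e"
proof (rule ccontr)
  assume "\<not> ?thesis"
  then have "infinite {n. \<exists>z. \<not> \<bar>f n z - g z\<bar> \<le> e}"
    unfolding eventually_sequentially by (auto simp: infinite_nat_iff_unbounded_le)
  from infinite_enumerate[OF this] obtain s :: "nat \<Rightarrow> nat"
    where s: "strict_mono s" "\<forall>k. \<exists>z. \<not> \<bar>f (s k) z - g z\<bar> \<le> e" by blast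
  then obtain z where z: "\<And>k. \<not> \<bar>f (s k) (z k) - g (z k)\<bar> \<le> e" by metis
  \<comment> \<open>Beyond \<open>2 * R * exp 1\<close> the potential u is positive, so f = u;
    beyond \<open>4 * R / e\<close> the two errors 2R/|z| add up to at most \<open>e\<close>. A
    compact disc remains.\<close>
  define K where "K = max (2 * R * exp 1) (4 * R / e)"
  have "z k \<in> cball 0 K" for k
  proof (rule ccontr)
    assume "z k \<notin> cball 0 K"
    then have large: "2 * R * exp 1 < cmod (z k)" "4 * R / e < cmod (z k)" by (auto simp: K_def)
    note 2 = ln_gt_1_far(1)[OF large(1)]
    have "1 < ln (cmod (z k))" by (rule ln_gt_1_far(2)[OF large(1)])
    moreover have "2 * R / cmod (z k) \<le> 1" using 2 R by (simp add: divide_le_eq_1)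
    moreover note far_bounds(1)[OF 2, of "s k"] far_bounds(2)[OF 2]
    moreover have "cmod (z k) > 0" using 2 R by linarith
    then have "4 * R / cmod (z k) \<le> e" using large(2) e by (simp add: pos_divide_le_eq pos_divide_less_eq mult.commute)
    moreover have "f (s k) (z k) = max (u (s k) (z k)) 0" by (rule f_eq_u[OF far_bounds(3)[OF 2]])
    ultimately have "\<bar>f (s k) (z k) - g (z k)\<bar> \<le> e" by (simp add: max_def split: if_splits)
    then show False using z by blast
  qed
  then have "\<forall>k. z k \<in> cball 0 K" by blast
  then obtain l r where r: "strict_mono r" "(z \<circ> r) \<longlonglongrightarrow> l"
    by (rule seq_compactE[OF compact_imp_seq_compact[OF compact_cball]])
  have zl: "(\<lambda>k. z (r k)) \<longlonglongrightarrow> l" using r(2) by (simp add: comp_def)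
  have sr: "strict_mono (\<lambda>k. s (r k))" using s(1) r(1) by (simp add: strict_mono_def)
  have "(\<lambda>k. g (z (r k))) \<longlonglongrightarrow> g l" by (rule continuous_on_tendsto_compose[OF continuous_g[of UNIV] zl]) auto
  from tendsto_diff[OF f_limit[OF sr zl] this]
  have "(\<lambda>k. f (s (r k)) (z (r k)) - g (z (r k))) \<longlonglongrightarrow> 0" by simp
  from tendstoD[OF this e] have "\<forall>\<^sub>F k in sequentially. \<bar>f (s (r k)) (z (r k)) - g (z (r k))\<bar> < e"
    by (simp add: dist_real_def)
  then have "\<forall>\<^sub>F k in sequentially. False" by eventually_elim (use z less_imp_le in blast)
  then show False by simp
qed

text \<open>With uniform convergence this yields the constant \<open>C\<close> of
  \<open>escape_rate\<close>, common to all large n.\<close>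

lemma g_near_log_plus: "\<exists>C. \<forall>z. \<bar>g z - log_plus (cmod z)\<bar> \<le> C"
proof -
  have "bounded (g ` cball 0 (2 * R))"
    by (intro compact_imp_bounded compact_continuous_image continuous_g compact_cball)
  then obtain c where "\<forall>y\<in>g ` cball 0 (2 * R). \<bar>y\<bar> \<le> c" by (auto simp: bounded_iff)
  then have c: "\<bar>g z\<bar> \<le> c" if "cmod z \<le> 2 * R" for z using that by simp
  have "\<bar>g z - log_plus (cmod z)\<bar> \<le> \<bar>c\<bar> + ln (2 * R) + 1" for z
  proof (cases "cmod z \<le> 2 * R")
    case True
    have "log_plus (cmod z) \<le> ln (2 * R)"
    proof (cases "z = 0")
      case False
      then show ?thesis using True R by (simp add: log_plus_def)
    qed (use R in \<open>simp add: log_plus_def\<close>)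
    moreover have "log_plus (cmod z) \<ge> 0" by (simp add: log_plus_def)
    ultimately show ?thesis using c[OF True] by linarith
  next
    case False
    then have "2 * R \<le> cmod z" by simp
    note far = far_bounds(2)[OF this]
    have "2 * R / cmod z \<le> 1" using False R by (simp add: divide_le_eq_1)
    moreover have "log_plus (cmod z) = ln (cmod z)" using False R by (simp add: log_plus_def)
    moreover have "ln (2 * R) \<ge> 0" using R by simp
    ultimately show ?thesis using far by linarith
  qed
  then show ?thesis by blast
qed

end

section \<open>The dynamical Green function\<close>

text \<open>The hypothesis \<open>growth\<close> bounds the first step of the telescoping series at
  every point; applied along an orbit it bounds the k-th step by C/d^k.\<close>

locale escape_rate =
  fixes p :: "complex poly" and C :: real
  assumes degree: "degree p \<ge> 2" and C: "C \<ge> 0"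
    and growth: "\<And>w. \<bar>log_plus (cmod (poly p w)) / degree p - log_plus (cmod w)\<bar> \<le> C"
begin

abbreviation "d \<equiv> real (degree p)"

definition approx :: "nat \<Rightarrow> complex \<Rightarrow> real" where
  "approx k z = log_plus (cmod ((poly p ^^ k) z)) / d ^ k"

lemma d: "d \<ge> 2" using degree by simp

lemma approx_step: "\<bar>approx (Suc k) z - approx k z\<bar> \<le> C / d ^ k"
proof -
  let ?w = "(poly p ^^ k) z"
  have "approx (Suc k) z - approx k z = (log_plus (cmod (poly p ?w)) / d - log_plus (cmod ?w)) / d ^ k"
    using d by (simp add: approx_def field_simps)
  then have "\<bar>approx (Suc k) z - approx k z\<bar> = \<bar>log_plus (cmod (poly p ?w)) / d - log_plus (cmod ?w)\<bar> / d ^ k"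
    by (simp add: abs_divide)
  also have "\<dots> \<le> C / d ^ k" using growth by (intro divide_right_mono) auto
  finally show ?thesis .
qed

text \<open>Every d \<ge> 2 is compared with the ratio 1/2, which keeps the factor 2 independent of
  the degree.\<close>

lemma geometric_tail: "(\<Sum>i<n. C / d ^ (m + i)) \<le> 2 * C / d ^ m"
proof -
  have "(\<Sum>i<n. C / d ^ (m + i)) \<le> C / d ^ m * (\<Sum>i<n. (1 / 2) ^ i)"
    unfolding sum_distrib_left
  proof (rule sum_mono)
    fix i
    have "(1 / d) ^ i \<le> (1 / 2) ^ i" using d by (intro power_mono) (auto intro: frac_le)
    then have "1 / d ^ i \<le> (1 / 2) ^ i" by (simp only: power_one_over)
    then have "C / d ^ m * (1 / d ^ i) \<le> C / d ^ m * (1 / 2) ^ i" using C d by (intro mult_left_mono) auto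
    then show "C / d ^ (m + i) \<le> C / d ^ m * (1 / 2) ^ i" by (simp add: power_add)
  qed
  also have "\<dots> \<le> C / d ^ m * 2"
  proof (rule mult_left_mono)
    have "(\<Sum>i<n. (1 / 2 :: real) ^ i) = 2 - 2 * (1 / 2) ^ n" 
    proof (induction n)
      case (Suc n)
      have "(1 / 2 :: real) ^ Suc n = (1 / 2) ^ n / 2" by simp
      with Suc show ?case unfolding sum.lessThan_Suc by linarith
    qed simp
    then show "(\<Sum>i<n. (1 / 2 :: real) ^ i) \<le> 2" by simp
  qed (use C d in auto)
  finally show ?thesis by (simp add: mult.commute)
qed

lemma approx_Cauchy: "\<bar>approx (m + n) z - approx m z\<bar> \<le> 2 * C / d ^ m"
proof -
  have "\<bar>approx (m + n) z - approx m z\<bar> \<le> (\<Sum>i<n. C / d ^ (m + i))"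
  proof (induction n)
    case (Suc n)
    then show ?case using approx_step[of "m + n" z] by simp
  qed simp
  then show ?thesis using geometric_tail[of m n] by simp
qed

lemma approx_tendsto: "(\<lambda>k. approx k z) \<longlonglongrightarrow> dynamical_green p z"
proof -
  have "Cauchy (\<lambda>k. approx k z)"
  proof (rule metric_CauchyI)
    fix e :: real assume e: "e > 0"
    have "(\<lambda>m. 4 * C / d ^ m) \<longlonglongrightarrow> 0" using d by real_asymp
    from order_tendstoD(2)[OF this e] obtain m where m: "4 * C / d ^ m < e" by (auto simp: eventually_sequentially)
    have *: "\<bar>approx i z - approx m z\<bar> \<le> 2 * C / d ^ m" if "i \<ge> m" for i
      using approx_Cauchy[of m "i - m" z] that by simp
    have "dist (approx i z) (approx j z) < e" if "i \<ge> m" "j \<ge> m" for i j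
      using *[OF that(1)] *[OF that(2)] m unfolding dist_real_def by linarith
    then show "\<exists>M. \<forall>i\<ge>M. \<forall>j\<ge>M. dist (approx i z) (approx j z) < e" by blast
  qed
  then have "convergent (\<lambda>k. approx k z)" by (simp add: Cauchy_convergent_iff)
  then show ?thesis unfolding dynamical_green_def approx_def by (simp add: convergent_LIMSEQ_iff)
qed

lemma dynamical_green_approx: "\<bar>dynamical_green p z - approx m z\<bar> \<le> 2 * C / d ^ m"
proof (rule LIMSEQ_le_const2)
  show "(\<lambda>n. \<bar>approx (n + m) z - approx m z\<bar>) \<longlonglongrightarrow> \<bar>dynamical_green p z - approx m z\<bar>"
    by (intro tendsto_intros LIMSEQ_ignore_initial_segment approx_tendsto)
  show "\<exists>N. \<forall>n\<ge>N. \<bar>approx (n + m) z - approx m z\<bar> \<le> 2 * C / d ^ m"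
    using approx_Cauchy[of m _ z] by (simp add: add.commute)
qed

lemma dynamical_green_near_log_plus: "\<bar>dynamical_green p z - log_plus (cmod z)\<bar> \<le> 2 * C"
  using dynamical_green_approx[of z 0] by (simp add: approx_def)

lemma dynamical_green_near_first_step:
  "\<bar>dynamical_green p z - log_plus (cmod (poly p z)) / d\<bar> \<le> 2 * C / d"
  using dynamical_green_approx[of z 1] by (simp add: approx_def)

lemma dynamical_green_iterate: "dynamical_green p ((poly p ^^ k) z) = d ^ k * dynamical_green p z"
proof (rule LIMSEQ_unique)
  show "(\<lambda>j. approx j ((poly p ^^ k) z)) \<longlonglongrightarrow> dynamical_green p ((poly p ^^ k) z)" by (rule approx_tendsto)
  have "approx j ((poly p ^^ k) z) = d ^ k * approx (j + k) z" for j
    using d by (simp add: approx_def funpow_add power_add)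
  moreover have "(\<lambda>j. d ^ k * approx (j + k) z) \<longlonglongrightarrow> d ^ k * dynamical_green p z"
    by (intro tendsto_intros LIMSEQ_ignore_initial_segment approx_tendsto)
  ultimately show "(\<lambda>j. approx j ((poly p ^^ k) z)) \<longlonglongrightarrow> d ^ k * dynamical_green p z" by simp
qed

lemma dynamical_green_nonneg: "dynamical_green p z \<ge> 0"
  by (rule LIMSEQ_le_const[OF approx_tendsto]) (auto simp: approx_def log_plus_def)

lemma borel_measurable_dynamical_green [measurable]: "dynamical_green p \<in> borel_measurable borel"
proof -
  have "continuous_on UNIV (poly p ^^ k)" for k
    by (induction k) (auto intro!: continuous_intros continuous_on_compose2[of UNIV "poly p"] simp: comp_def)
  then have [measurable]: "poly p ^^ k \<in> borel_measurable borel" for k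
    by (rule borel_measurable_continuous_onI)
  have "approx k \<in> borel_measurable borel" for k
    unfolding approx_def log_plus_def by measurable
  then show ?thesis by (rule borel_measurable_LIMSEQ_real[OF approx_tendsto])
qed

end

section \<open>The distributional Laplacian of logarithmic potentials\<close>

lemma test_function_has_derivative:
  assumes "test_function \<phi>"
  shows "(\<phi> has_derivative frechet_derivative \<phi> (at z)) (at z)"
  using assms C_k_Suc_has_derivative[of 0 \<phi> z] unfolding test_function_def by blast

lemma has_derivative_along_line:
  fixes \<phi> :: "complex \<Rightarrow> real" and b :: complex
  assumes "(\<phi> has_derivative \<phi>') (at (z + of_real s * b))"
  shows "((\<lambda>s. \<phi> (z + of_real s * b)) has_real_derivative \<phi>' b) (at s)"
proof -
  have "((\<lambda>s. z + of_real s * b) has_derivative (\<lambda>h. of_real h * b)) (at s)"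
    by (auto intro!: derivative_eq_intros)
  from has_derivative_compose[OF this assms]
  have "((\<lambda>s. \<phi> (z + of_real s * b)) has_derivative (\<lambda>h. \<phi>' (of_real h * b))) (at s)" .
  moreover have "\<phi>' (of_real h * b) = \<phi>' b * h" for h
    using linear_scale[OF has_derivative_linear[OF assms], of h b] by (simp add: scaleR_conv_of_real mult.commute)
  ultimately show ?thesis by (simp add: has_field_derivative_def)
qed

lemma test_function_dir_deriv:
  assumes "test_function \<phi>" and b: "b \<in> Basis"
  shows "\<And>s z. ((\<lambda>s. \<phi> (z + of_real s * b)) has_real_derivative dir_deriv b \<phi> (z + of_real s * b)) (at s)"
    and "\<And>s z. ((\<lambda>s. dir_deriv b \<phi> (z + of_real s * b)) has_real_derivative dir_deriv b (dir_deriv b \<phi>) (z + of_real s * b)) (at s)"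
    and "continuous_on UNIV (dir_deriv b \<phi>)" "continuous_on UNIV (dir_deriv b (dir_deriv b \<phi>))"
proof -
  have c: "C_k k (dir_deriv b \<phi>)" for k
    using assms unfolding test_function_def by (metis C_k.simps(2))
  have c2: "C_k k (dir_deriv b (dir_deriv b \<phi>))" for k
    using c[of "Suc k"] b by simp
  show "continuous_on UNIV (dir_deriv b \<phi>)" "continuous_on UNIV (dir_deriv b (dir_deriv b \<phi>))"
    using c[of 0] c2[of 0] by auto
  show "((\<lambda>s. \<phi> (z + of_real s * b)) has_real_derivative dir_deriv b \<phi> (z + of_real s * b)) (at s)" for s z
    unfolding dir_deriv_def by (rule has_derivative_along_line[OF test_function_has_derivative[OF assms(1)]])
  show "((\<lambda>s. dir_deriv b \<phi> (z + of_real s * b)) has_real_derivative dir_deriv b (dir_deriv b \<phi>) (z + of_real s * b)) (at s)" for s z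
    using has_derivative_along_line[OF C_k_Suc_has_derivative[OF c[of "Suc 0"]], where b = b] by (simp add: dir_deriv_def[of b "dir_deriv b \<phi>"])
qed

lemma dir_deriv_zero_outside:
  assumes "closed S" "\<And>z. z \<notin> S \<Longrightarrow> f z = 0" "z \<notin> S"
  shows "dir_deriv b f z = 0"
proof -
  have "((\<lambda>z. 0) has_derivative (\<lambda>h. 0)) (at z)" by simp
  then have "(f has_derivative (\<lambda>h. 0)) (at z)"
    by (rule has_derivative_transform_within_open[of _ _ _ _ "- S"]) (use assms in auto)
  then show ?thesis by (rule dir_deriv_eqI)
qed

lemma test_function_support:
  assumes "test_function \<phi>"
  obtains r where "r > 0" "\<And>z. z \<notin> cball 0 r \<Longrightarrow> \<phi> z = 0"
    "\<And>z b. z \<notin> cball 0 r \<Longrightarrow> dir_deriv b \<phi> z = 0" "\<And>z b. z \<notin> cball 0 r \<Longrightarrow> dir_deriv b (dir_deriv b \<phi>) z = 0"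
    "\<And>z. z \<notin> cball 0 r \<Longrightarrow> laplacian \<phi> z = 0"
proof -
  have "bounded (closure {z. \<phi> z \<noteq> 0})" using assms compact_imp_bounded by (auto simp: test_function_def)
  from bounded_subset_ballD[OF this, of 0] obtain r where r: "r > 0" "closure {z. \<phi> z \<noteq> 0} \<subseteq> ball 0 r" by blast
  have 0: "\<phi> z = 0" if "z \<notin> cball 0 r" for z
    using that r(2) closure_subset[of "{z. \<phi> z \<noteq> 0}"] by (auto simp: subset_eq) (meson less_imp_le)
  have 1: "dir_deriv b \<phi> z = 0" if "z \<notin> cball 0 r" for z b
    by (rule dir_deriv_zero_outside[OF closed_cball 0 that])
  have 2: "dir_deriv b (dir_deriv b \<phi>) z = 0" if "z \<notin> cball 0 r" for z b
    by (rule dir_deriv_zero_outside[OF closed_cball 1 that])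
  then have "laplacian \<phi> z = 0" if "z \<notin> cball 0 r" for z using that by (simp add: laplacian_def)
  with that[OF r(1) 0 1 2] show thesis by blast
qed

lemma continuous_on_laplacian: "test_function \<phi> \<Longrightarrow> continuous_on UNIV (laplacian \<phi>)"
  unfolding laplacian_def by (intro continuous_intros test_function_dir_deriv(4))

lemma bounded_continuous_support:
  fixes h :: "complex \<Rightarrow> real"
  assumes "continuous_on UNIV h" "\<And>z. z \<notin> cball 0 r \<Longrightarrow> h z = 0"
  shows "\<exists>B>0. \<forall>z. \<bar>h z\<bar> \<le> B"
proof -
  have "bounded (h ` cball 0 r)"
    using assms(1) by (intro compact_imp_bounded compact_continuous_image compact_cball) (auto intro: continuous_on_subset)
  then obtain B where B: "B > 0" "\<forall>y\<in>h ` cball 0 r. \<bar>y\<bar> \<le> B" by (auto simp: bounded_pos)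
  have "\<bar>h z\<bar> \<le> B" for z using B assms(2)[of z] by (cases "z \<in> cball 0 r") auto
  then show ?thesis using B(1) by blast
qed

lemma integrable_bounded_support:
  fixes h :: "complex \<Rightarrow> real"
  assumes "h \<in> borel_measurable borel" "\<And>z. z \<notin> cball 0 r \<Longrightarrow> h z = 0" "\<And>z. z \<in> cball 0 r \<Longrightarrow> \<bar>h z\<bar> \<le> B"
  shows "integrable lborel h"
proof (rule Bochner_Integration.integrable_bound[where f = "\<lambda>z. B * indicator (cball 0 r) z"])
  show "integrable lborel (\<lambda>z. B * indicator (cball (0::complex) r) z)"
    using emeasure_lborel_cball_finite[of 0 r] by (intro integrable_mult_right) (simp add: integrable_indicator_iff)
  show "AE z in lborel. norm (h z) \<le> norm (B * indicator (cball 0 r) z)"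
  proof (rule AE_I2)
    fix z
    show "norm (h z) \<le> norm (B * indicator (cball 0 r) z)"
      using assms(2,3)[of z] by (cases "z \<in> cball 0 r") auto
  qed
qed (use assms(1) in simp)

lemma lborel_integral_translate:
  fixes F :: "complex \<Rightarrow> real"
  assumes "F \<in> borel_measurable borel"
  shows "(LINT z|lborel. F (z + c)) = (LINT z|lborel. F z)"
proof -
  have "(LINT z|lborel. F z) = (LINT z|distr lborel borel ((+) c). F z)" by (simp add: lborel_distr_plus)
  also have "\<dots> = (LINT z|lborel. F (c + z))" using assms by (subst integral_distr) auto
  finally show ?thesis by (simp add: add.commute)
qed

text \<open>By translation invariance the integrals of the difference quotients vanish.\<close>

lemma integral_derivative_along_line:
  fixes F F' :: "complex \<Rightarrow> real"
  assumes F: "continuous_on UNIV F" "\<And>z. z \<notin> cball 0 r \<Longrightarrow> F z = 0"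
    and F': "continuous_on UNIV F'" "\<And>z. z \<notin> cball 0 r \<Longrightarrow> F' z = 0"
    and deriv: "\<And>s z. ((\<lambda>s. F (z + of_real s * b)) has_real_derivative F' (z + of_real s * b)) (at s)"
  shows "(LINT z|lborel. F' z) = 0"
proof -
  obtain B where B: "B > 0" "\<And>z. \<bar>F' z\<bar> \<le> B" using bounded_continuous_support[OF F'] by auto
  obtain A where A: "A > 0" "\<And>z. \<bar>F z\<bar> \<le> A" using bounded_continuous_support[OF F] by auto
  have [measurable]: "F \<in> borel_measurable borel" "F' \<in> borel_measurable borel"
    using F(1) F'(1) by (auto intro: borel_measurable_continuous_onI)
  define h where "h n = 1 / real (Suc n)" for n
  have h: "0 < h n" "h n \<le> 1" for n by (auto simp: h_def)
  define D where "D n z = (F (z + of_real (h n) * b) - F z) / h n" for n z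
  \<comment> \<open>By the mean value theorem the difference quotients are bounded by
    \<open>B\<close>, and as \<open>h n \<le> 1\<close> they vanish outside the disc enlarged by
    |b|.\<close>
  have "(\<lambda>n. LINT z|lborel. D n z) \<longlonglongrightarrow> (LINT z|lborel. F' z)"
  proof (rule integral_dominated_convergence[where w = "\<lambda>z. B * indicator (cball 0 (r + cmod b)) z"])
    show "integrable lborel (\<lambda>z. B * indicator (cball (0::complex) (r + cmod b)) z)"
      using emeasure_lborel_cball_finite[of 0 "r + cmod b"] by (intro integrable_mult_right) (simp add: integrable_indicator_iff)
    show "AE z in lborel. (\<lambda>n. D n z) \<longlonglongrightarrow> F' z"
    proof (rule AE_I2)
      fix z
      have "((\<lambda>s. (F (z + of_real s * b) - F z) / s) \<longlongrightarrow> F' z) (at 0)"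
        using deriv[of z 0] by (simp add: has_field_derivative_iff)
      moreover have "filterlim h (at 0) sequentially"
      proof -
        have "h \<longlonglongrightarrow> 0" unfolding h_def[abs_def] by real_asymp
        then show ?thesis unfolding filterlim_at using h(1) by (auto simp: less_imp_neq[symmetric])
      qed
      ultimately show "(\<lambda>n. D n z) \<longlonglongrightarrow> F' z" unfolding D_def by (rule filterlim_compose)
    qed
    show "AE z in lborel. norm (D n z) \<le> B * indicator (cball 0 (r + cmod b)) z" for n
    proof (rule AE_I2)
      fix z
      show "norm (D n z) \<le> B * indicator (cball 0 (r + cmod b)) z"
      proof (cases "z \<in> cball 0 (r + cmod b)")
        case True
        obtain s where "F (z + of_real (h n) * b) - F (z + of_real 0 * b) = (h n - 0) * F' (z + of_real s * b)"
          using MVT2[OF h(1)[of n], of "\<lambda>s. F (z + of_real s * b)" "\<lambda>s. F' (z + of_real s * b)"] deriv by blast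
        then have "D n z = F' (z + of_real s * b)" using h(1)[of n] by (simp add: D_def)
        then show ?thesis using B(2) True by simp
      next
        case False
        have "cmod (of_real (h n) * b) \<le> 1 * cmod b" unfolding norm_mult using h[of n] by (intro mult_right_mono) auto
        moreover have "r + cmod b < cmod z" using False by simp
        ultimately have "r < cmod (z + of_real (h n) * b)" "r < cmod z"
          using norm_triangle_ineq4[of "z + of_real (h n) * b" "of_real (h n) * b"] norm_ge_zero[of b] by (simp_all del: norm_ge_zero)
        then have "z + of_real (h n) * b \<notin> cball 0 r" "z \<notin> cball 0 r" by auto
        then show ?thesis using F(2) False by (simp add: D_def)
      qed
    qed
  qed (auto simp: D_def)
  moreover have "(LINT z|lborel. D n z) = 0" for n
  proof -
    have i: "integrable lborel F" by (rule integrable_bounded_support[OF _ F(2) A(2)]) auto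
    have i2: "integrable lborel (\<lambda>z. F (z + of_real (h n) * b))"
    proof (rule integrable_bounded_support[where r = "r + cmod b" and B = A])
      fix z :: complex assume z: "z \<notin> cball 0 (r + cmod b)"
      have "cmod (of_real (h n) * b) \<le> 1 * cmod b" unfolding norm_mult using h[of n] by (intro mult_right_mono) auto
      then have "z + of_real (h n) * b \<notin> cball 0 r"
        using z norm_triangle_ineq4[of "z + of_real (h n) * b" "of_real (h n) * b"] by auto
      then show "F (z + of_real (h n) * b) = 0" by (rule F(2))
    qed (use A in auto)
    show ?thesis unfolding D_def using i i2 lborel_integral_translate[of F "of_real (h n) * b"] by simp
  qed
  ultimately show ?thesis by (simp add: LIMSEQ_const_iff)
qed

text \<open>A smooth regularization of ln|z| whose Laplacian is an approximate identity of mass 2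
  pi.\<close>

definition reg_ln :: "real \<Rightarrow> complex \<Rightarrow> real" where
  "reg_ln e z = ln ((cmod z)\<^sup>2 + e\<^sup>2) / 2"

lemma reg_ln_along_line:
  fixes b \<zeta> z :: complex
  assumes e: "e > 0"
  defines "w \<equiv> \<lambda>s :: real. z + of_real s * b - \<zeta>"
  defines "q \<equiv> \<lambda>s. (cmod (w s))\<^sup>2 + e\<^sup>2"
  shows "((\<lambda>s. reg_ln e (w s)) has_real_derivative (w s \<bullet> b) / q s) (at s)"
    "((\<lambda>s. (w s \<bullet> b) / q s) has_real_derivative (b \<bullet> b) / q s - 2 * (w s \<bullet> b)\<^sup>2 / (q s)\<^sup>2) (at s)"
proof -
  have q: "q s > 0" for s unfolding q_def using e by (simp add: add_nonneg_pos)
  have dq: "(q has_real_derivative 2 * (w s \<bullet> b)) (at s)"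
    unfolding q_def w_def cmod_power2 inner_complex_def
    by (rule derivative_eq_intros refl | simp)+
  have dl: "((\<lambda>s. w s \<bullet> b) has_real_derivative b \<bullet> b) (at s)"
    unfolding w_def inner_complex_def by (rule derivative_eq_intros refl | simp)+
  have "((\<lambda>s. ln (q s) / 2) has_real_derivative 1 / q s * (2 * (w s \<bullet> b)) / 2) (at s)"
    by (intro DERIV_cdivide DERIV_chain2[OF DERIV_ln_divide[OF q] dq])
  moreover have "1 / q s * (2 * (w s \<bullet> b)) / 2 = (w s \<bullet> b) / q s" by simp
  ultimately show "((\<lambda>s. reg_ln e (w s)) has_real_derivative (w s \<bullet> b) / q s) (at s)"
    by (simp only: reg_ln_def q_def)
  have "((\<lambda>s. (w s \<bullet> b) / q s) has_real_derivative ((b \<bullet> b) * q s - (w s \<bullet> b) * (2 * (w s \<bullet> b))) / (q s * q s)) (at s)"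
    by (rule DERIV_divide[OF dl dq]) (use q[of s] in auto)
  moreover have "((b \<bullet> b) * q s - (w s \<bullet> b) * (2 * (w s \<bullet> b))) / (q s * q s) = (b \<bullet> b) / q s - 2 * (w s \<bullet> b)\<^sup>2 / (q s)\<^sup>2"
    using q[of s] by (simp add: diff_divide_distrib power2_eq_square)
  ultimately show "((\<lambda>s. (w s \<bullet> b) / q s) has_real_derivative (b \<bullet> b) / q s - 2 * (w s \<bullet> b)\<^sup>2 / (q s)\<^sup>2) (at s)" by simp
qed

text \<open>Green's second identity in each coordinate direction: L \<phi>'' - L'' \<phi> is the
  derivative of L \<phi>' - L' \<phi>, which has compact support, so its integral vanishes. Summing
  L'' over the two directions gives the explicit kernel.\<close>

lemma integral_reg_ln_laplacian:
  assumes \<phi>: "test_function \<phi>" and e: "e > 0"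
  shows "(LINT z|lborel. reg_ln e (z - \<zeta>) * laplacian \<phi> z) = (LINT z|lborel. 2 * e\<^sup>2 / ((cmod (z - \<zeta>))\<^sup>2 + e\<^sup>2)\<^sup>2 * \<phi> z)"
proof -
  obtain r where r: "r > 0" "\<And>z. z \<notin> cball 0 r \<Longrightarrow> \<phi> z = 0"
    "\<And>z b. z \<notin> cball 0 r \<Longrightarrow> dir_deriv b \<phi> z = 0" "\<And>z b. z \<notin> cball 0 r \<Longrightarrow> dir_deriv b (dir_deriv b \<phi>) z = 0"
    by (rule test_function_support[OF \<phi>]) blast
  define q where "q z = (cmod (z - \<zeta>))\<^sup>2 + e\<^sup>2" for z
  have q: "q z > 0" "q z \<noteq> 0" for z unfolding q_def using e by (simp_all add: add_nonneg_pos less_imp_neq[symmetric])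
  have q0: "(cmod (z - \<zeta>))\<^sup>2 + e\<^sup>2 \<noteq> 0" "0 < (cmod (z - \<zeta>))\<^sup>2 + e\<^sup>2" for z using q[of z] by (auto simp: q_def)
  define L where "L z = reg_ln e (z - \<zeta>)" for z
  define L1 where "L1 b z = ((z - \<zeta>) \<bullet> b) / q z" for b z
  define L2 where "L2 b z = (b \<bullet> b) / q z - 2 * ((z - \<zeta>) \<bullet> b)\<^sup>2 / (q z)\<^sup>2" for b z
  have c: "continuous_on UNIV q" unfolding q_def by (intro continuous_intros)
  have cL: "continuous_on UNIV L" unfolding L_def reg_ln_def using q0 by (intro continuous_intros) auto
  have cL1: "continuous_on UNIV (L1 b)" for b unfolding L1_def using q by (intro continuous_intros c) auto
  have cL2: "continuous_on UNIV (L2 b)" for b unfolding L2_def using q by (intro continuous_intros c) auto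
  note c\<phi> = test_function_continuous[OF \<phi>]
  have i: "integrable lborel h" if h: "continuous_on UNIV h" "\<And>z. z \<notin> cball 0 r \<Longrightarrow> h z = 0" for h :: "complex \<Rightarrow> real"
  proof -
    obtain B where "\<And>z. \<bar>h z\<bar> \<le> B" using bounded_continuous_support[OF h] by auto
    then show ?thesis by (intro integrable_bounded_support[OF borel_measurable_continuous_onI[OF h(1)] h(2)])
  qed
  have i1: "integrable lborel (\<lambda>z. L z * dir_deriv b (dir_deriv b \<phi>) z)" "integrable lborel (\<lambda>z. L2 b z * \<phi> z)" if "b \<in> Basis" for b
    by (rule i; use r cL cL2 c\<phi> test_function_dir_deriv(4)[OF \<phi> that] in \<open>auto intro!: continuous_intros\<close>)+
  have 0: "(LINT z|lborel. L z * dir_deriv b (dir_deriv b \<phi>) z) = (LINT z|lborel. L2 b z * \<phi> z)" if b: "b \<in> Basis" for b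
  proof -
    note d = test_function_dir_deriv[OF \<phi> b]
    have "(LINT z|lborel. L z * dir_deriv b (dir_deriv b \<phi>) z - L2 b z * \<phi> z) = 0"
    proof (rule integral_derivative_along_line[where F = "\<lambda>z. L z * dir_deriv b \<phi> z - L1 b z * \<phi> z" and r = r and b = b])
      show "continuous_on UNIV (\<lambda>z. L z * dir_deriv b \<phi> z - L1 b z * \<phi> z)"
        "continuous_on UNIV (\<lambda>z. L z * dir_deriv b (dir_deriv b \<phi>) z - L2 b z * \<phi> z)"
        by (intro continuous_intros cL cL1 cL2 c\<phi> d(3,4))+
      show "((\<lambda>s. L (z + of_real s * b) * dir_deriv b \<phi> (z + of_real s * b) - L1 b (z + of_real s * b) * \<phi> (z + of_real s * b))
        has_real_derivative L (z + of_real s * b) * dir_deriv b (dir_deriv b \<phi>) (z + of_real s * b) - L2 b (z + of_real s * b) * \<phi> (z + of_real s * b)) (at s)" for s z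
      proof -
        have dL: "((\<lambda>s. L (z + of_real s * b)) has_real_derivative L1 b (z + of_real s * b)) (at s)"
          unfolding L_def L1_def q_def by (rule reg_ln_along_line(1)[OF e])
        have dL1: "((\<lambda>s. L1 b (z + of_real s * b)) has_real_derivative L2 b (z + of_real s * b)) (at s)"
          unfolding L2_def L1_def q_def by (rule reg_ln_along_line(2)[OF e])
        show ?thesis
          by (rule DERIV_diff[OF DERIV_mult[OF dL d(2)] DERIV_mult[OF dL1 d(1)], THEN DERIV_cong]) (simp add: algebra_simps)
      qed
    qed (use r in auto)
    then show ?thesis using i1[OF b] by simp
  qed
  have "(LINT z|lborel. L z * laplacian \<phi> z) = (\<Sum>b\<in>Basis. LINT z|lborel. L z * dir_deriv b (dir_deriv b \<phi>) z)"
    unfolding laplacian_def sum_distrib_left using i1 by (intro Bochner_Integration.integral_sum) auto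
  also have "\<dots> = (\<Sum>b\<in>Basis. LINT z|lborel. L2 b z * \<phi> z)" by (intro sum.cong refl 0)
  also have "\<dots> = (LINT z|lborel. (\<Sum>b\<in>Basis. L2 b z * \<phi> z))"
    using i1 by (intro Bochner_Integration.integral_sum[symmetric]) auto
  also have "\<dots> = (LINT z|lborel. 2 * e\<^sup>2 / ((cmod (z - \<zeta>))\<^sup>2 + e\<^sup>2)\<^sup>2 * \<phi> z)"
  proof (rule Bochner_Integration.integral_cong[OF refl])
    fix z
    have "(\<Sum>b\<in>Basis. L2 b z) = 2 / q z - 2 * (cmod (z - \<zeta>))\<^sup>2 / (q z)\<^sup>2"
      unfolding L2_def Basis_complex_def by (simp add: inner_complex_def cmod_power2 add_divide_distrib distrib_left)
    also have "\<dots> = 2 * e\<^sup>2 / (q z)\<^sup>2"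
    proof -
      have "2 / q z = 2 * q z / (q z)\<^sup>2" using q[of z] by (simp add: power2_eq_square)
      then show ?thesis by (simp add: q_def diff_divide_distrib[symmetric])
    qed
    finally show "(\<Sum>b\<in>Basis. L2 b z * \<phi> z) = 2 * e\<^sup>2 / ((cmod (z - \<zeta>))\<^sup>2 + e\<^sup>2)\<^sup>2 * \<phi> z"
      unfolding sum_distrib_right[symmetric] by (simp add: q_def)
  qed
  finally show ?thesis by (simp add: L_def)
qed

section \<open>The logarithm as a fundamental solution\<close>

lemma nn_integral_log_tail_translate:
  "(\<integral>\<^sup>+z. ennreal (max 0 (- M - ln (cmod (z - \<zeta>)))) \<partial>lborel) = ennreal (pi / 2 * exp (- 2 * M))"
proof -
  have "(\<integral>\<^sup>+z. ennreal (max 0 (- M - ln (cmod (z - \<zeta>)))) \<partial>lborel)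
     = (\<integral>\<^sup>+z. ennreal (max 0 (- M - ln (cmod (z - \<zeta>)))) \<partial>distr lborel borel ((+) \<zeta>))"
    by (simp add: lborel_distr_plus)
  also have "\<dots> = (\<integral>\<^sup>+z. ennreal (max 0 (- M - ln (cmod z))) \<partial>lborel)"
    by (subst nn_integral_distr) auto
  finally show ?thesis by (simp only: nn_integral_log_tail_complex)
qed

text \<open>For |z - \<zeta>| < 1 the log tail has mass pi/2, the instance M = 0 that explains the
  terms \<open>- 0\<close>; elsewhere ln x \<le> x \<le> r + R on the support. The bound sees
  \<zeta> through \<open>R\<close> only, so it can be integrated over \<zeta>.\<close>

lemma nn_integral_ln_bounded_support:
  fixes h :: "complex \<Rightarrow> real"
  assumes h: "\<And>z. z \<notin> cball 0 r \<Longrightarrow> h z = 0" "\<And>z. \<bar>h z\<bar> \<le> B"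
    and \<zeta>: "cmod \<zeta> \<le> R" and r: "r \<ge> 0"
  shows "(\<integral>\<^sup>+z. ennreal \<bar>ln (cmod (z - \<zeta>)) * h z\<bar> \<partial>lborel) \<le> ennreal (B * (pi / 2)) + ennreal (B * (r + R) * (pi * r\<^sup>2))"
proof -
  have B: "B \<ge> 0" using h(2)[of 0] by simp
  have R: "R \<ge> 0" using \<zeta> norm_ge_zero[of \<zeta>] by linarith
  have "(\<integral>\<^sup>+z. ennreal \<bar>ln (cmod (z - \<zeta>)) * h z\<bar> \<partial>lborel)
    \<le> (\<integral>\<^sup>+z. ennreal B * ennreal (max 0 (- 0 - ln (cmod (z - \<zeta>)))) + ennreal (B * (r + R)) * indicator (cball 0 r) z \<partial>lborel)"
  proof (rule nn_integral_mono)
    fix z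
    let ?x = "cmod (z - \<zeta>)" and ?m = "max 0 (- 0 - ln (cmod (z - \<zeta>)))"
    show "ennreal \<bar>ln ?x * h z\<bar> \<le> ennreal B * ennreal ?m + ennreal (B * (r + R)) * indicator (cball 0 r) z"
    proof (cases "z \<in> cball 0 r")
      case True
      have x: "0 \<le> ?x" "?x \<le> r + R" "0 \<le> r + R" using r R True \<zeta> norm_triangle_ineq4[of z \<zeta>] by auto
      have "\<bar>ln ?x\<bar> \<le> ?m + (r + R)"
      proof (cases "?x < 1")
        case True
        then show ?thesis using x by (cases "?x = 0") auto
      next
        case False
        then have "ln ?x \<le> ?x - 1" by (intro ln_le_minus_one) auto
        then show ?thesis using False x by auto
      qed
      then have "\<bar>ln ?x * h z\<bar> \<le> (?m + (r + R)) * B"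
        unfolding abs_mult using h(2) by (intro mult_mono) auto
      then have "ennreal \<bar>ln ?x * h z\<bar> \<le> ennreal (B * ?m + B * (r + R))" by (intro ennreal_leI) (simp add: algebra_simps)
      also have "\<dots> = ennreal (B * ?m) + ennreal (B * (r + R))" using B r R by (intro ennreal_plus mult_nonneg_nonneg) auto
      also have "ennreal (B * ?m) = ennreal B * ennreal ?m" using B by (intro ennreal_mult) auto
      finally show ?thesis using True by simp
    next
      case False
      then show ?thesis using h(1)[of z] by simp
    qed
  qed
  also have "\<dots> = ennreal B * (\<integral>\<^sup>+z. ennreal (max 0 (- 0 - ln (cmod (z - \<zeta>)))) \<partial>lborel) + ennreal (B * (r + R)) * emeasure lborel (cball (0::complex) r)"
  proof -
    have [measurable]: "cball (0::complex) r \<in> sets borel" by simp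
    have "(\<integral>\<^sup>+z. ennreal B * ennreal (max 0 (- 0 - ln (cmod (z - \<zeta>)))) \<partial>lborel) = ennreal B * (\<integral>\<^sup>+z. ennreal (max 0 (- 0 - ln (cmod (z - \<zeta>)))) \<partial>lborel)"
      by (rule nn_integral_cmult) measurable
    moreover have "(\<integral>\<^sup>+z. ennreal (B * (r + R)) * indicator (cball (0::complex) r) z \<partial>lborel) = ennreal (B * (r + R)) * emeasure lborel (cball (0::complex) r)"
      by (rule nn_integral_cmult_indicator) simp
    moreover have "(\<integral>\<^sup>+z. ennreal B * ennreal (max 0 (- 0 - ln (cmod (z - \<zeta>)))) + ennreal (B * (r + R)) * indicator (cball 0 r) z \<partial>lborel)
      = (\<integral>\<^sup>+z. ennreal B * ennreal (max 0 (- 0 - ln (cmod (z - \<zeta>)))) \<partial>lborel) + (\<integral>\<^sup>+z. ennreal (B * (r + R)) * indicator (cball (0::complex) r) z \<partial>lborel)"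
      by (rule nn_integral_add) measurable
    ultimately show ?thesis by (simp only:)
  qed
  also have "emeasure lborel (cball (0::complex) r) = ennreal (pi * r\<^sup>2)"
    using r by (subst emeasure_cball) (auto simp: unit_ball_vol_2)
  finally show ?thesis unfolding nn_integral_log_tail_translate using B r R
    by (simp add: ennreal_mult[symmetric])
qed

lemma integrable_ln_bounded_support:
  fixes h :: "complex \<Rightarrow> real"
  assumes "h \<in> borel_measurable borel" "\<And>z. z \<notin> cball 0 r \<Longrightarrow> h z = 0" "\<And>z. \<bar>h z\<bar> \<le> B" "r \<ge> 0"
  shows "integrable lborel (\<lambda>z. ln (cmod (z - \<zeta>)) * h z)"
proof (rule integrableI_bounded)
  show "(\<lambda>z. ln (cmod (z - \<zeta>)) * h z) \<in> borel_measurable lborel" using assms(1) by measurable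
  have "(\<integral>\<^sup>+z. ennreal (norm (ln (cmod (z - \<zeta>)) * h z)) \<partial>lborel) \<le> ennreal (B * (pi / 2)) + ennreal (B * (r + cmod \<zeta>) * (pi * r\<^sup>2))"
    unfolding real_norm_def by (rule nn_integral_ln_bounded_support[OF assms(2,3) order_refl assms(4)])
  also have "\<dots> < \<infinity>" by simp
  finally show "(\<integral>\<^sup>+z. ennreal (norm (ln (cmod (z - \<zeta>)) * h z)) \<partial>lborel) < \<infinity>" .
qed

lemma lborel_integral_affine_complex:
  fixes F :: "complex \<Rightarrow> real"
  assumes "F \<in> borel_measurable borel" "e > 0"
  shows "(LINT z|lborel. F z) = e\<^sup>2 * (LINT w|lborel. F (\<zeta> + of_real e * w))"
proof -
  have "(LINT z|lborel. F z) = (LINT z|density (distr lborel borel (\<lambda>w. \<zeta> + e *\<^sub>R w)) (\<lambda>_. ennreal (\<bar>e\<bar> ^ DIM(complex))). F z)"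
    using assms(2) by (subst lborel_affine[of e \<zeta>]) auto
  also have "\<dots> = (LINT z|distr lborel borel (\<lambda>w. \<zeta> + e *\<^sub>R w). e\<^sup>2 * F z)"
    using assms by (subst integral_density) auto
  also have "\<dots> = e\<^sup>2 * (LINT w|lborel. F (\<zeta> + of_real e * w))"
    using assms by (subst integral_distr) (auto simp: scaleR_conv_of_real)
  finally show ?thesis .
qed

text \<open>Let e tend to 0 in \<open>integral_reg_ln_laplacian\<close>; both sides converge by
  dominated convergence, the right one after rescaling.\<close>

lemma integral_ln_laplacian:
  assumes \<phi>: "test_function \<phi>"
  shows "(LINT z|lborel. ln (cmod (z - \<zeta>)) * laplacian \<phi> z) = 2 * pi * \<phi> \<zeta>"
proof -
  obtain r where r: "r > 0" "\<And>z. z \<notin> cball 0 r \<Longrightarrow> \<phi> z = 0" "\<And>z. z \<notin> cball 0 r \<Longrightarrow> laplacian \<phi> z = 0"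
    by (rule test_function_support[OF \<phi>]) blast
  obtain B where B: "B > 0" "\<And>z. \<bar>laplacian \<phi> z\<bar> \<le> B"
    using bounded_continuous_support[OF continuous_on_laplacian[OF \<phi>] r(3)] by auto
  obtain A where A: "A > 0" "\<And>z. \<bar>\<phi> z\<bar> \<le> A"
    using bounded_continuous_support[OF test_function_continuous[OF \<phi>] r(2)] by auto
  have [measurable]: "laplacian \<phi> \<in> borel_measurable borel" "\<phi> \<in> borel_measurable borel"
    using continuous_on_laplacian[OF \<phi>] test_function_continuous[OF \<phi>] by (auto intro: borel_measurable_continuous_onI)
  define e where "e n = 1 / real (Suc n)" for n
  have e: "0 < e n" "e n \<le> 1" for n by (auto simp: e_def)
  have e0: "e \<longlonglongrightarrow> 0" unfolding e_def[abs_def] by real_asymp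
  \<comment> \<open>For 0 < e \<le> 1 the regularized logarithm lies between ln and
    \<open>reg_ln 1\<close>, so the absolute values of these two dominate.\<close>
  have lhs: "(\<lambda>n. LINT z|lborel. reg_ln (e n) (z - \<zeta>) * laplacian \<phi> z) \<longlonglongrightarrow> (LINT z|lborel. ln (cmod (z - \<zeta>)) * laplacian \<phi> z)"
  proof (rule integral_dominated_convergence[where w = "\<lambda>z. \<bar>ln (cmod (z - \<zeta>)) * laplacian \<phi> z\<bar> + \<bar>reg_ln 1 (z - \<zeta>) * laplacian \<phi> z\<bar>"])
    have "integrable lborel (\<lambda>z. ln (cmod (z - \<zeta>)) * laplacian \<phi> z)"
      by (rule integrable_ln_bounded_support[OF _ r(3) B(2)]) (use r in auto)
    moreover have "integrable lborel (\<lambda>z. reg_ln 1 (z - \<zeta>) * laplacian \<phi> z)"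
    proof -
      have c: "continuous_on UNIV (\<lambda>z. reg_ln 1 (z - \<zeta>) * laplacian \<phi> z)"
        unfolding reg_ln_def by (intro continuous_intros continuous_on_laplacian[OF \<phi>]) (auto simp: add_nonneg_eq_0_iff)
      have z: "reg_ln 1 (z - \<zeta>) * laplacian \<phi> z = 0" if "z \<notin> cball 0 r" for z using r(3)[OF that] by simp
      obtain b where "\<And>z. \<bar>reg_ln 1 (z - \<zeta>) * laplacian \<phi> z\<bar> \<le> b" using bounded_continuous_support[OF c z] by auto
      then show ?thesis by (intro integrable_bounded_support[OF borel_measurable_continuous_onI[OF c] z])
    qed
    ultimately show "integrable lborel (\<lambda>z. \<bar>ln (cmod (z - \<zeta>)) * laplacian \<phi> z\<bar> + \<bar>reg_ln 1 (z - \<zeta>) * laplacian \<phi> z\<bar>)"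
      by (intro Bochner_Integration.integrable_add integrable_abs)
    show "AE z in lborel. (\<lambda>n. reg_ln (e n) (z - \<zeta>) * laplacian \<phi> z) \<longlonglongrightarrow> ln (cmod (z - \<zeta>)) * laplacian \<phi> z"
      using AE_lborel_singleton[of \<zeta>]
    proof eventually_elim
      case (elim z)
      then have p: "cmod (z - \<zeta>) > 0" by simp
      have "(\<lambda>n. ln ((cmod (z - \<zeta>))\<^sup>2 + (e n)\<^sup>2) / 2 * laplacian \<phi> z) \<longlonglongrightarrow> ln ((cmod (z - \<zeta>))\<^sup>2 + 0\<^sup>2) / 2 * laplacian \<phi> z"
        using p by (intro tendsto_intros e0) auto
      then show ?case using p by (simp add: reg_ln_def ln_realpow)
    qed
    show "AE z in lborel. norm (reg_ln (e n) (z - \<zeta>) * laplacian \<phi> z) \<le> \<bar>ln (cmod (z - \<zeta>)) * laplacian \<phi> z\<bar> + \<bar>reg_ln 1 (z - \<zeta>) * laplacian \<phi> z\<bar>" for n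
      using AE_lborel_singleton[of \<zeta>]
    proof eventually_elim
      case (elim z)
      then have p: "cmod (z - \<zeta>) > 0" by simp
      have "ln ((cmod (z - \<zeta>))\<^sup>2) \<le> ln ((cmod (z - \<zeta>))\<^sup>2 + (e n)\<^sup>2)" using p by (intro ln_mono) auto
      then have 1: "ln (cmod (z - \<zeta>)) \<le> reg_ln (e n) (z - \<zeta>)" using p by (simp add: reg_ln_def ln_realpow)
      have "(e n)\<^sup>2 \<le> 1" using e[of n] by (simp add: power_le_one)
      moreover have "(cmod (z - \<zeta>))\<^sup>2 + (e n)\<^sup>2 > 0" using p by (simp add: add_pos_nonneg)
      ultimately have "ln ((cmod (z - \<zeta>))\<^sup>2 + (e n)\<^sup>2) \<le> ln ((cmod (z - \<zeta>))\<^sup>2 + 1\<^sup>2)" by (intro ln_mono) auto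
      then have 2: "reg_ln (e n) (z - \<zeta>) \<le> reg_ln 1 (z - \<zeta>)" by (simp add: reg_ln_def)
      have "\<bar>reg_ln (e n) (z - \<zeta>)\<bar> * \<bar>laplacian \<phi> z\<bar> \<le> (\<bar>ln (cmod (z - \<zeta>))\<bar> + \<bar>reg_ln 1 (z - \<zeta>)\<bar>) * \<bar>laplacian \<phi> z\<bar>"
        using 1 2 by (intro mult_right_mono) auto
      then show ?case by (simp add: abs_mult distrib_right)
    qed
  qed (unfold reg_ln_def, measurable)
  \<comment> \<open>The substitution z = \<zeta> + e w turns the approximate identity into one fixed
    kernel and moves e into the argument of \<phi>.\<close>
  have rhs: "(\<lambda>n. LINT z|lborel. 2 * (e n)\<^sup>2 / ((cmod (z - \<zeta>))\<^sup>2 + (e n)\<^sup>2)\<^sup>2 * \<phi> z) \<longlonglongrightarrow> (LINT w|lborel. 2 * 1\<^sup>2 / ((cmod w)\<^sup>2 + 1\<^sup>2)\<^sup>2 * \<phi> \<zeta>)"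
  proof -
    let ?k = "\<lambda>w :: complex. 2 * 1\<^sup>2 / ((cmod w)\<^sup>2 + 1\<^sup>2)\<^sup>2 :: real"
    have "(LINT z|lborel. 2 * (e n)\<^sup>2 / ((cmod (z - \<zeta>))\<^sup>2 + (e n)\<^sup>2)\<^sup>2 * \<phi> z) = (LINT w|lborel. ?k w * \<phi> (\<zeta> + of_real (e n) * w))" for n
    proof -
      have "(LINT z|lborel. 2 * (e n)\<^sup>2 / ((cmod (z - \<zeta>))\<^sup>2 + (e n)\<^sup>2)\<^sup>2 * \<phi> z)
         = (e n)\<^sup>2 * (LINT w|lborel. 2 * (e n)\<^sup>2 / ((cmod (\<zeta> + of_real (e n) * w - \<zeta>))\<^sup>2 + (e n)\<^sup>2)\<^sup>2 * \<phi> (\<zeta> + of_real (e n) * w))"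
        by (rule lborel_integral_affine_complex[OF _ e(1)]) measurable
      also have "\<dots> = (LINT w|lborel. (e n)\<^sup>2 * (2 * (e n)\<^sup>2 / ((cmod (\<zeta> + of_real (e n) * w - \<zeta>))\<^sup>2 + (e n)\<^sup>2)\<^sup>2 * \<phi> (\<zeta> + of_real (e n) * w)))"
        by (rule integral_mult_right_zero[symmetric])
      also have "\<dots> = (LINT w|lborel. ?k w * \<phi> (\<zeta> + of_real (e n) * w))"
      proof (rule Bochner_Integration.integral_cong[OF refl])
        fix w
        have "(cmod (\<zeta> + of_real (e n) * w - \<zeta>))\<^sup>2 + (e n)\<^sup>2 = (e n)\<^sup>2 * ((cmod w)\<^sup>2 + 1\<^sup>2)"
          using e(1)[of n] by (simp add: norm_mult power_mult_distrib distrib_left)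
        then have "(e n)\<^sup>2 * (2 * (e n)\<^sup>2 / ((cmod (\<zeta> + of_real (e n) * w - \<zeta>))\<^sup>2 + (e n)\<^sup>2)\<^sup>2) = (e n)\<^sup>2 * (2 * (e n)\<^sup>2) / ((e n)\<^sup>2 * ((cmod w)\<^sup>2 + 1\<^sup>2))\<^sup>2"
          by (simp only: times_divide_eq_right)
        also have "\<dots> = ((e n)\<^sup>2)\<^sup>2 * 2 / (((e n)\<^sup>2)\<^sup>2 * ((cmod w)\<^sup>2 + 1\<^sup>2)\<^sup>2)"
          by (simp only: power_mult_distrib power2_eq_square mult_ac)
        also have "\<dots> = ?k w" using e(1)[of n] by simp
        finally show "(e n)\<^sup>2 * (2 * (e n)\<^sup>2 / ((cmod (\<zeta> + of_real (e n) * w - \<zeta>))\<^sup>2 + (e n)\<^sup>2)\<^sup>2 * \<phi> (\<zeta> + of_real (e n) * w)) = ?k w * \<phi> (\<zeta> + of_real (e n) * w)"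
          by (simp only: mult.assoc[symmetric])
      qed
      finally show ?thesis .
    qed
    moreover have "(\<lambda>n. LINT w|lborel. ?k w * \<phi> (\<zeta> + of_real (e n) * w)) \<longlonglongrightarrow> (LINT w|lborel. ?k w * \<phi> \<zeta>)"
    proof (rule integral_dominated_convergence[where w = "\<lambda>w. ?k w * A"])
      have "integrable lborel ?k"
        using nn_integral_poisson_complex[of 1] by (intro integrableI_nonneg) auto
      then show "integrable lborel (\<lambda>w. ?k w * A)" by (rule integrable_mult_left)
      show "AE w in lborel. (\<lambda>n. ?k w * \<phi> (\<zeta> + of_real (e n) * w)) \<longlonglongrightarrow> ?k w * \<phi> \<zeta>"
      proof (rule AE_I2)
        fix w
        have "(\<lambda>n. \<zeta> + of_real (e n) * w) \<longlonglongrightarrow> \<zeta> + of_real 0 * w" by (intro tendsto_intros e0)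
        then have "(\<lambda>n. \<phi> (\<zeta> + of_real (e n) * w)) \<longlonglongrightarrow> \<phi> (\<zeta> + of_real 0 * w)"
          by (rule continuous_on_tendsto_compose[OF test_function_continuous[OF \<phi>]]) auto
        then show "(\<lambda>n. ?k w * \<phi> (\<zeta> + of_real (e n) * w)) \<longlonglongrightarrow> ?k w * \<phi> \<zeta>" by (intro tendsto_mult tendsto_const) simp
      qed
      show "AE w in lborel. norm (?k w * \<phi> (\<zeta> + of_real (e n) * w)) \<le> ?k w * A" for n
        unfolding real_norm_def abs_mult using A(2) by (intro AE_I2 mult_mono) auto
    qed auto
    ultimately show ?thesis by simp
  qed
  have k: "(LINT w|lborel. 2 * 1\<^sup>2 / ((cmod w)\<^sup>2 + 1\<^sup>2)\<^sup>2 * \<phi> \<zeta>) = 2 * pi * \<phi> \<zeta>"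
  proof -
    have "(LINT w|lborel. 2 * 1\<^sup>2 / ((cmod w)\<^sup>2 + 1\<^sup>2)\<^sup>2) = 2 * pi"
      using nn_integral_poisson_complex[of 1] by (subst integral_eq_nn_integral) auto
    then show ?thesis by (simp only: integral_mult_left_zero)
  qed
  show ?thesis
    using LIMSEQ_unique[OF lhs] rhs unfolding integral_reg_ln_laplacian[OF \<phi> e(1)] k by blast
qed

text \<open>Fubini with the fundamental solution; the bound that is uniform over \<zeta> in
  \<open>K\<close> gives integrability on the product. Where the logarithm is not integrable the
  inner integral takes a default value, but this is a null set of z.\<close>

lemma integral_potential_laplacian:
  assumes \<nu>: "\<nu> \<in> prob_measures_on K" and K: "compact K" and \<phi>: "test_function \<phi>"
  shows "(LINT z|lborel. (LINT \<zeta>|\<nu>. ln (cmod (z - \<zeta>))) * laplacian \<phi> z) = 2 * pi * (LINT \<zeta>|\<nu>. \<phi> \<zeta>)"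
proof -
  note [measurable_cong] = prob_measures_onD(2)[OF \<nu>]
  interpret prob_space \<nu> using prob_measures_onD(1)[OF \<nu>] .
  interpret P: pair_sigma_finite "lborel :: complex measure" \<nu> ..
  obtain r where r: "r > 0" "\<And>z. z \<notin> cball 0 r \<Longrightarrow> laplacian \<phi> z = 0"
    by (rule test_function_support[OF \<phi>]) blast
  obtain B where B: "B > 0" "\<And>z. \<bar>laplacian \<phi> z\<bar> \<le> B"
    using bounded_continuous_support[OF continuous_on_laplacian[OF \<phi>] r(2)] by auto
  obtain R where R: "K \<subseteq> cball 0 R" by (rule compact_subset_cball[OF K]) blast
  have [measurable]: "laplacian \<phi> \<in> borel_measurable borel"
    by (rule borel_measurable_continuous_onI[OF continuous_on_laplacian[OF \<phi>]])
  let ?f = "\<lambda>z \<zeta>. ln (cmod (z - \<zeta>)) * laplacian \<phi> z"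
  let ?c = "ennreal (B * (pi / 2)) + ennreal (B * (r + R) * (pi * r\<^sup>2))"
  have "integrable (lborel \<Otimes>\<^sub>M \<nu>) (\<lambda>(z, \<zeta>). ?f z \<zeta>)"
  proof (rule integrableI_bounded)
    have "(\<integral>\<^sup>+p. ennreal (norm (case p of (z, \<zeta>) \<Rightarrow> ?f z \<zeta>)) \<partial>(lborel \<Otimes>\<^sub>M \<nu>)) = (\<integral>\<^sup>+\<zeta>. (\<integral>\<^sup>+z. ennreal \<bar>?f z \<zeta>\<bar> \<partial>lborel) \<partial>\<nu>)"
      by (subst P.nn_integral_snd[symmetric]) auto
    also have "\<dots> \<le> (\<integral>\<^sup>+\<zeta>. ?c \<partial>\<nu>)"
    proof (rule nn_integral_mono_AE)
      show "AE \<zeta> in \<nu>. (\<integral>\<^sup>+z. ennreal \<bar>?f z \<zeta>\<bar> \<partial>lborel) \<le> ?c"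
        using AE_prob_measures_on[OF \<nu> compact_imp_closed[OF K]]
      proof eventually_elim
        case (elim \<zeta>)
        then have "cmod \<zeta> \<le> R" using R by fastforce
        then show ?case by (intro nn_integral_ln_bounded_support r(2) B(2)) (use r in auto)
      qed
    qed
    also have "\<dots> = ?c" by (simp add: emeasure_space_1)
    also have "\<dots> < \<infinity>" by simp
    finally show "(\<integral>\<^sup>+p. ennreal (norm (case p of (z, \<zeta>) \<Rightarrow> ?f z \<zeta>)) \<partial>(lborel \<Otimes>\<^sub>M \<nu>)) < \<infinity>" .
  qed measurable
  from P.Fubini_integral[OF this]
  have "(LINT z|lborel. LINT \<zeta>|\<nu>. ?f z \<zeta>) = (LINT \<zeta>|\<nu>. LINT z|lborel. ?f z \<zeta>)" by simp
  also have "\<dots> = (LINT \<zeta>|\<nu>. 2 * pi * \<phi> \<zeta>)" by (simp only: integral_ln_laplacian[OF \<phi>])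
  finally show ?thesis by simp
qed

section \<open>The Brolin measure\<close>

lemma exp_log_plus_bound: "log_plus x \<le> c \<Longrightarrow> x \<le> exp c"
proof (cases "x > 0")
  case True
  assume "log_plus x \<le> c"
  then have "exp (ln x) \<le> exp c" by (simp add: log_plus_def)
  then show ?thesis using True by simp
next
  case False
  then show ?thesis using exp_gt_zero[of c] by linarith
qed

section \<open>Iterated preimages of a point\<close>

primrec iterate_poly :: "complex poly \<Rightarrow> nat \<Rightarrow> complex poly" where
  "iterate_poly p 0 = [:0, 1:]"
| "iterate_poly p (Suc k) = pcompose p (iterate_poly p k)"

lemma poly_iterate_poly: "poly (iterate_poly p k) z = (poly p ^^ k) z"
  by (induction k) (auto simp: poly_pcompose)

lemma degree_iterate_poly: "degree (iterate_poly p k) = degree p ^ k"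
  by (induction k) (auto simp: degree_pcompose)

lemma lead_coeff_iterate_poly:
  assumes "lead_coeff p = 1" "degree p > 0"
  shows "lead_coeff (iterate_poly p k) = 1"
proof (induction k)
  case (Suc k)
  have "degree (iterate_poly p k) > 0" using assms(2) by (simp add: degree_iterate_poly)
  then show ?case unfolding iterate_poly.simps by (subst lead_coeff_comp) (use Suc assms(1) in auto)
qed simp

lemma preimages_list:
  fixes p :: "complex poly"
  assumes p: "lead_coeff p = 1" "degree p > 0"
  obtains ys where "length ys = degree p ^ k" "\<And>z. (poly p ^^ k) z - a = (\<Prod>i<length ys. z - ys ! i)"
proof -
  let ?q = "iterate_poly p k + [:- a:]"
  have deg: "degree [:- a:] < degree (iterate_poly p k)" using p(2) by (simp add: degree_iterate_poly)
  then have eq: "degree ?q = degree (iterate_poly p k)" by (rule degree_add_eq_left)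
  moreover have "lead_coeff ?q = 1"
    unfolding eq coeff_add using lead_coeff_iterate_poly[OF p, of k] coeff_eq_0[OF deg] by simp
  ultimately obtain ys where ys: "length ys = degree p ^ k" "?q = (\<Prod>j<length ys. [:- (ys ! j), 1:])"
    using monic_complex_poly_factorization[of ?q] by (metis degree_iterate_poly)
  have "(poly p ^^ k) z - a = (\<Prod>i<length ys. z - ys ! i)" for z
    using arg_cong[OF ys(2), of "\<lambda>q. poly q z"] by (simp add: poly_iterate_poly poly_prod)
  with that ys(1) show thesis by blast
qed

context escape_rate
begin

lemma dynamical_green_less: "dynamical_green p z \<le> log_plus (cmod z) + 2 * C" "log_plus (cmod z) \<le> dynamical_green p z + 2 * C"
  using dynamical_green_near_log_plus[of z] by linarith+

text \<open>Where the Green function is 0, the whole orbit satisfies log^+ \<le> 2C and stays in the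
  disc of radius exp(2C). The modulus of a exceeds this by 1, so the orbit keeps distance at least 1
  from a and the logarithm stays bounded. All other orbits escape, and a becomes negligible. Hence
  the limit holds at every z.\<close>

lemma ln_preimage_tendsto:
  fixes a :: complex
  assumes a: "cmod a = exp (2 * C) + 1"
  shows "(\<lambda>k. ln (cmod ((poly p ^^ k) z - a)) / d ^ k) \<longlonglongrightarrow> dynamical_green p z"
proof (cases "dynamical_green p z = 0")
  case True
  let ?c = "ln (2 * exp (2 * C) + 1)"
  have b: "\<bar>ln (cmod ((poly p ^^ k) z - a))\<bar> \<le> ?c" for k
  proof -
    have "dynamical_green p ((poly p ^^ k) z) = 0" using True by (simp add: dynamical_green_iterate)
    then have le: "cmod ((poly p ^^ k) z) \<le> exp (2 * C)"
      using dynamical_green_less(2)[of "(poly p ^^ k) z"] by (intro exp_log_plus_bound) simp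
    have "1 \<le> cmod ((poly p ^^ k) z - a)" using norm_triangle_ineq2[of a "(poly p ^^ k) z"] le a by (simp add: norm_minus_commute)
    moreover have "cmod ((poly p ^^ k) z - a) \<le> 2 * exp (2 * C) + 1" using norm_triangle_ineq4[of "(poly p ^^ k) z" a] le a by simp
    ultimately have "0 \<le> ln (cmod ((poly p ^^ k) z - a))" "ln (cmod ((poly p ^^ k) z - a)) \<le> ?c"
      by (simp, intro ln_mono, linarith+)
    then show ?thesis by simp
  qed
  have "(\<lambda>k. ln (cmod ((poly p ^^ k) z - a)) / d ^ k) \<longlonglongrightarrow> 0"
  proof (rule Lim_null_comparison)
    show "\<forall>\<^sub>F k in sequentially. norm (ln (cmod ((poly p ^^ k) z - a)) / d ^ k) \<le> ?c / d ^ k"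
      using b d by (intro always_eventually allI) (simp add: abs_divide divide_right_mono)
    show "(\<lambda>k. ?c / d ^ k) \<longlonglongrightarrow> 0" using d by real_asymp
  qed
  then show ?thesis using True by simp
next
  case False
  then have G: "dynamical_green p z > 0" using dynamical_green_nonneg[of z] by linarith
  let ?G = "dynamical_green p z"
  have a1: "cmod a > 1" unfolding a by simp
  have "filterlim (\<lambda>k. d ^ k * ?G - 2 * C) at_top sequentially" using d G by real_asymp
  then have ev: "\<forall>\<^sub>F k in sequentially. ln (2 * cmod a) < d ^ k * ?G - 2 * C" by (simp add: filterlim_at_top_dense)
  have "(\<lambda>k. ln (cmod ((poly p ^^ k) z - a)) / d ^ k - ?G) \<longlonglongrightarrow> 0"
  proof (rule Lim_null_comparison)
    \<comment> \<open>Here 2C is the error between d^k G and log^+ of the orbit point, and 1 bounds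
      the effect of subtracting a once the orbit point exceeds 2|a|.\<close>
    show "(\<lambda>k. (2 * C + 1) / d ^ k) \<longlonglongrightarrow> 0" using d by real_asymp
    show "\<forall>\<^sub>F k in sequentially. norm (ln (cmod ((poly p ^^ k) z - a)) / d ^ k - ?G) \<le> (2 * C + 1) / d ^ k"
      using ev
    proof eventually_elim
      case (elim k)
      let ?w = "(poly p ^^ k) z"
      have near: "\<bar>d ^ k * ?G - log_plus (cmod ?w)\<bar> \<le> 2 * C"
        using dynamical_green_near_log_plus[of ?w] by (simp add: dynamical_green_iterate)
      then have gt: "ln (2 * cmod a) < log_plus (cmod ?w)" using elim by linarith
      moreover have pos: "0 < ln (2 * cmod a)" by (rule ln_gt_zero) (use a1 in linarith)
      ultimately have lp: "log_plus (cmod ?w) = ln (cmod ?w)" "ln (cmod ?w) > ln (2 * cmod a)"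
        by (auto simp: log_plus_def max_def split: if_splits)
      have w0: "cmod ?w > 0" using lp(2) pos by (cases "?w = 0") auto
      then have w: "2 * cmod a < cmod ?w" using lp(2) a1 by (subst (asm) ln_less_cancel_iff) auto
      have "cmod ?w - cmod a \<le> cmod (?w - a)" by (rule norm_triangle_ineq2)
      then have "\<bar>ln (cmod (?w - a)) - ln (cmod ?w)\<bar> \<le> \<bar>cmod (?w - a) - cmod ?w\<bar> / (cmod ?w / 2)"
        using w w0 by (intro abs_ln_diff_le) auto
      also have "\<dots> \<le> cmod a / (cmod ?w / 2)"
        using norm_triangle_ineq3[of "?w - a" ?w] w0 by (intro divide_right_mono) auto
      also have "\<dots> \<le> 1" using w w0 by (simp add: divide_le_eq_1)
      finally have "\<bar>ln (cmod (?w - a)) - d ^ k * ?G\<bar> \<le> 2 * C + 1" using near lp(1) by linarith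
      then have "\<bar>ln (cmod (?w - a)) - d ^ k * ?G\<bar> / d ^ k \<le> (2 * C + 1) / d ^ k" using d by (intro divide_right_mono) auto
      moreover have "ln (cmod (?w - a)) / d ^ k - ?G = (ln (cmod (?w - a)) - d ^ k * ?G) / d ^ k" using d by (simp add: diff_divide_distrib)
      ultimately show ?case by (simp add: abs_divide)
    qed
  qed
  then show ?thesis by (simp add: LIM_zero_iff)
qed

text \<open>If the k-th iterate maps y to a, the Green function G satisfies G(y) \<le> d^k G(y) =
  G(a). One 2C passes from log^+|a| to G(a), another from G(y) to log^+|y|. The radius depends on C
  alone, so it serves a whole sequence of polynomials with a common C.\<close>

definition support_radius :: real where
  "support_radius = exp (log_plus (exp (2 * C) + 1) + 4 * C)"

lemma preimage_bound:
  assumes "cmod a = exp (2 * C) + 1" "(poly p ^^ k) y = a"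
  shows "cmod y \<le> support_radius"
proof -
  have "dynamical_green p y * 1 \<le> dynamical_green p y * d ^ k"
    using d dynamical_green_nonneg[of y] by (intro mult_left_mono one_le_power) auto
  also have "\<dots> = dynamical_green p a" using dynamical_green_iterate[of k y] assms(2) by (simp add: mult.commute)
  also have "\<dots> \<le> log_plus (exp (2 * C) + 1) + 2 * C" using dynamical_green_less(1)[of a] assms(1) by simp
  finally have "log_plus (cmod y) \<le> log_plus (exp (2 * C) + 1) + 4 * C" using dynamical_green_less(2)[of y] by simp
  then show ?thesis unfolding support_radius_def by (rule exp_log_plus_bound)
qed

text \<open>Truncating the potentials from below at $-M$ changes their integrals against a bounded
  function by $O(e^{-2M})$, uniformly over all probability measures; the truncated ones converge
  by dominated convergence.\<close>

lemma preimage_potentials_limit: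
  fixes h :: "complex \<Rightarrow> real" and ys :: "nat \<Rightarrow> complex list"
  assumes h: "h \<in> borel_measurable borel" "\<And>z. z \<notin> cball 0 r \<Longrightarrow> h z = 0" "\<And>z. \<bar>h z\<bar> \<le> B" and r: "r \<ge> 0" and B: "B > 0"
    and len: "\<And>k. ys k \<noteq> []" and \<rho>: "\<And>k. set (ys k) \<subseteq> cball 0 \<rho>"
    and lim: "\<And>z. (\<And>k. z \<notin> set (ys k)) \<Longrightarrow>
      (\<lambda>k. LINT \<zeta>|root_measure (ys k). ln (cmod (z - \<zeta>))) \<longlonglongrightarrow> dynamical_green p z"
  shows "(\<lambda>k. LINT z|lborel. (LINT \<zeta>|root_measure (ys k). ln (cmod (z - \<zeta>))) * h z)
    \<longlonglongrightarrow> (LINT z|lborel. dynamical_green p z * h z)"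
proof -
  note [measurable] = h(1)
  define U where "U k z = (\<Sum>i<length (ys k). ln (cmod (z - ys k ! i))) / length (ys k)" for k z
  have U: "(LINT \<zeta>|root_measure (ys k). ln (cmod (z - \<zeta>))) = U k z" for k z
    unfolding U_def by (rule integral_root_measure[OF len]) measurable
  have [measurable]: "U k \<in> borel_measurable borel" for k unfolding U_def by measurable
  have lpos: "real (length (ys k)) > 0" for k using len[of k] by simp
  have int_U: "integrable lborel (\<lambda>z. U k z * h z)" for k
  proof -
    have "integrable lborel (\<lambda>z. (\<Sum>i<length (ys k). ln (cmod (z - ys k ! i)) * h z) / length (ys k))"
      by (intro integrable_divide Bochner_Integration.integrable_sum integrable_ln_bounded_support[OF h r])
    then show ?thesis by (simp add: U_def sum_distrib_right)
  qed
  have null: "AE z in lborel. \<forall>k. z \<notin> set (ys k)"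
    unfolding AE_all_countable
  proof
    fix k
    show "AE z in lborel. z \<notin> set (ys k)"
      using finite_imp_null_set_lborel[OF finite_set[of "ys k"]] by (rule AE_not_in)
  qed
  have upper: "U k z \<le> r + \<rho>" if z: "z \<in> cball 0 r" for k z
  proof -
    have "(\<Sum>i<length (ys k). ln (cmod (z - ys k ! i))) \<le> (\<Sum>i<length (ys k). r + \<rho>)"
    proof (rule sum_mono)
      fix i assume "i \<in> {..<length (ys k)}"
      then have "cmod (ys k ! i) \<le> \<rho>" using \<rho>[of k] nth_mem by fastforce
      then have le: "cmod (z - ys k ! i) \<le> r + \<rho>" using z norm_triangle_ineq4[of z "ys k ! i"] by simp
      show "ln (cmod (z - ys k ! i)) \<le> r + \<rho>"
      proof (cases "z = ys k ! i")
        case True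
        then show ?thesis using le by simp
      next
        case False
        then show ?thesis using le ln_le_minus_one[of "cmod (z - ys k ! i)"] by simp
      qed
    qed
    then show ?thesis unfolding U_def using lpos[of k] by (simp add: pos_divide_le_eq mult.commute)
  qed
  define V where "V M k z = max (U k z) (- M)" for M k z
  have [measurable]: "V M k \<in> borel_measurable borel" for M k unfolding V_def by measurable
  have Vb: "\<bar>V M k z * h z\<bar> \<le> (M + \<bar>r + \<rho>\<bar>) * B * indicator (cball 0 r) z" if "M \<ge> 0" for M k z
  proof (cases "z \<in> cball 0 r")
    case True
    have "\<bar>V M k z\<bar> \<le> M + \<bar>r + \<rho>\<bar>" using upper[OF True, of k] that unfolding V_def by linarith
    then show ?thesis using True h(3) that unfolding abs_mult by (auto intro!: mult_mono)
  qed (use h(2) in auto)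
  have int_ind: "integrable lborel (\<lambda>z. c * indicator (cball (0::complex) r) z :: real)" for c
    using emeasure_lborel_cball_finite[of 0 r] by (intro integrable_mult_right) (simp add: integrable_indicator_iff)
  have int_V: "integrable lborel (\<lambda>z. V M k z * h z)" if "M \<ge> 0" for M k
  proof (rule Bochner_Integration.integrable_bound[OF int_ind[of "(M + \<bar>r + \<rho>\<bar>) * B"]])
    show "AE z in lborel. norm (V M k z * h z) \<le> norm ((M + \<bar>r + \<rho>\<bar>) * B * indicator (cball 0 r) z)"
      unfolding real_norm_def by (rule AE_I2, rule order_trans[OF Vb[OF that] abs_ge_self])
  qed measurable
  \<comment> \<open>The truncation error of an average is at most the average of the truncation
    errors, and each of these has integral pi/2 exp(-2M) wherever its pole lies.\<close>
  have err: "\<bar>(LINT z|lborel. U k z * h z) - (LINT z|lborel. V M k z * h z)\<bar> \<le> B * (pi / 2 * exp (- 2 * M))" if M: "M \<ge> 0" for M k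
  proof -
    let ?t = "\<lambda>i z. max 0 (- M - ln (cmod (z - ys k ! i)))"
    have it: "integrable lborel (?t i)" for i
      using nn_integral_log_tail_translate[of M "ys k ! i"] by (intro integrableI_nonneg) auto
    have tail: "(LINT z|lborel. ?t i z) = pi / 2 * exp (- 2 * M)" for i
      using nn_integral_log_tail_translate[of M "ys k ! i"] by (subst integral_eq_nn_integral) auto
    have pw: "\<bar>U k z * h z - V M k z * h z\<bar> \<le> (\<Sum>i<length (ys k). ?t i z) / length (ys k) * B" for z
    proof -
      have "(\<Sum>i<length (ys k). - M - ln (cmod (z - ys k ! i))) / length (ys k) \<le> (\<Sum>i<length (ys k). ?t i z) / length (ys k)"
        by (intro divide_right_mono sum_mono) auto
      moreover have "(\<Sum>i<length (ys k). - M - ln (cmod (z - ys k ! i))) / length (ys k) = - M - U k z"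
        using lpos[of k] by (simp add: U_def sum_subtractf diff_divide_distrib)
      moreover have "0 \<le> (\<Sum>i<length (ys k). ?t i z) / length (ys k)" by (intro divide_nonneg_nonneg sum_nonneg) auto
      ultimately have "\<bar>U k z - V M k z\<bar> \<le> (\<Sum>i<length (ys k). ?t i z) / length (ys k)"
        unfolding V_def by linarith
      then have "\<bar>U k z - V M k z\<bar> * \<bar>h z\<bar> \<le> (\<Sum>i<length (ys k). ?t i z) / length (ys k) * B"
        using h(3) by (intro mult_mono) (auto intro: order_trans[OF abs_ge_zero])
      then show ?thesis by (simp add: abs_mult flip: left_diff_distrib)
    qed
    have "\<bar>LINT z|lborel. U k z * h z - V M k z * h z\<bar> \<le> (LINT z|lborel. \<bar>U k z * h z - V M k z * h z\<bar>)" by (rule integral_abs_bound)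
    also have "\<dots> \<le> (LINT z|lborel. (\<Sum>i<length (ys k). ?t i z) / length (ys k) * B)"
    proof (rule integral_mono)
      show "integrable lborel (\<lambda>z. \<bar>U k z * h z - V M k z * h z\<bar>)"
        by (intro integrable_abs Bochner_Integration.integrable_diff int_U int_V[OF M])
      show "integrable lborel (\<lambda>z. (\<Sum>i<length (ys k). ?t i z) / length (ys k) * B)"
        by (intro integrable_mult_left integrable_divide Bochner_Integration.integrable_sum it)
    qed (rule pw)
    also have "\<dots> = (\<Sum>i<length (ys k). LINT z|lborel. ?t i z) / length (ys k) * B"
      by (simp only: integral_mult_left_zero integral_divide_zero Bochner_Integration.integral_sum[OF it])
    also have "\<dots> = B * (pi / 2 * exp (- 2 * M))" unfolding tail using lpos[of k] by simp
    finally show ?thesis using int_U int_V[OF M] by simp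
  qed
  have V_lim: "(\<lambda>k. LINT z|lborel. V M k z * h z) \<longlonglongrightarrow> (LINT z|lborel. dynamical_green p z * h z)" if M: "M \<ge> 0" for M
  proof (rule integral_dominated_convergence[OF _ _ int_ind[of "(M + \<bar>r + \<rho>\<bar>) * B"]])
    show "AE z in lborel. (\<lambda>k. V M k z * h z) \<longlonglongrightarrow> dynamical_green p z * h z"
      using null
    proof eventually_elim
      case (elim z)
      have "(\<lambda>k. max (U k z) (- M)) \<longlonglongrightarrow> max (dynamical_green p z) (- M)"
        using lim[of z] elim unfolding U by (intro tendsto_max tendsto_const) auto
      \<comment> \<open>The Green function is nonnegative, so truncation at -M leaves the limit
        unchanged.\<close>
      moreover have "max (dynamical_green p z) (- M) = dynamical_green p z"
        using dynamical_green_nonneg[of z] M by simp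
      ultimately show ?case unfolding V_def by (intro tendsto_mult tendsto_const) simp
    qed
  qed (use Vb[OF M] in auto)
  show ?thesis
    unfolding U
  proof (rule LIMSEQ_I)
    fix e :: real assume e: "e > 0"
    have "(\<lambda>M. B * (pi / 2 * exp (- 2 * real M))) \<longlonglongrightarrow> 0" by real_asymp
    from order_tendstoD(2)[OF this, of "e / 2"] e obtain M :: nat where M: "B * (pi / 2 * exp (- 2 * real M)) < e / 2"
      by (auto simp: eventually_sequentially)
    have "\<forall>\<^sub>F k in sequentially. dist (LINT z|lborel. V (real M) k z * h z) (LINT z|lborel. dynamical_green p z * h z) < e / 2"
      using V_lim[of "real M"] e by (intro tendstoD) auto
    then obtain k0 where k0: "\<And>k. k \<ge> k0 \<Longrightarrow> dist (LINT z|lborel. V (real M) k z * h z) (LINT z|lborel. dynamical_green p z * h z) < e / 2"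
      unfolding eventually_sequentially by blast
    have "norm ((LINT z|lborel. U k z * h z) - (LINT z|lborel. dynamical_green p z * h z)) < e" if "k \<ge> k0" for k
      using k0[OF that] err[of "real M" k] M unfolding dist_real_def real_norm_def by linarith
    then show "\<exists>k0. \<forall>k\<ge>k0. norm ((LINT z|lborel. U k z * h z) - (LINT z|lborel. dynamical_green p z * h z)) < e" by blast
  qed
qed

text \<open>Brolin's construction: the solutions of "k-th iterate = a", with multiplicity, carry
  uniform measures whose potentials ln|p^k(z) - a| / d^k tend to the Green function. Laplacians
  identify every weak limit, so a convergent subsequence of measures is enough.\<close>

lemma brolin_measure_exists:
  assumes monic: "lead_coeff p = 1"
  shows "\<exists>\<omega>\<in>prob_measures_on (cball 0 support_radius). \<forall>\<phi>. test_function \<phi> \<longrightarrow>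
    (LINT z|\<omega>. \<phi> z) = (LINT z|lborel. dynamical_green p z * laplacian \<phi> z) / (2 * pi)"
proof -
  define a where "a = complex_of_real (exp (2 * C) + 1)"
  have a: "cmod a = exp (2 * C) + 1" unfolding a_def norm_of_real by (simp add: add_pos_pos less_imp_le)
  have dp: "degree p > 0" using degree by simp
  have "\<exists>ys. length ys = degree p ^ k \<and> (\<forall>z. (poly p ^^ k) z - a = (\<Prod>i<length ys. z - ys ! i))" for k
    by (rule preimages_list[OF monic dp, of k a]) blast
  then obtain ys where ys: "\<And>k. length (ys k) = degree p ^ k"
    "\<And>k z. (poly p ^^ k) z - a = (\<Prod>i<length (ys k). z - ys k ! i)" by metis
  have ne: "ys k \<noteq> []" for k using ys(1)[of k] dp by (metis length_0_conv power_eq_0_iff less_irrefl)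
  have sub: "set (ys k) \<subseteq> cball 0 support_radius" for k
  proof
    fix y assume "y \<in> set (ys k)"
    then have 0: "(\<Prod>i<length (ys k). y - ys k ! i) = 0" by (auto simp: in_set_conv_nth)
    have "(poly p ^^ k) y - a = 0" unfolding ys(2) 0 ..
    then have "(poly p ^^ k) y = a" by simp
    then show "y \<in> cball 0 support_radius" using preimage_bound[OF a] by simp
  qed
  have on: "root_measure (ys k) \<in> prob_measures_on (cball 0 support_radius)" for k
    by (rule root_measure_in_prob_measures_on[OF ne sub]) simp
  have lim: "(\<lambda>k. LINT \<zeta>|root_measure (ys k). ln (cmod (z - \<zeta>))) \<longlonglongrightarrow> dynamical_green p z"
    if z: "\<And>k. z \<notin> set (ys k)" for z
  proof -
    have "(LINT \<zeta>|root_measure (ys k). ln (cmod (z - \<zeta>))) = ln (cmod ((poly p ^^ k) z - a)) / d ^ k" for k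
    proof -
      have "ln (cmod ((poly p ^^ k) z - a)) = (\<Sum>i<length (ys k). ln (cmod (z - ys k ! i)))"
        unfolding ys(2) prod_norm[symmetric] using z[of k] nth_mem by (intro ln_prod) fastforce+
      then show ?thesis
        using ys(1)[of k] by (subst integral_root_measure[OF ne]) auto
    qed
    then show ?thesis using ln_preimage_tendsto[OF a] by simp
  qed
  obtain s \<omega> where s: "strict_mono s" "\<omega> \<in> prob_measures_on (cball 0 support_radius)" "weak_limit ((\<lambda>k. root_measure (ys k)) \<circ> s) \<omega>"
    by (rule weak_compactness[OF compact_cball, of "\<lambda>k. root_measure (ys k)"]) (use on in blast)+
  have "(LINT z|\<omega>. \<phi> z) = (LINT z|lborel. dynamical_green p z * laplacian \<phi> z) / (2 * pi)" if \<phi>: "test_function \<phi>" for \<phi>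
  proof (rule LIMSEQ_unique)
    show "(\<lambda>k. LINT z|root_measure (ys (s k)). \<phi> z) \<longlonglongrightarrow> (LINT z|\<omega>. \<phi> z)"
      using s(3) test_function_continuous[OF \<phi>] unfolding weak_limit_def comp_def by blast
    obtain r where r: "r > 0" "\<And>z. z \<notin> cball 0 r \<Longrightarrow> laplacian \<phi> z = 0"
      by (rule test_function_support[OF \<phi>]) blast
    obtain B where B: "B > 0" "\<And>z. \<bar>laplacian \<phi> z\<bar> \<le> B"
      using bounded_continuous_support[OF continuous_on_laplacian[OF \<phi>] r(2)] by auto
    have "(\<lambda>k. (LINT z|lborel. (LINT \<zeta>|root_measure (ys k). ln (cmod (z - \<zeta>))) * laplacian \<phi> z) / (2 * pi))
       \<longlonglongrightarrow> (LINT z|lborel. dynamical_green p z * laplacian \<phi> z) / (2 * pi)"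
    proof (intro tendsto_divide tendsto_const preimage_potentials_limit[OF _ r(2) B(2) _ B(1) ne sub lim])
      show "laplacian \<phi> \<in> borel_measurable borel" by (rule borel_measurable_continuous_onI[OF continuous_on_laplacian[OF \<phi>]])
    qed (use r in auto)
    then have "(\<lambda>k. LINT z|root_measure (ys k). \<phi> z) \<longlonglongrightarrow> (LINT z|lborel. dynamical_green p z * laplacian \<phi> z) / (2 * pi)"
      by (simp add: integral_potential_laplacian[OF on compact_cball \<phi>])
    from LIMSEQ_subseq_LIMSEQ[OF this s(1)]
    show "(\<lambda>k. LINT z|root_measure (ys (s k)). \<phi> z) \<longlonglongrightarrow> (LINT z|lborel. dynamical_green p z * laplacian \<phi> z) / (2 * pi)"
      by (simp add: comp_def)
  qed
  then show ?thesis using s(2) by blast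
qed

lemma brolin_measure:
  assumes monic: "lead_coeff p = 1"
  shows "brolin_measure p \<in> prob_measures_on (cball 0 support_radius)"
    and "test_function \<phi> \<Longrightarrow> (LINT z|brolin_measure p. \<phi> z) = (LINT z|lborel. dynamical_green p z * laplacian \<phi> z) / (2 * pi)"
proof -
  obtain \<omega> where \<omega>: "\<omega> \<in> prob_measures_on (cball 0 support_radius)"
    "\<And>\<phi>. test_function \<phi> \<Longrightarrow> (LINT z|\<omega>. \<phi> z) = (LINT z|lborel. dynamical_green p z * laplacian \<phi> z) / (2 * pi)"
    using brolin_measure_exists[OF monic] by blast
  have "brolin_measure p = \<omega>"
    unfolding brolin_measure_def
  proof (rule the_equality)
    show "sets \<omega> = sets borel \<and> prob_space \<omega> \<and> (\<forall>\<phi>. test_function \<phi> \<longrightarrow>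
      (LINT z|\<omega>. \<phi> z) = (LINT z|lborel. dynamical_green p z * laplacian \<phi> z) / (2 * pi))"
      using \<omega>(2) prob_measures_onD(1,2)[OF \<omega>(1)] by blast
    fix \<omega>' assume *: "sets \<omega>' = sets borel \<and> prob_space \<omega>' \<and> (\<forall>\<phi>. test_function \<phi> \<longrightarrow>
      (LINT z|\<omega>'. \<phi> z) = (LINT z|lborel. dynamical_green p z * laplacian \<phi> z) / (2 * pi))"
    show "\<omega>' = \<omega>"
      by (rule measure_eqI_test_function) (use * \<omega>(2) prob_measures_onD(1,2)[OF \<omega>(1)] in auto)
  qed
  then show "brolin_measure p \<in> prob_measures_on (cball 0 support_radius)"
    "test_function \<phi> \<Longrightarrow> (LINT z|brolin_measure p. \<phi> z) = (LINT z|lborel. dynamical_green p z * laplacian \<phi> z) / (2 * pi)"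
    using \<omega> by auto
qed

end

section \<open>The main theorem\<close>

lemma Linf_norm_le:
  assumes "f \<in> borel_measurable borel" "\<And>z. \<bar>f z\<bar> \<le> e"
  shows "Linf_norm f \<le> ereal e"
  unfolding Linf_norm_def using assms by (intro esssup_I) auto

lemma Linf_norm_nonneg: "0 \<le> Linf_norm f"
proof (rule ccontr)
  assume neg: "\<not> 0 \<le> Linf_norm f"
  have "AE z in lborel. ereal \<bar>f z\<bar> \<le> Linf_norm f" unfolding Linf_norm_def by (rule esssup_AE)
  then have "AE z in (lborel :: complex measure). False"
  proof eventually_elim
    case (elim z)
    then have "0 \<le> Linf_norm f" using order_trans[of 0 "ereal \<bar>f z\<bar>"] by simp
    then show ?case using neg by simp
  qed
  then have "emeasure lborel (UNIV :: complex set) = 0" by (subst (asm) AE_iff_measurable[of UNIV]) auto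
  then show False by simp
qed

lemma Linf_norm_tendsto_0:
  assumes "\<And>n. n \<ge> N \<Longrightarrow> F n \<in> borel_measurable borel"
    and "\<And>e. e > 0 \<Longrightarrow> \<forall>\<^sub>F n in sequentially. \<forall>z. \<bar>F n z\<bar> \<le> e"
  shows "(\<lambda>n. Linf_norm (F n)) \<longlonglongrightarrow> 0"
proof (rule order_tendstoI)
  fix a :: ereal assume "a < 0"
  then show "\<forall>\<^sub>F n in sequentially. a < Linf_norm (F n)"
    by (intro always_eventually allI) (rule less_le_trans[OF _ Linf_norm_nonneg])
next
  fix a :: ereal assume "0 < a"
  then obtain e where e: "0 < ereal e" "ereal e < a" using ereal_dense2 by blast
  from assms(2)[of e] e(1) have "\<forall>\<^sub>F n in sequentially. \<forall>z. \<bar>F n z\<bar> \<le> e" by simp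
  with eventually_ge_at_top[of N] show "\<forall>\<^sub>F n in sequentially. Linf_norm (F n) < a"
  proof eventually_elim
    case (elim n)
    then have "Linf_norm (F n) \<le> ereal e" by (intro Linf_norm_le assms(1)) auto
    then show ?case using e(2) by (rule order_le_less_trans)
  qed
qed

text \<open>The common disc provides weakly convergent subsequences. Against a test function the
  Laplacian sits on the smooth side, so uniform convergence of the potentials identifies the limit
  with \<mu> on test functions. These determine a measure, which upgrades the convergence to all
  continuous functions.\<close>

lemma weak_star_tendsto_of_potentials:
  fixes \<omega> :: "nat \<Rightarrow> complex measure" and G :: "nat \<Rightarrow> complex \<Rightarrow> real"
  assumes \<omega>: "\<And>n. \<omega> n \<in> prob_measures_on (cball 0 \<rho>)"
    and \<mu>: "\<mu> \<in> prob_measures_on K" "compact K"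
    and G: "\<And>n. G n \<in> borel_measurable borel" and g: "continuous_on UNIV g"
    and pot: "\<And>\<phi> n. test_function \<phi> \<Longrightarrow> (LINT z|\<omega> n. \<phi> z) = (LINT z|lborel. G n z * laplacian \<phi> z) / (2 * pi)"
    and g_def: "\<And>z. g z = (LINT \<zeta>|\<mu>. ln (cmod (z - \<zeta>)))"
    and lim: "\<And>e. e > 0 \<Longrightarrow> \<forall>\<^sub>F n in sequentially. \<forall>z. \<bar>G n z - g z\<bar> \<le> e"
  shows "weak_star_tendsto \<omega> \<mu> sequentially"
  unfolding weak_star_tendsto_def
proof (intro allI impI LIMSEQ_subsequence_principle)
  fix f :: "complex \<Rightarrow> real" and s :: "nat \<Rightarrow> nat"
  assume f: "continuous_on UNIV f \<and> bounded (range f)" and s: "strict_mono s"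
  obtain r \<kappa> where r: "strict_mono r" "\<kappa> \<in> prob_measures_on (cball 0 \<rho>)" "weak_limit ((\<lambda>k. \<omega> (s k)) \<circ> r) \<kappa>"
    by (rule weak_compactness[OF compact_cball, of "\<lambda>k. \<omega> (s k)"]) (use \<omega> in blast)+
  have sr: "strict_mono (\<lambda>k. s (r k))" using s r(1) by (simp add: strict_mono_def)
  have test: "(LINT z|\<kappa>. \<phi> z) = (LINT z|\<mu>. \<phi> z)" if \<phi>: "test_function \<phi>" for \<phi>
  proof (rule LIMSEQ_unique)
    show "(\<lambda>k. LINT z|\<omega> (s (r k)). \<phi> z) \<longlonglongrightarrow> (LINT z|\<kappa>. \<phi> z)"
      using r(3) test_function_continuous[OF \<phi>] unfolding weak_limit_def comp_def by blast
    obtain R where R: "R > 0" "\<And>z. z \<notin> cball 0 R \<Longrightarrow> laplacian \<phi> z = 0"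
      by (rule test_function_support[OF \<phi>]) blast
    note lc = continuous_on_laplacian[OF \<phi>]
    have [measurable]: "laplacian \<phi> \<in> borel_measurable borel" "g \<in> borel_measurable borel"
      using lc g by (auto intro: borel_measurable_continuous_onI)
    note [measurable] = G
    let ?w = "\<lambda>z. (\<bar>g z\<bar> + 1) * \<bar>laplacian \<phi> z\<bar>"
    have "(\<lambda>k. LINT z|lborel. G (s (r k)) z * laplacian \<phi> z) \<longlonglongrightarrow> (LINT z|lborel. g z * laplacian \<phi> z)"
    proof -
      have "\<forall>\<^sub>F n in sequentially. \<forall>z. \<bar>G n z - g z\<bar> \<le> 1" by (rule lim) simp
      then obtain N where N: "\<And>n z. n \<ge> N \<Longrightarrow> \<bar>G n z - g z\<bar> \<le> 1" unfolding eventually_sequentially by blast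
      \<comment> \<open>The shift by \<open>N\<close> drops the indices at which \<open>G n\<close>
        may not yet be within 1 of \<open>g\<close>; only afterwards is the majorant
        \<open>?w\<close> assured.\<close>
      have "(\<lambda>k. LINT z|lborel. G (s (r (k + N))) z * laplacian \<phi> z) \<longlonglongrightarrow> (LINT z|lborel. g z * laplacian \<phi> z)"
      proof (rule integral_dominated_convergence[where w = ?w])
        have c: "continuous_on UNIV ?w" by (intro continuous_intros g lc)
        have z: "?w z = 0" if "z \<notin> cball 0 R" for z using R(2)[OF that] by simp
        obtain b where "\<And>z. \<bar>?w z\<bar> \<le> b" using bounded_continuous_support[OF c z] by auto
        then show "integrable lborel ?w" by (intro integrable_bounded_support[OF borel_measurable_continuous_onI[OF c] z])
        show "AE z in lborel. (\<lambda>k. G (s (r (k + N))) z * laplacian \<phi> z) \<longlonglongrightarrow> g z * laplacian \<phi> z"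
        proof (rule AE_I2)
          fix z
          have "(\<lambda>n. G n z) \<longlonglongrightarrow> g z"
          proof (rule LIMSEQ_I)
            fix e :: real assume e: "e > 0"
            then have "\<forall>\<^sub>F n in sequentially. \<forall>z. \<bar>G n z - g z\<bar> \<le> e / 2" by (intro lim) simp
            then obtain M where M: "\<And>n z. n \<ge> M \<Longrightarrow> \<bar>G n z - g z\<bar> \<le> e / 2" unfolding eventually_sequentially by blast
            have "norm (G n z - g z) < e" if "n \<ge> M" for n using M[OF that, of z] e by simp
            then show "\<exists>M. \<forall>n\<ge>M. norm (G n z - g z) < e" by blast
          qed
          from LIMSEQ_ignore_initial_segment[OF LIMSEQ_subseq_LIMSEQ[OF this sr], of N]
          show "(\<lambda>k. G (s (r (k + N))) z * laplacian \<phi> z) \<longlonglongrightarrow> g z * laplacian \<phi> z"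
            by (intro tendsto_mult tendsto_const) (simp add: comp_def)
        qed
        show "AE z in lborel. norm (G (s (r (k + N))) z * laplacian \<phi> z) \<le> ?w z" for k
        proof (rule AE_I2)
          fix z
          have "N \<le> s (r (k + N))" using seq_suble[OF sr, of "k + N"] by simp
          from N[OF this, of z] have "\<bar>G (s (r (k + N))) z\<bar> \<le> \<bar>g z\<bar> + 1" by linarith
          then show "norm (G (s (r (k + N))) z * laplacian \<phi> z) \<le> ?w z"
            unfolding real_norm_def abs_mult by (intro mult_right_mono) auto
        qed
      qed measurable
      then show ?thesis by (rule LIMSEQ_offset)
    qed
    then have "(\<lambda>k. (LINT z|lborel. G (s (r k)) z * laplacian \<phi> z) / (2 * pi)) \<longlonglongrightarrow> (LINT z|lborel. g z * laplacian \<phi> z) / (2 * pi)"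
      by (intro tendsto_divide tendsto_const) auto
    then show "(\<lambda>k. LINT z|\<omega> (s (r k)). \<phi> z) \<longlonglongrightarrow> (LINT z|\<mu>. \<phi> z)"
      unfolding pot[OF \<phi>] g_def integral_potential_laplacian[OF \<mu> \<phi>] by simp
  qed
  have "\<kappa> = \<mu>"
    by (rule measure_eqI_test_function[OF _ _ _ _ test]) (use prob_measures_onD(1,2)[OF r(2)] prob_measures_onD(1,2)[OF \<mu>(1)] in auto)
  then show "\<exists>r. strict_mono r \<and> (\<lambda>k. LINT z|\<omega> (s (r k)). f z) \<longlonglongrightarrow> (LINT z|\<mu>. f z)"
    using r(1,3) f unfolding weak_limit_def comp_def by blast
qed

theorem theorem2:
  fixes E :: "complex set" and \<alpha> :: "nat \<Rightarrow> complex" and P :: "nat \<Rightarrow> int poly"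
  assumes "compact E"
    and "cnj ` E = E"
    and "dirichlet_regular E"
    and "log_capacity E = 1"
    and "inj \<alpha>"
    and "\<And>n. algebraic_int (\<alpha> n)"
    and "\<And>n. is_minimal_int_poly (P n) (\<alpha> n)"
    and "(\<lambda>n. max_dist (complex_roots (P n)) E) \<longlonglongrightarrow> 0"
  shows "((\<lambda>n. Linf_norm (\<lambda>z. dynamical_green (map_poly of_int (P n)) z - green_function E z))
            \<longlongrightarrow> 0) (along_nonlinear P)
       \<and> weak_star_tendsto (\<lambda>n. brolin_measure (map_poly of_int (P n))) (equilibrium_measure E)
            (along_nonlinear P)"
proof -
  let ?p = "\<lambda>n. map_poly of_int (P n) :: complex poly" and ?\<delta> = "\<lambda>n. max_dist (complex_roots (P n)) E"
  let ?\<mu> = "equilibrium_measure E" and ?g = "green_function E"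
  note E = \<open>compact E\<close> and min = assms(7)
  have V: "min_log_energy E = ereal 0"
    using min_log_energy_log_capacity[OF E assms(4)] by (simp add: zero_ereal_def)
  note \<mu> = equilibrium_measure_minimizes(1)[OF E V]
  have E0: "E \<noteq> {}" using prob_measures_onD(4)[OF \<mu>] by auto
  have green_eq: "?g z = (LINT \<zeta>|?\<mu>. ln (cmod (z - \<zeta>)))" for z
    by (simp add: green_function_def assms(4))
  have g_zero: "?g z = 0" if "z \<in> E" for z
  proof -
    have "z \<in> - outside E" using that outside_no_overlap[of E] by blast
    then show ?thesis using assms(3) unfolding dirichlet_regular_def poly_convex_hull_def by blast
  qed
  have g_cont: "continuous_on UNIV ?g" using assms(3) by (simp add: dirichlet_regular_def)
  obtain R0 where R0: "R0 \<ge> 1" "E \<subseteq> cball 0 R0" by (rule compact_subset_cball[OF E]) blast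
  \<comment> \<open>Room for the roots, which eventually lie within distance 1 of
    \<open>E\<close>.\<close>
  define R where "R = R0 + 1"
  have R: "R \<ge> 1" "E \<subseteq> cball 0 R" using R0 by (auto simp: R_def)
  have fin: "finite (complex_roots (P n))" for n
    using min[of n] unfolding complex_roots_def by (intro poly_roots_finite) (auto simp: is_minimal_int_poly_def)
  have near: "infdist \<zeta> E \<le> ?\<delta> n" if "\<zeta> \<in> complex_roots (P n)" for n \<zeta>
    unfolding max_dist_def using that fin[of n] by (intro Max_ge) auto
  have "\<forall>\<^sub>F n in sequentially. ?\<delta> n < 1" using assms(8) by (rule order_tendstoD) simp
  then obtain N0 where N0: "\<And>n. n \<ge> N0 \<Longrightarrow> ?\<delta> n < 1" unfolding eventually_sequentially by blast
  have rootsR: "complex_roots (P n) \<subseteq> cball 0 R" if "n \<ge> N0" for n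
  proof
    fix \<zeta> assume \<zeta>: "\<zeta> \<in> complex_roots (P n)"
    obtain x where x: "x \<in> E" "infdist \<zeta> E = dist \<zeta> x" using infdist_attains_inf[OF compact_imp_closed[OF E] E0] by blast
    have "dist \<zeta> x < 1" using near[OF \<zeta>] N0[OF that] x(2) by linarith
    moreover have "norm x \<le> R0" using x(1) R0 by auto
    ultimately show "\<zeta> \<in> cball 0 R" using norm_triangle_sub[of \<zeta> x] by (simp add: R_def dist_norm)
  qed
  have deg_top: "filterlim (\<lambda>n. degree (P n)) at_top sequentially"
    by (rule degree_minimal_int_poly_at_top[OF assms(5) min _ rootsR]) (use R in auto)
  then have "\<forall>\<^sub>F n in sequentially. 2 \<le> degree (P n)" by (simp add: filterlim_at_top)
  then obtain N1 where N1: "\<And>n. n \<ge> N1 \<Longrightarrow> 2 \<le> degree (P n)" unfolding eventually_sequentially by blast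
  \<comment> \<open>The hypotheses of \<open>equidistribution\<close> are required at every index,
    so the sequence is shifted past the finitely many exceptions.\<close>
  define N where "N = max N0 N1"
  have N: "N0 \<le> n + N" "N1 \<le> n + N" for n by (auto simp: N_def max_def)
  have "\<exists>xs. length xs = degree (P n) \<and> distinct xs \<and> set xs = complex_roots (P n) \<and> ?p n = (\<Prod>j<length xs. [:- (xs ! j), 1:])" for n
    by (rule minimal_int_poly_roots[OF min[of n]]) blast
  then obtain xs where xs: "\<And>n. length (xs n) = degree (P n)" "\<And>n. distinct (xs n)" "\<And>n. set (xs n) = complex_roots (P n)"
    "\<And>n. ?p n = (\<Prod>j<length (xs n). [:- (xs n ! j), 1:])" by metis
  interpret equidistribution E "\<lambda>n. xs (n + N)" R "\<lambda>n. ?\<delta> (n + N)"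
  proof
    show "xs (n + N) \<noteq> []" for n using xs(1)[of "n + N"] N1[OF N(2)[of n]] by auto
    show "set (xs (n + N)) \<subseteq> cball 0 R" for n unfolding xs(3) by (rule rootsR[OF N(1)])
    show "filterlim (\<lambda>n. length (xs (n + N))) at_top sequentially"
      unfolding xs(1) by (rule filterlim_compose[OF deg_top filterlim_add_const_nat_at_top])
    show "0 \<le> (\<Sum>i<length (xs (n + N)). \<Sum>j\<in>{..<length (xs (n + N))} - {i}. ln (cmod (xs (n + N) ! i - xs (n + N) ! j)))" for n
      by (rule sum_ln_root_distances_nonneg[OF _ xs(4,2)]) (use min[of "n + N"] in \<open>simp add: is_minimal_int_poly_def\<close>)
    show "infdist \<zeta> E \<le> ?\<delta> (n + N)" if "\<zeta> \<in> set (xs (n + N))" for n \<zeta> using near that unfolding xs(3) by blast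
    show "(\<lambda>n. ?\<delta> (n + N)) \<longlonglongrightarrow> 0" using assms(8) by (rule LIMSEQ_ignore_initial_segment)
    show "continuous_on UNIV (\<lambda>z. LINT \<zeta>|?\<mu>. ln (cmod (z - \<zeta>)))" using g_cont unfolding green_eq[abs_def] .
    show "(LINT \<zeta>|?\<mu>. ln (cmod (z - \<zeta>))) = 0" if "z \<in> E" for z using g_zero[OF that] unfolding green_eq .
  qed (use E V R xs(2) in auto)
  have g: "g = ?g" unfolding g_def[abs_def] green_eq[abs_def] ..
  have f: "f n z = log_plus (cmod (poly (?p (n + N)) z)) / degree (?p (n + N))" for n z
  proof -
    have "poly (?p (n + N)) z = (\<Prod>i<length (xs (n + N)). z - xs (n + N) ! i)" unfolding xs(4) poly_prod by simp
    then show ?thesis unfolding f_def by (simp add: xs(1))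
  qed
  obtain C0 where C0: "\<And>z. \<bar>g z - log_plus (cmod z)\<bar> \<le> C0" using g_near_log_plus by blast
  \<comment> \<open>\<open>C0\<close> bounds |g - log^+| and the added 1 bounds |f - g| from index
    \<open>N2\<close> on; neither depends on n.\<close>
  define C where "C = \<bar>C0\<bar> + 1"
  obtain N2 where N2: "\<And>n z. n \<ge> N2 \<Longrightarrow> \<bar>f n z - g z\<bar> \<le> 1"
    using f_uniform_limit[of 1] unfolding eventually_sequentially by auto
  \<comment> \<open>Index n of \<open>f\<close> belongs to \<open>P (n + N)\<close>, so starting
    \<open>f\<close> at \<open>N2\<close> means starting \<open>P\<close> at
    \<open>N2 + N\<close>.\<close>
  define M where "M = N2 + N"
  have deg2: "degree (?p (n + M)) \<ge> 2" for n using N1[OF N(2)[of "n + N2"]] by (simp add: M_def add.assoc)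
  have escape: "escape_rate (?p (n + M)) C" for n
  proof
    show "2 \<le> degree (?p (n + M))" by (rule deg2)
    show "C \<ge> 0" by (simp add: C_def)
    show "\<bar>log_plus (cmod (poly (?p (n + M)) w)) / degree (?p (n + M)) - log_plus (cmod w)\<bar> \<le> C" for w
      using N2[of "n + N2" w] C0[of w] unfolding f C_def M_def add.assoc by linarith
  qed
  have monic: "lead_coeff (?p n) = 1" for n using min[of n] by (simp add: is_minimal_int_poly_def)
  define G where "G n = dynamical_green (?p (n + M))" for n
  have G_meas: "G n \<in> borel_measurable borel" for n
    unfolding G_def by (rule escape_rate.borel_measurable_dynamical_green[OF escape])
  have G_lim: "\<forall>\<^sub>F n in sequentially. \<forall>z. \<bar>G n z - ?g z\<bar> \<le> e" if e: "e > 0" for e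
  proof -
    have "\<forall>\<^sub>F n in sequentially. \<forall>z. \<bar>f n z - g z\<bar> \<le> e / 2" using e by (intro f_uniform_limit) simp
    then have 1: "\<forall>\<^sub>F n in sequentially. \<forall>z. \<bar>f (n + N2) z - g z\<bar> \<le> e / 2" by (rule eventually_sequentially_seg[THEN iffD2])
    have "filterlim (\<lambda>n. real (degree (P n))) at_top sequentially"
      by (rule filterlim_compose[OF filterlim_real_sequentially deg_top])
    from real_tendsto_divide_at_top[OF tendsto_const this]
    have "(\<lambda>n. 2 * C / real (degree (P n))) \<longlonglongrightarrow> 0" .
    from order_tendstoD(2)[OF LIMSEQ_ignore_initial_segment[OF this, of M], of "e / 2"] e
    have 2: "\<forall>\<^sub>F n in sequentially. 2 * C / real (degree (P (n + M))) < e / 2" by simp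
    from 1 2 show ?thesis
    proof eventually_elim
      case (elim n)
      show ?case
      proof
        fix z
        have "\<bar>G n z - f (n + N2) z\<bar> \<le> 2 * C / real (degree (P (n + M)))"
          using escape_rate.dynamical_green_near_first_step[OF escape, of n z] unfolding G_def f M_def by (simp add: add.assoc)
        moreover have "\<bar>f (n + N2) z - g z\<bar> \<le> e / 2" using elim by blast
        ultimately show "\<bar>G n z - ?g z\<bar> \<le> e" using elim(2) unfolding g by linarith
      qed
    qed
  qed
  have "(\<lambda>n. Linf_norm (\<lambda>z. G n z - ?g z)) \<longlonglongrightarrow> 0"
    by (rule Linf_norm_tendsto_0[of 0]) (use G_lim G_meas borel_measurable_continuous_onI[OF g_cont] in auto)
  then have A: "(\<lambda>n. Linf_norm (\<lambda>z. dynamical_green (?p n) z - ?g z)) \<longlonglongrightarrow> 0"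
    unfolding G_def by (rule LIMSEQ_offset)
  have B': "weak_star_tendsto (\<lambda>n. brolin_measure (?p (n + M))) ?\<mu> sequentially"
  proof (rule weak_star_tendsto_of_potentials[OF _ \<mu> E G_meas g_cont _ green_eq G_lim])
    show "brolin_measure (?p (n + M)) \<in> prob_measures_on (cball 0 (exp (log_plus (exp (2 * C) + 1) + 4 * C)))" for n
      using escape_rate.brolin_measure(1)[OF escape monic] by (simp add: escape_rate.support_radius_def[OF escape])
    show "(LINT z|brolin_measure (?p (n + M)). \<phi> z) = (LINT z|lborel. G n z * laplacian \<phi> z) / (2 * pi)" if "test_function \<phi>" for \<phi> n
      unfolding G_def by (rule escape_rate.brolin_measure(2)[OF escape monic that])
  qed
  have B: "weak_star_tendsto (\<lambda>n. brolin_measure (?p n)) ?\<mu> sequentially"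
    unfolding weak_star_tendsto_def
    by (intro allI impI, rule LIMSEQ_offset[where k = M]) (use B' in \<open>unfold weak_star_tendsto_def, blast\<close>)
  \<comment> \<open>Limits pass to the finer filter.\<close>
  have le: "along_nonlinear P \<le> sequentially" unfolding along_nonlinear_def by (rule inf_le1)
  show ?thesis
    using tendsto_mono[OF le A] B tendsto_mono[OF le] unfolding weak_star_tendsto_def by blast
qed

end
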